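(* Let $\mathbb K$ be a field, $k\ge1$, and $x\in\mathbb K$. The Motzkin algebra $\mathsf M_k(x)$ is semisimple if and only if $u_j(x-1)\ne0$ for all $1\le j\le k-1$; equivalently, iff $x\neq 2\cos\!\big(\frac{\pi m}{j+1}\big)+1$ (interpreted via the roots of $u_j(y-1)$ in $\mathbb K$) for all $1\le j\le k-1$, $1\le m\le j$.
   Context: A Motzkin $k$-diagram has top vertices $1,\dots,k$ and bottom vertices $1',\dots,k'$, edges each joining two distinct vertices, each vertex on at most one edge, edges planar (drawable inside the rectangle without crossing). $\mathsf M_k(x)$ is the free $\mathbb K$-module on Motzkin $k$-diagrams with product: place $d_1$ above $d_2$, identifying bottom vertices of $d_1$ with top vertices of $d_2$; let $d_3$ join two outer vertices iff they are connected by a path; then $d_1d_2=x^\kappa d_3$ where $\kappa$ is the number of closed loops formed in the middle row. Chebyshev polynomials: $u_0(y)=1$, $u_1(y)=y$, $u_m(y)=y\,u_{m-1}(y)-u_{m-2}(y)$ for $m\ge2$. *)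

theory Defs
  imports Main
begin

text \<open>Vertices: T i is the top vertex i, B i is the bottom vertex i', for 1 <= i <= k.\<close>
datatype vtx = T nat | B nat

definition verts :: "nat \<Rightarrow> vtx set" where
  "verts k = {T i | i. 1 \<le> i \<and> i \<le> k} \<union> {B i | i. 1 \<le> i \<and> i \<le> k}"

text \<open>Position of a vertex when walking around the boundary of the rectangle:
  top vertices 1..k left to right, then bottom vertices k'..1' right to left.\<close>
fun bpos :: "nat \<Rightarrow> vtx \<Rightarrow> nat" where
  "bpos k (T i) = i"
| "bpos k (B i) = 2 * k + 1 - i"

text \<open>A diagram is a set of edges, each edge a 2-element set of vertices.
  Planarity (drawable inside the rectangle without crossings) means no two
  edges have interleaving endpoints along the boundary.\<close>
definition motzkin_diagram :: "nat \<Rightarrow> vtx set set \<Rightarrow> bool" where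
  "motzkin_diagram k D \<longleftrightarrow>
     (\<forall>e\<in>D. \<exists>a b. a \<noteq> b \<and> a \<in> verts k \<and> b \<in> verts k \<and> e = {a, b}) \<and>
     (\<forall>e1\<in>D. \<forall>e2\<in>D. e1 \<noteq> e2 \<longrightarrow> e1 \<inter> e2 = {}) \<and>
     (\<forall>e1\<in>D. \<forall>e2\<in>D. \<forall>a b c d. e1 = {a, b} \<and> e2 = {c, d} \<longrightarrow>
        \<not> (bpos k a < bpos k c \<and> bpos k c < bpos k b \<and> bpos k b < bpos k d))"

definition diagrams :: "nat \<Rightarrow> vtx set set set" where
  "diagrams k = {D. motzkin_diagram k D}"

text \<open>Stacking d1 above d2: layer 0 = top of d1, layer 1 = middle row
  (bottom of d1 identified with top of d2), layer 2 = bottom of d2.\<close>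
fun lift1 :: "vtx \<Rightarrow> nat \<times> nat" where
  "lift1 (T i) = (0, i)" | "lift1 (B i) = (1, i)"

fun lift2 :: "vtx \<Rightarrow> nat \<times> nat" where
  "lift2 (T i) = (1, i)" | "lift2 (B i) = (2, i)"

fun outer :: "vtx \<Rightarrow> nat \<times> nat" where
  "outer (T i) = (0, i)" | "outer (B i) = (2, i)"

definition adj_in :: "(vtx \<Rightarrow> nat \<times> nat) \<Rightarrow> vtx set set \<Rightarrow> nat \<times> nat \<Rightarrow> nat \<times> nat \<Rightarrow> bool" where
  "adj_in f D u v \<longleftrightarrow> (\<exists>e\<in>D. \<exists>a b. e = {a, b} \<and> a \<noteq> b \<and> u = f a \<and> v = f b)"

definition stack_adj :: "vtx set set \<Rightarrow> vtx set set \<Rightarrow> nat \<times> nat \<Rightarrow> nat \<times> nat \<Rightarrow> bool" where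
  "stack_adj D1 D2 u v \<longleftrightarrow> adj_in lift1 D1 u v \<or> adj_in lift2 D2 u v"

definition stack_conn :: "vtx set set \<Rightarrow> vtx set set \<Rightarrow> nat \<times> nat \<Rightarrow> nat \<times> nat \<Rightarrow> bool" where
  "stack_conn D1 D2 = (stack_adj D1 D2)\<^sup>*\<^sup>*"

definition compose :: "nat \<Rightarrow> vtx set set \<Rightarrow> vtx set set \<Rightarrow> vtx set set" where
  "compose k D1 D2 = {{a, b} | a b. a \<in> verts k \<and> b \<in> verts k \<and> a \<noteq> b \<and>
                        stack_conn D1 D2 (outer a) (outer b)}"

definition middle :: "nat \<Rightarrow> (nat \<times> nat) set" where
  "middle k = {(1, i) | i. 1 \<le> i \<and> i \<le> k}"

text \<open>Closed loops in the middle row: connected components lying entirely in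
  the middle row in which every vertex lies on an edge of d1 and on an edge of d2
  (so the component is a cycle rather than a path).\<close>
definition loops :: "nat \<Rightarrow> vtx set set \<Rightarrow> vtx set set \<Rightarrow> (nat \<times> nat) set set" where
  "loops k D1 D2 = {C. \<exists>u\<in>middle k. C = {v. stack_conn D1 D2 u v} \<and> C \<subseteq> middle k \<and>
      (\<forall>v\<in>C. (\<exists>w. adj_in lift1 D1 v w) \<and> (\<exists>w. adj_in lift2 D2 v w))}"

definition num_loops :: "nat \<Rightarrow> vtx set set \<Rightarrow> vtx set set \<Rightarrow> nat" where
  "num_loops k D1 D2 = card (loops k D1 D2)"

text \<open>Elements of the free K-module on Motzkin k-diagrams: coefficient functions
  supported on the set of diagrams.\<close>
definition malg_carrier :: "nat \<Rightarrow> (vtx set set \<Rightarrow> 'a::field) set" where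
  "malg_carrier k = {f. \<forall>D. D \<notin> diagrams k \<longrightarrow> f D = 0}"

definition malg_mult :: "nat \<Rightarrow> 'a::field \<Rightarrow> (vtx set set \<Rightarrow> 'a) \<Rightarrow> (vtx set set \<Rightarrow> 'a) \<Rightarrow> (vtx set set \<Rightarrow> 'a)" where
  "malg_mult k x f g = (\<lambda>D3. \<Sum>D1\<in>diagrams k. \<Sum>D2\<in>diagrams k.
      (if compose k D1 D2 = D3 then f D1 * g D2 * x ^ num_loops k D1 D2 else 0))"

text \<open>Left ideals of the algebra (sub-K-modules closed under left multiplication; closure
  under scalars follows since scalar multiples of the identity lie in the algebra).\<close>
definition malg_left_ideal :: "nat \<Rightarrow> 'a::field \<Rightarrow> (vtx set set \<Rightarrow> 'a) set \<Rightarrow> bool" where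
  "malg_left_ideal k x L \<longleftrightarrow> L \<subseteq> malg_carrier k \<and> (\<lambda>_. 0) \<in> L \<and>
     (\<forall>f\<in>L. \<forall>g\<in>L. (\<lambda>D. f D + g D) \<in> L) \<and>
     (\<forall>a\<in>malg_carrier k. \<forall>f\<in>L. malg_mult k x a f \<in> L)"

definition motzkin_semisimple :: "nat \<Rightarrow> 'a::field \<Rightarrow> bool" where
  "motzkin_semisimple k x \<longleftrightarrow>
     (\<forall>L. malg_left_ideal k x L \<longrightarrow>
        (\<exists>L'. malg_left_ideal k x L' \<and> L \<inter> L' = {\<lambda>_. 0} \<and>
              (\<forall>a\<in>malg_carrier k. \<exists>l\<in>L. \<exists>l'\<in>L'. a = (\<lambda>D. l D + l' D))))"

fun cheb_u :: "nat \<Rightarrow> 'a::comm_ring_1 \<Rightarrow> 'a" where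
  "cheb_u 0 y = 1"
| "cheb_u (Suc 0) y = y"
| "cheb_u (Suc (Suc m)) y = y * cheb_u (Suc m) y - cheb_u m y"

end

theory Submission
  imports Defs
begin

text \<open>
Colour vertices by two colours so that the coloured set is a union of edges. The compatible
colourings of a diagram form a linear relation over the field with two elements, which determines
the diagram; stacking diagrams composes these relations, and the closed loops form a basis of the
kernel of the composition. Associativity of the product and all relations between generators
reduce to statements about these relations, and planarity is the vanishing modulo 4 of an
alternating form on them, so it is inherited by products.

Write \<open>p\<^sub>i\<close> for the identity with strand \<open>i\<close> removed and \<open>t\<^sub>i\<close> for the cup and cap at
\<open>i\<close>, \<open>i + 1\<close>. Since \<open>t\<^sub>i (1 - p\<^sub>i) t\<^sub>i = (x - 1) t\<^sub>i\<close>, the Jones--Wenzl recursion with loop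
parameter \<open>x - 1\<close> produces an idempotent on \<open>n\<close> strands, killed by all diagrams with fewer through
strands, as long as \<open>u\<^sub>1, \<dots>, u\<^sub>n\<^sub>-\<^sub>1\<close> do not vanish at \<open>x - 1\<close>. If none of \<open>u\<^sub>1, \<dots>, u\<^sub>k\<^sub>-\<^sub>1\<close>
vanishes, these idempotents are primitive and orthogonal, generate the unit ideal, and the left
ideals they generate are minimal; so the algebra is a sum of minimal left ideals. If \<open>u\<^sub>j\<close> is the first to
vanish, then the partial trace of the idempotent \<open>g\<close> on \<open>j\<close> strands is zero and \<open>z = g t\<^sub>j g\<close>,
restricted to \<open>j + 1\<close> strands, is nonzero with \<open>z a z = 0\<close> for all \<open>a\<close>, which is impossible in a
semisimple algebra.
\<close>

section \<open>Two partial matchings on one vertex set\<close>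

text \<open>Tracing paths through stacked diagrams makes associativity and loop counts awkward; the
  two-colour relations confine path arguments to one fact: in a union of two matchings, a
  nonisolated end is joined to exactly one other end. Isolated vertices must stay uncoloured, so
  that a path stopping in the middle row carries colour zero, matching the way
  \<open>compose\<close> drops it. A closed loop is one free bit, so the number of loops is the
  exponent of a power of 2, and additivity of loop counts becomes a double count. The parameter
  \<open>x - 1\<close> arises because each position splits into an empty state \<open>p\<close> and
  an occupied state \<open>1 - p\<close>: a loop of value \<open>x\<close> is an empty loop of value
  1 plus an occupied loop of value \<open>x - 1\<close>. The Chebyshev quotients are the partial
  traces of the projectors. No cellular structure is invoked. Instead, a diagram on \<open>n\<close>
  strands other than the identity has an isolated bottom vertex or an innermost bottom arc, hence
  factors through some \<open>p\<close> or \<open>t\<close>, and projectors kill both.\<close>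

lemma even_card_matched:
  assumes "finite X" and match: "\<And>v. v \<in> X \<Longrightarrow> \<exists>w\<in>X. h v w"
    and sym: "\<And>u v. h u v \<Longrightarrow> h v u" and func: "\<And>u v w. h u v \<Longrightarrow> h u w \<Longrightarrow> v = w"
    and irrefl: "\<And>u. \<not> h u u"
  shows "even (card X)"
proof -
  let ?P = "{{v, w} | v w. v \<in> X \<and> w \<in> X \<and> h v w}"
  have U: "\<Union>?P = X"
  proof (intro equalityI subsetI)
    show "v \<in> \<Union>?P" if "v \<in> X" for v using match[OF that] that by auto
  qed auto
  have "2 * card ?P = card (\<Union>?P)"
  proof (rule card_partition)
    show "finite ?P" by (rule finite_subset[of _ "Pow X"]) (use assms(1) in auto)
    show "finite (\<Union>?P)" using U assms(1) by simp
    show "card c = 2" if "c \<in> ?P" for c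
    proof -
      from that obtain v w where "c = {v, w}" "h v w" by auto
      then show ?thesis using irrefl[of v] by (cases "v = w") auto
    qed
    show "c1 \<inter> c2 = {}" if "c1 \<in> ?P" "c2 \<in> ?P" "c1 \<noteq> c2" for c1 c2
    proof -
      from that(1) obtain v w where c1: "c1 = {v, w}" "h v w" by auto
      from that(2) obtain v' w' where c2: "c2 = {v', w'}" "h v' w'" by auto
      have nbrs: "c1 = c2" if "z \<in> c1" "z \<in> c2" for z
      proof -
        have "\<exists>y. c1 = {z, y} \<and> h z y" using c1 sym[OF c1(2)] that(1) by blast
        moreover have "\<exists>y. c2 = {z, y} \<and> h z y" using c2 sym[OF c2(2)] that(2) by blast
        ultimately show ?thesis using func by (elim exE conjE) (drule (1) func, simp)
      qed
      show ?thesis using nbrs that(3) by blast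
    qed
  qed
  then show ?thesis unfolding U by (intro dvdI) (rule HOL.sym)
qed

text \<open>Indexing the two matchings by \<open>bool\<close> lets an alternating walk switch
  matching by negation, and lets one argument serve both matchings.\<close>

locale two_matchings =
  fixes side :: "bool \<Rightarrow> 'v \<Rightarrow> 'v \<Rightarrow> bool"
  assumes sym: "side s u v \<Longrightarrow> side s v u"
    and func: "side s u v \<Longrightarrow> side s u w \<Longrightarrow> v = w"
    and irrefl: "\<not> side s u u"
begin

abbreviation conn :: "'v \<Rightarrow> 'v \<Rightarrow> bool" where
  "conn \<equiv> (\<lambda>u v. side True u v \<or> side False u v)\<^sup>*\<^sup>*"

text \<open>An isolated vertex counts as an end too; a vertex is no end precisely when both
  matchings cover it.\<close>

definition end_vertex :: "'v \<Rightarrow> bool" where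
  "end_vertex v \<longleftrightarrow> (\<exists>s. \<forall>w. \<not> side s v w)"

lemma end_vertex_one_side: "end_vertex v \<Longrightarrow> side s v w \<Longrightarrow> \<not> side (\<not> s) v w'"
  unfolding end_vertex_def by (cases s) (auto simp: ex_bool_eq)

lemma side_conn: "side s u v \<Longrightarrow> conn u v"
  by (cases s) auto

lemma conn_sym: "conn u v \<Longrightarrow> conn v u"
proof (induction rule: rtranclp_induct)
  case (step y z)
  then have "conn z y" using sym by auto
  then show ?case using step.IH by (rule rtranclp_trans)
qed simp

text \<open>The last argument is the matching used by the latest step, so the next step must use the
  other one. The start pretends to have arrived along \<open>s0\<close>, which in the applications
  is a matching that misses \<open>a\<close>.\<close>

inductive walk :: "'v \<Rightarrow> bool \<Rightarrow> nat \<Rightarrow> 'v \<Rightarrow> bool \<Rightarrow> bool" for a s0 where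
  start: "walk a s0 0 a s0"
| step: "walk a s0 n v s \<Longrightarrow> side (\<not> s) v w \<Longrightarrow> walk a s0 (Suc n) w (\<not> s)"

lemma walk_Suc: "walk a s0 (Suc n) w t \<Longrightarrow> \<exists>v. walk a s0 n v (\<not> t) \<and> side t v w"
  by (erule walk.cases) auto

lemma walk_0: "walk a s0 0 w t \<longleftrightarrow> w = a \<and> t = s0"
  by (auto intro: start elim: walk.cases)

lemma walk_det: "walk a s0 n v s \<Longrightarrow> walk a s0 n v' s' \<Longrightarrow> v = v' \<and> s = s'"
proof (induction n arbitrary: v s v' s')
  case (Suc n)
  obtain u where u: "walk a s0 n u (\<not> s)" "side s u v"
    using walk_Suc[OF Suc.prems(1)] by blast
  obtain u' where u': "walk a s0 n u' (\<not> s')" "side s' u' v'"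
    using walk_Suc[OF Suc.prems(2)] by blast
  from Suc.IH[OF u(1) u'(1)] show ?case using u(2) u'(2) func by auto
qed (simp add: walk_0)

lemma walk_prefix: "walk a s0 n v s \<Longrightarrow> m \<le> n \<Longrightarrow> \<exists>v' s'. walk a s0 m v' s'"
proof (induction n arbitrary: v s)
  case (Suc n)
  then show ?case using walk_Suc[OF Suc.prems(1)] by (cases "m = Suc n") (blast, fastforce)
qed auto

text \<open>An edge at the current vertex either continues the alternating walk or is its last step
  reversed; at the start the second case is excluded because \<open>s0\<close> misses
  \<open>a\<close>.\<close>

lemma conn_walk:
  assumes "conn a v" and "\<And>w. \<not> side s0 a w"
  shows "\<exists>n s. walk a s0 n v s"
  using assms(1)
proof (induction rule: rtranclp_induct)
  case base
  then show ?case using start by blast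
next
  case (step y z)
  then obtain n s where w: "walk a s0 n y s" by blast
  obtain t where t: "side t y z" using step.hyps(2) by blast
  show ?case
  proof (cases "t = s")
    case False
    then have "t = (\<not> s)" by auto
    then show ?thesis using t walk.step[OF w] by blast
  next
    case True
    show ?thesis
    proof (cases n)
      case 0
      then show ?thesis using w True t assms(2) by (simp add: walk_0)
    next
      case (Suc m)
      then obtain u where "walk a s0 m u (\<not> s)" "side s u y" using w walk_Suc by blast
      moreover from this(2) have "u = z" using func[of s y u z] sym t True by blast
      ultimately show ?thesis by blast
    qed
  qed
qed

text \<open>The alternating walk from \<open>a\<close> is deterministic and cannot be continued
  beyond another end, so two further ends are reached after the same number of steps.\<close>

lemma at_most_two_ends:
  assumes "conn a b" "conn a c" "b \<noteq> a" "c \<noteq> a" "end_vertex a" "end_vertex b" "end_vertex c"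
  shows "b = c"
proof -
  obtain s0 where s0: "\<And>w. \<not> side s0 a w" using assms(5) unfolding end_vertex_def by blast
  have stuck: "\<not> walk a s0 (Suc n) w t"
    if w: "walk a s0 n v s" and v: "v \<noteq> a" "end_vertex v" for n v s w t
  proof
    assume "walk a s0 (Suc n) w t"
    then obtain v' where v': "walk a s0 n v' (\<not> t)" "side t v' w" using walk_Suc by blast
    then have "v' = v" "s = (\<not> t)" using walk_det w by auto
    obtain m where n: "n = Suc m" using w v(1) by (cases n) (auto simp: walk_0)
    then obtain u where "side s u v" using w walk_Suc by blast
    then have "side s v u" by (rule sym)
    moreover have "side (\<not> s) v w" using v' \<open>v' = v\<close> \<open>s = (\<not> t)\<close> by simp
    ultimately show False using end_vertex_one_side[OF v(2)] by simp
  qed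
  obtain n s where b: "walk a s0 n b s" using conn_walk[OF assms(1) s0] by blast
  obtain m s' where c: "walk a s0 m c s'" using conn_walk[OF assms(2) s0] by blast
  have "\<not> n < m"
    using stuck[OF b assms(3,6)] walk_prefix[OF c] by (metis Suc_leI)
  moreover have "\<not> m < n"
    using stuck[OF c assms(4,7)] walk_prefix[OF b] by (metis Suc_leI)
  ultimately have "n = m" by simp
  then show ?thesis using walk_det b c by blast
qed

text \<open>If \<open>a\<close> were the only end, one matching would be perfect on its component and the
  other perfect on the component without \<open>a\<close>.\<close>

lemma other_end_exists:
  assumes "finite {v. conn a v}" "end_vertex a" "side s a b"
  shows "\<exists>c. conn a c \<and> c \<noteq> a \<and> end_vertex c"
proof (rule ccontr)
  assume none: "\<not> ?thesis"
  let ?C = "{v. conn a v}"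
  have lacks: "\<not> side (\<not> s) a w" for w
    by (rule end_vertex_one_side[OF assms(2,3)])
  have nbr: "\<exists>w\<in>?C. side r v w" if v: "v \<in> ?C" "v \<noteq> a" for v r
  proof -
    obtain w where w: "side r v w" using none v unfolding end_vertex_def by blast
    then have "conn a w" using v(1) side_conn rtranclp_trans[of _ a v w] by blast
    then show ?thesis using w by blast
  qed
  have 1: "even (card ?C)"
  proof (rule even_card_matched[where h = "side s"])
    show "\<exists>w\<in>?C. side s v w" if "v \<in> ?C" for v
      using nbr[OF that] assms(3) side_conn by (cases "v = a") auto
  qed (simp add: assms(1), erule sym, erule (1) func, rule irrefl)
  have 2: "even (card (?C - {a}))"
  proof (rule even_card_matched[where h = "side (\<not> s)"])
    show "\<exists>w\<in>?C - {a}. side (\<not> s) v w" if v: "v \<in> ?C - {a}" for v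
    proof -
      obtain w where w: "w \<in> ?C" "side (\<not> s) v w" using nbr v by blast
      then have "w \<noteq> a" using lacks sym by blast
      then show ?thesis using w by blast
    qed
  qed (simp add: assms(1), erule sym, erule (1) func, rule irrefl)
  have 3: "card ?C = Suc (card (?C - {a}))"
    using assms(1) by (intro card.remove) auto
  show False using 1 2 unfolding 3 even_Suc by blast
qed

end

section \<open>Colourings of diagrams\<close>

definition matching :: "nat \<Rightarrow> vtx set set \<Rightarrow> bool" where
  "matching k D \<longleftrightarrow>
     (\<forall>e\<in>D. \<exists>a b. a \<noteq> b \<and> a \<in> verts k \<and> b \<in> verts k \<and> e = {a, b}) \<and>
     (\<forall>e1\<in>D. \<forall>e2\<in>D. e1 \<noteq> e2 \<longrightarrow> e1 \<inter> e2 = {})"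

lemma verts_simps [simp]: "T i \<in> verts k \<longleftrightarrow> 1 \<le> i \<and> i \<le> k" "B i \<in> verts k \<longleftrightarrow> 1 \<le> i \<and> i \<le> k"
  by (auto simp: verts_def)

lemma matching_edgeE:
  assumes "matching k D" "e \<in> D"
  obtains a b where "a \<noteq> b" "a \<in> verts k" "b \<in> verts k" "e = {a, b}"
  using assms unfolding matching_def by meson

lemma matching_edgeD:
  assumes "matching k D" "{a, b} \<in> D"
  shows "a \<noteq> b" "a \<in> verts k" "b \<in> verts k"
  using matching_edgeE[OF assms] by (metis doubleton_eq_iff)+

lemma matching_unique:
  assumes "matching k D" "{a, b} \<in> D" "{a, c} \<in> D"
  shows "b = c"
proof -
  have "{a, b} = {a, c}"
    using assms unfolding matching_def by (metis disjoint_iff insertI1)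
  then show ?thesis by (auto simp: doubleton_eq_iff)
qed

lemma matching_cover:
  assumes "matching k D"
  shows "v \<in> \<Union>D \<longleftrightarrow> (\<exists>w. {v, w} \<in> D)"
proof
  assume "v \<in> \<Union>D"
  then obtain e where e: "e \<in> D" "v \<in> e" by blast
  obtain a b where "e = {a, b}" using matching_edgeE[OF assms e(1)] by metis
  then show "\<exists>w. {v, w} \<in> D" using e by (auto simp: insert_commute)
qed auto

text \<open>A colouring selects vertices; it is compatible with a diagram if the selected set is a union
  of edges. Over the field with two elements these sets form a subspace, and stacking diagrams
  becomes composition of linear relations.\<close>

fun colour :: "nat set \<Rightarrow> nat set \<Rightarrow> vtx \<Rightarrow> bool" where
  "colour S R (T i) = (i \<in> S)"
| "colour S R (B i) = (i \<in> R)"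

text \<open>The first condition keeps isolated vertices uncoloured. The relation is then spanned by
  the indicators of the edges.\<close>

definition colrel :: "vtx set set \<Rightarrow> (nat set \<times> nat set) set" where
  "colrel D = {(S, R). (\<forall>v. colour S R v \<longrightarrow> v \<in> \<Union>D) \<and>
                       (\<forall>a b. {a, b} \<in> D \<longrightarrow> colour S R a = colour S R b)}"

lemma colrel_iff:
  assumes "matching k D"
  shows "(S, R) \<in> colrel D \<longleftrightarrow> (\<forall>v. colour S R v \<longrightarrow> (\<exists>w. {v, w} \<in> D)) \<and>
           (\<forall>a b. {a, b} \<in> D \<longrightarrow> colour S R a = colour S R b)"
  unfolding colrel_def mem_Collect_eq prod.case matching_cover[OF assms] ..

lemma colrel_subset:
  assumes "matching k D" "(S, R) \<in> colrel D"
  shows "S \<subseteq> {1..k}" "R \<subseteq> {1..k}"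
proof -
  have v: "v \<in> verts k" if "colour S R v" for v
    using assms(2) that matching_edgeD[OF assms(1)] unfolding colrel_iff[OF assms(1)] by blast
  show "S \<subseteq> {1..k}" using v[of "T _"] by auto
  show "R \<subseteq> {1..k}" using v[of "B _"] by auto
qed

lemma colrel_finite:
  assumes "matching k D" "(S, R) \<in> colrel D"
  shows "finite S" "finite R"
  using colrel_subset[OF assms] finite_subset by blast+

lemma colrel_empty: "({}, {}) \<in> colrel D"
proof -
  have "\<not> colour {} {} v" for v by (cases v) auto
  then show ?thesis unfolding colrel_def by simp
qed

lemma colour_sym_diff:
  "colour (sym_diff S S') (sym_diff R R') v \<longleftrightarrow> colour S R v \<noteq> colour S' R' v"
  by (cases v) auto

lemma colrel_sym_diff:
  assumes "(S, R) \<in> colrel D" "(S', R') \<in> colrel D"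
  shows "(sym_diff S S', sym_diff R R') \<in> colrel D"
  using assms unfolding colrel_def colour_sym_diff mem_Collect_eq prod.case by blast

definition tops :: "vtx set \<Rightarrow> nat set" where "tops U = {i. T i \<in> U}"
definition bots :: "vtx set \<Rightarrow> nat set" where "bots U = {i. B i \<in> U}"

lemma colour_tops_bots [simp]: "colour (tops U) (bots U) v \<longleftrightarrow> v \<in> U"
  by (cases v) (auto simp: tops_def bots_def)

lemma colrel_edge:
  assumes "matching k D" "e \<in> D"
  shows "(tops e, bots e) \<in> colrel D"
proof -
  have "a \<in> e \<longleftrightarrow> b \<in> e" if "{a, b} \<in> D" for a b
  proof (cases "{a, b} = e")
    case False
    then have "{a, b} \<inter> e = {}" using assms that unfolding matching_def by simp
    then show ?thesis by blast
  qed blast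
  then show ?thesis using assms(2) unfolding colrel_def by auto
qed

text \<open>The indicator of an edge \<open>{a, b}\<close> of one diagram is compatible with the
  other, so there \<open>a\<close> has a partner and this partner is coloured, hence equal to
  \<open>b\<close>.\<close>

lemma colrel_inj:
  assumes "matching k D" "matching k D'" "colrel D = colrel D'"
  shows "D = D'"
proof -
  have "D \<subseteq> D'" if m: "matching k D" and m': "matching k D'" and eq: "colrel D = colrel D'" for D D'
  proof
    fix e assume e: "e \<in> D"
    obtain a b where ab: "e = {a, b}" "a \<noteq> b" using matching_edgeE[OF m e] by metis
    have c: "(tops e, bots e) \<in> colrel D'" using colrel_edge[OF m e] eq by simp
    then obtain w where w: "{a, w} \<in> D'" unfolding colrel_iff[OF m'] using ab by auto
    then have "w \<in> e" using c ab unfolding colrel_iff[OF m'] by auto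
    moreover have "w \<noteq> a" using matching_edgeD[OF m' w] by simp
    ultimately show "e \<in> D'" using ab w by auto
  qed
  then show ?thesis using assms by (metis subset_antisym)
qed

section \<open>Stacking two diagrams\<close>

definition stack_side :: "vtx set set \<Rightarrow> vtx set set \<Rightarrow> bool \<Rightarrow> nat \<times> nat \<Rightarrow> nat \<times> nat \<Rightarrow> bool" where
  "stack_side D1 D2 s = (if s then adj_in lift1 D1 else adj_in lift2 D2)"

lemma lift1_inj [simp]: "lift1 a = lift1 b \<longleftrightarrow> a = b" by (cases a; cases b) auto
lemma lift2_inj [simp]: "lift2 a = lift2 b \<longleftrightarrow> a = b" by (cases a; cases b) auto
lemma outer_inj [simp]: "outer a = outer b \<longleftrightarrow> a = b" by (cases a; cases b) auto

lemma adj_in_iff: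
  assumes "matching k D"
  shows "adj_in f D u v \<longleftrightarrow> (\<exists>a b. {a, b} \<in> D \<and> u = f a \<and> v = f b)"
  using matching_edgeD[OF assms] unfolding adj_in_def by blast

fun lab :: "nat set \<Rightarrow> nat set \<Rightarrow> nat set \<Rightarrow> nat \<times> nat \<Rightarrow> bool" where
  "lab S M R (l, i) = (if l = 0 then i \<in> S else if l = 1 then i \<in> M else i \<in> R)"

lemma lab_lift [simp]:
  "lab S M R (lift1 v) = colour S M v" "lab S M R (lift2 v) = colour M R v"
  "lab S M R (outer v) = colour S R v"
  by (cases v; simp)+

locale stack =
  fixes k :: nat and D1 D2 :: "vtx set set"
  assumes m1: "matching k D1" and m2: "matching k D2"
begin

lemma side_True: "stack_side D1 D2 True u v \<longleftrightarrow> (\<exists>a b. {a, b} \<in> D1 \<and> u = lift1 a \<and> v = lift1 b)"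
  by (simp add: stack_side_def adj_in_iff[OF m1])

lemma side_False: "stack_side D1 D2 False u v \<longleftrightarrow> (\<exists>a b. {a, b} \<in> D2 \<and> u = lift2 a \<and> v = lift2 b)"
  by (simp add: stack_side_def adj_in_iff[OF m2])

sublocale two_matchings "stack_side D1 D2"
proof
  fix s u v w
  show "stack_side D1 D2 s u v \<Longrightarrow> stack_side D1 D2 s v u"
    by (cases s) (auto simp: side_True side_False, (metis insert_commute)+)
  show "stack_side D1 D2 s u v \<Longrightarrow> stack_side D1 D2 s u w \<Longrightarrow> v = w"
    using matching_unique[OF m1] matching_unique[OF m2]
    by (cases s) (auto simp: side_True side_False)
  show "\<not> stack_side D1 D2 s u u"
    using matching_edgeD[OF m1] matching_edgeD[OF m2]
    by (cases s) (auto simp: side_True side_False)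
qed

lemma stack_conn_eq: "stack_conn D1 D2 = conn"
proof -
  have "stack_adj D1 D2 = (\<lambda>u v. stack_side D1 D2 True u v \<or> stack_side D1 D2 False u v)"
    by (intro ext) (simp add: stack_adj_def stack_side_def)
  then show ?thesis by (simp add: stack_conn_def)
qed

lemma lift1_side: "stack_side D1 D2 True (lift1 a) w \<longleftrightarrow> (\<exists>b. {a, b} \<in> D1 \<and> w = lift1 b)"
  by (auto simp: side_True)

lemma lift2_side: "stack_side D1 D2 False (lift2 a) w \<longleftrightarrow> (\<exists>b. {a, b} \<in> D2 \<and> w = lift2 b)"
  by (auto simp: side_False)

lemma side_box: "stack_side D1 D2 s u v \<Longrightarrow> v \<in> {0, 1, 2} \<times> {1..k}"
proof (cases s)
  case True
  assume "stack_side D1 D2 s u v"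
  then obtain a b where "{a, b} \<in> D1" "v = lift1 b" using True side_True by auto
  then show ?thesis using matching_edgeD(3)[OF m1, of a b] by (cases b) auto
next
  case False
  assume "stack_side D1 D2 s u v"
  then obtain a b where "{a, b} \<in> D2" "v = lift2 b" using False side_False by auto
  then show ?thesis using matching_edgeD(3)[OF m2, of a b] by (cases b) auto
qed

lemma conn_box: "conn u v \<Longrightarrow> v = u \<or> v \<in> {0, 1, 2} \<times> {1..k}"
  by (induction rule: rtranclp_induct) (use side_box in blast)+

lemma finite_component: "finite {v. conn u v}"
  by (rule finite_subset[of _ "insert u ({0, 1, 2} \<times> {1..k})"]) (use conn_box in blast, simp)

text \<open>A top vertex is never met by \<open>D2\<close> and a bottom vertex never by
  \<open>D1\<close>.\<close>

lemma outer_end: "end_vertex (outer v)"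
proof (cases v)
  case (T i)
  have "\<not> stack_side D1 D2 False (0, i) w" for w
  proof
    assume "stack_side D1 D2 False (0, i) w"
    then obtain a where "(0, i) = lift2 a" using side_False by blast
    then show False by (cases a) auto
  qed
  then show ?thesis unfolding end_vertex_def T outer.simps by blast
next
  case (B i)
  have "\<not> stack_side D1 D2 True (2, i) w" for w
  proof
    assume "stack_side D1 D2 True (2, i) w"
    then obtain a where "(2, i) = lift1 a" using side_True by blast
    then show False by (cases a) auto
  qed
  then show ?thesis unfolding end_vertex_def B outer.simps by blast
qed

lemma compose_edge:
  "{a, b} \<in> compose k D1 D2 \<longleftrightarrow>
     a \<in> verts k \<and> b \<in> verts k \<and> a \<noteq> b \<and> conn (outer a) (outer b)"
  unfolding compose_def stack_conn_eq
  by (auto simp: doubleton_eq_iff dest: conn_sym)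

text \<open>Outer vertices are ends of their components, so each is joined to at most one other
  outer vertex.\<close>

lemma matching_compose: "matching k (compose k D1 D2)"
  unfolding matching_def
proof (intro conjI ballI impI)
  fix e assume "e \<in> compose k D1 D2"
  then show "\<exists>a b. a \<noteq> b \<and> a \<in> verts k \<and> b \<in> verts k \<and> e = {a, b}"
    unfolding compose_def by blast
next
  fix e1 e2 assume e: "e1 \<in> compose k D1 D2" "e2 \<in> compose k D1 D2" "e1 \<noteq> e2"
  have dbl: "\<exists>b. e = {z, b}" if "e \<in> compose k D1 D2" "z \<in> e" for e z
    using that unfolding compose_def by blast
  show "e1 \<inter> e2 = {}"
  proof (rule ccontr)
    assume "e1 \<inter> e2 \<noteq> {}"
    then obtain z where z: "z \<in> e1" "z \<in> e2" by blast
    obtain b c where bc: "e1 = {z, b}" "e2 = {z, c}" using dbl e z by meson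
    have "outer b = outer c"
    proof (rule at_most_two_ends)
      show "conn (outer z) (outer b)" "conn (outer z) (outer c)" "outer b \<noteq> outer z" "outer c \<noteq> outer z"
        using e(1,2) unfolding bc compose_edge by auto
    qed (rule outer_end)+
    then show False using e(3) bc by simp
  qed
qed

lemma lab_conn:
  assumes "(S, M) \<in> colrel D1" "(M, R) \<in> colrel D2" "conn u v"
  shows "lab S M R u = lab S M R v"
  using assms(3)
proof (induction rule: rtranclp_induct)
  case (step y z)
  have "lab S M R y = lab S M R z"
    using step.hyps(2) assms(1,2) unfolding colrel_iff[OF m1] colrel_iff[OF m2] side_True side_False
    by auto
  then show ?case using step.IH by simp
qed simp

lemma lab_covered:
  assumes "(S, M) \<in> colrel D1" "(M, R) \<in> colrel D2"
  shows "colour S M v \<Longrightarrow> \<exists>w. stack_side D1 D2 True (lift1 v) w"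
    and "colour M R v \<Longrightarrow> \<exists>w. stack_side D1 D2 False (lift2 v) w"
  using assms unfolding colrel_iff[OF m1] colrel_iff[OF m2] lift1_side lift2_side by blast+

text \<open>The colour is constant along paths. For a coloured outer vertex, the other end of its
  path is coloured too; in the middle row it would then be covered by both diagrams and be no end,
  so it lies in an outer row.\<close>

lemma colrel_compose1:
  assumes "(S, M) \<in> colrel D1" "(M, R) \<in> colrel D2"
  shows "(S, R) \<in> colrel (compose k D1 D2)"
  unfolding colrel_iff[OF matching_compose]
proof (intro conjI allI impI)
  fix a b assume "{a, b} \<in> compose k D1 D2"
  then have "conn (outer a) (outer b)" by (simp add: compose_edge)
  then show "colour S R a = colour S R b" using lab_conn[OF assms] by fastforce
next
  fix v assume v: "colour S R v"
  have "\<exists>s w. stack_side D1 D2 s (outer v) w"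
  proof (cases v)
    case (T i)
    then show ?thesis using v lab_covered(1)[OF assms, of "T i"] by auto
  next
    case (B i)
    then show ?thesis using v lab_covered(2)[OF assms, of "B i"] by auto
  qed
  then obtain s w where sw: "stack_side D1 D2 s (outer v) w" by blast
  then obtain c where c: "conn (outer v) c" "c \<noteq> outer v" "end_vertex c"
    using other_end_exists[OF finite_component outer_end] by blast
  have lc: "lab S M R c" using lab_conn[OF assms c(1)] v by simp
  have box: "c \<in> {0, 1, 2} \<times> {1..k}" using conn_box[OF c(1)] c(2) by blast
  have vv: "v \<in> verts k"
    using side_box[OF sym[OF sw]] by (cases v) auto
  obtain l i where li: "c = (l, i)" by (cases c)
  have "l \<noteq> 1"
  proof
    assume "l = 1"
    then have i: "i \<in> M" "c = lift1 (B i)" "c = lift2 (T i)" using lc li by auto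
    have "\<exists>w. stack_side D1 D2 True c w" "\<exists>w. stack_side D1 D2 False c w"
      using lab_covered[OF assms] i by (metis colour.simps)+
    then show False using c(3) unfolding end_vertex_def ex_bool_eq by blast
  qed
  then have "\<exists>w. c = outer w \<and> w \<in> verts k"
    using box li by (auto intro: exI[of _ "T i"] exI[of _ "B i"])
  then obtain w where "c = outer w" "w \<in> verts k" by blast
  then have "{v, w} \<in> compose k D1 D2" using c vv by (auto simp: compose_edge)
  then show "\<exists>w. {v, w} \<in> compose k D1 D2" by blast
qed

lemma colrel_compose2:
  assumes "(S, R) \<in> colrel (compose k D1 D2)"
  obtains M where "(S, M) \<in> colrel D1" "(M, R) \<in> colrel D2"
proof -
  \<comment> \<open>Colours spread from the outer rows along paths; loops and paths that reach no
    outer vertex stay uncoloured.\<close>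
  define M where "M = {i. \<exists>a. colour S R a \<and> conn (outer a) (1, i)}"
  note col = assms[unfolded colrel_iff[OF matching_compose]]
  have lab: "lab S M R u \<longleftrightarrow> (\<exists>a. colour S R a \<and> conn (outer a) u)" if "u = lift1 v \<or> u = lift2 v" for u v
  proof (cases "\<exists>i. u = (1, i)")
    case True
    then show ?thesis by (auto simp: M_def)
  next
    case False
    then have "u = outer v" using that by (cases v) auto
    then obtain w where w: "u = outer w" by blast
    have "colour S R w" if "colour S R a" "conn (outer a) (outer w)" for a
    proof (cases "a = w")
      case neq: False
      have "a \<in> verts k" using that(1) col matching_edgeD[OF matching_compose] by blast
      moreover from this have "w \<in> verts k" using conn_box[OF that(2)] neq by (cases w; cases a) auto
      ultimately have "{a, w} \<in> compose k D1 D2" using that neq by (auto simp: compose_edge)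
      then show ?thesis using that(1) col by blast
    qed (use that in simp)
    then show ?thesis using w by auto
  qed
  \<comment> \<open>The path from a coloured outer vertex already has an outer vertex as its second
    end, so every middle vertex on it is interior.\<close>
  have not_end: "\<exists>w. stack_side D1 D2 s (1, i) w" if i: "i \<in> M" for i s
  proof (rule ccontr)
    assume "\<not> ?thesis"
    then have e: "end_vertex (1, i)" unfolding end_vertex_def by blast
    from i obtain a where a: "colour S R a" "conn (outer a) (1, i)" unfolding M_def by blast
    then obtain b where "{a, b} \<in> compose k D1 D2" using col by blast
    then have b: "a \<noteq> b" "conn (outer a) (outer b)" by (auto simp: compose_edge)
    have "outer b = (1, i)"
      using a b e by (intro at_most_two_ends[of "outer a"] outer_end) (auto, cases a, auto)
    then show False by (cases b) auto
  qed
  have outer_side: "\<exists>s w. stack_side D1 D2 s (outer a) w" if a: "colour S R a" for a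
  proof -
    from a col obtain b where "{a, b} \<in> compose k D1 D2" by blast
    then have "conn (outer a) (outer b)" "outer a \<noteq> outer b" by (auto simp: compose_edge)
    then show ?thesis
    proof (cases rule: converse_rtranclpE)
      case (step y)
      from step(1) show ?thesis by blast
    qed simp
  qed
  have pres: "lab S M R u = lab S M R v" if "stack_side D1 D2 s u v" for s u v
  proof -
    have uv: "conn u v" "conn v u" using side_conn that conn_sym by blast+
    have "\<exists>a. u = lift1 a \<or> u = lift2 a" "\<exists>a. v = lift1 a \<or> v = lift2 a"
      using that by (cases s; auto simp: side_True side_False)+
    then obtain a b where "u = lift1 a \<or> u = lift2 a" "v = lift1 b \<or> v = lift2 b" by blast
    from lab[OF this(1)] lab[OF this(2)] show ?thesis using rtranclp_trans uv by meson
  qed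
  have "(S, M) \<in> colrel D1"
    unfolding colrel_iff[OF m1]
  proof (intro conjI allI impI)
    fix a b assume "{a, b} \<in> D1"
    then have "stack_side D1 D2 True (lift1 a) (lift1 b)" by (auto simp: side_True)
    from pres[OF this] show "colour S M a = colour S M b" by simp
  next
    fix v assume v: "colour S M v"
    have "\<exists>w. stack_side D1 D2 True (lift1 v) w"
    proof (cases v)
      case (T i)
      then have "colour S R (T i)" using v by simp
      from outer_side[OF this] obtain s w where "stack_side D1 D2 s (0, i) w" by auto
      moreover have "s"
      proof (rule ccontr)
        assume "\<not> s"
        then obtain a where "(0, i) = lift2 a" using calculation side_False by auto
        then show False by (cases a) auto
      qed
      ultimately have "stack_side D1 D2 True (lift1 v) w" using T by simp
      then show ?thesis by blast
    next
      case (B i)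
      then show ?thesis using v not_end by simp
    qed
    then show "\<exists>w. {v, w} \<in> D1" using lift1_side by blast
  qed
  moreover have "(M, R) \<in> colrel D2"
    unfolding colrel_iff[OF m2]
  proof (intro conjI allI impI)
    fix a b assume "{a, b} \<in> D2"
    then have "stack_side D1 D2 False (lift2 a) (lift2 b)" by (auto simp: side_False)
    from pres[OF this] show "colour M R a = colour M R b" by simp
  next
    fix v assume v: "colour M R v"
    have "\<exists>w. stack_side D1 D2 False (lift2 v) w"
    proof (cases v)
      case (B i)
      then have "colour S R (B i)" using v by simp
      from outer_side[OF this] obtain s w where "stack_side D1 D2 s (2, i) w" by auto
      moreover have "\<not> s"
      proof
        assume "s"
        then obtain a where "(2, i) = lift1 a" using calculation side_True by auto
        then show False by (cases a) auto
      qed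
      ultimately have "stack_side D1 D2 False (lift2 v) w" using B by simp
      then show ?thesis by blast
    next
      case (T i)
      then show ?thesis using v not_end by simp
    qed
    then show "\<exists>w. {v, w} \<in> D2" using lift2_side by blast
  qed
  ultimately show ?thesis by (rule that)
qed

lemma colrel_compose: "colrel (compose k D1 D2) = colrel D1 O colrel D2"
  using colrel_compose1 colrel_compose2 by (auto simp: relcomp_unfold) metis

end

section \<open>Counting closed loops by colourings of the middle row\<close>

context stack
begin

definition mid_colourings :: "nat set \<Rightarrow> nat set \<Rightarrow> nat set set" where
  "mid_colourings S R = {M. (S, M) \<in> colrel D1 \<and> (M, R) \<in> colrel D2}"

lemma finite_mid_colourings: "finite (mid_colourings S R)"
proof (rule finite_subset)
  show "mid_colourings S R \<subseteq> Pow {1..k}"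
    unfolding mid_colourings_def using colrel_subset(2)[OF m1] by blast
qed simp

lemma loops_iff:
  "C \<in> loops k D1 D2 \<longleftrightarrow> (\<exists>i\<in>{1..k}. C = {v. conn (1, i) v}) \<and> C \<subseteq> {1} \<times> {1..k} \<and>
     (\<forall>v\<in>C. \<forall>s. \<exists>w. stack_side D1 D2 s v w)"
proof -
  have mid: "middle k = {1} \<times> {1..k}" by (auto simp: middle_def)
  show ?thesis
    unfolding loops_def stack_conn_eq mid by (auto simp: stack_side_def all_bool_eq)
qed

lemma component_eq:
  assumes "conn u v"
  shows "{w. conn u w} = {w. conn v w}"
  using rtranclp_trans[OF assms] rtranclp_trans[OF conn_sym[OF assms]] by blast

lemma loop_component: "C \<in> loops k D1 D2 \<Longrightarrow> v \<in> C \<Longrightarrow> C = {w. conn v w}"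
  unfolding loops_iff using component_eq by blast

lemma finite_loops: "finite (loops k D1 D2)"
  by (rule finite_subset[of _ "Pow ({1} \<times> {1..k})"]) (use loops_iff in blast, simp)

text \<open>Compatible colourings of the middle row alone are exactly the unions of closed loops.\<close>

lemma card_mid_colourings_empty: "card (mid_colourings {} {}) = 2 ^ num_loops k D1 D2"
proof -
  let ?h = "\<lambda>L. {i. (1, i) \<in> \<Union>L}"
  have "bij_betw ?h (Pow (loops k D1 D2)) (mid_colourings {} {})"
  proof (rule bij_betwI')
    fix L L' assume L: "L \<in> Pow (loops k D1 D2)" and L': "L' \<in> Pow (loops k D1 D2)"
    have sub: "L \<subseteq> L'" if "?h L = ?h L'" "L \<subseteq> loops k D1 D2" "L' \<subseteq> loops k D1 D2" for L L'
    proof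
      fix C assume C: "C \<in> L"
      then have Cl: "C \<in> loops k D1 D2" using that(2) by blast
      then obtain i where i: "C = {v. conn (1, i) v}" unfolding loops_iff by blast
      then have "(1, i) \<in> C" by simp
      then have "i \<in> ?h L" using C by blast
      then have "i \<in> ?h L'" unfolding that(1) .
      then obtain C' where C': "C' \<in> L'" "(1, i) \<in> C'" by blast
      then have "C' = C" using loop_component that(3) i by blast
      then show "C \<in> L'" using C' by simp
    qed
    show "(?h L = ?h L') = (L = L')"
      using sub[of L L'] sub[of L' L] L L' by auto
  next
    fix L assume L: "L \<in> Pow (loops k D1 D2)"
    let ?M = "?h L"
    have inL: "lab {} ?M {} u \<longleftrightarrow> u \<in> \<Union>L" for u
    proof (cases u)
      case (Pair l i)
      have "\<Union>L \<subseteq> {1} \<times> {1..k}" using L loops_iff by blast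
      then have "u \<in> \<Union>L \<Longrightarrow> l = 1" using Pair by blast
      then show ?thesis using Pair by auto
    qed
    have nb: "\<exists>w. stack_side D1 D2 s u w" if "u \<in> \<Union>L" for s u
      using that L loops_iff by blast
    have pres: "u \<in> \<Union>L \<longleftrightarrow> v \<in> \<Union>L" if "stack_side D1 D2 s u v" for s u v
    proof -
      have "v \<in> \<Union>L" if uv: "conn u v" and u: "u \<in> \<Union>L" for u v
      proof -
        obtain C where C: "C \<in> L" "u \<in> C" using u by blast
        then have "C = {w. conn u w}" using loop_component L by blast
        then show ?thesis using uv C by blast
      qed
      then show ?thesis using side_conn[OF that] conn_sym by blast
    qed
    have "({}, ?M) \<in> colrel D1"
      unfolding colrel_iff[OF m1]
    proof (intro conjI allI impI)
      fix v assume "colour {} ?M v"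
      then have "lift1 v \<in> \<Union>L" using inL[of "lift1 v"] by simp
      from nb[OF this] show "\<exists>w. {v, w} \<in> D1" using lift1_side by blast
    next
      fix a b assume "{a, b} \<in> D1"
      then have "stack_side D1 D2 True (lift1 a) (lift1 b)" by (auto simp: side_True)
      from pres[OF this] show "colour {} ?M a = colour {} ?M b"
        using inL[of "lift1 a"] inL[of "lift1 b"] by simp
    qed
    moreover have "(?M, {}) \<in> colrel D2"
      unfolding colrel_iff[OF m2]
    proof (intro conjI allI impI)
      fix v assume "colour ?M {} v"
      then have "lift2 v \<in> \<Union>L" using inL[of "lift2 v"] by simp
      from nb[OF this] show "\<exists>w. {v, w} \<in> D2" using lift2_side by blast
    next
      fix a b assume "{a, b} \<in> D2"
      then have "stack_side D1 D2 False (lift2 a) (lift2 b)" by (auto simp: side_False)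
      from pres[OF this] show "colour ?M {} a = colour ?M {} b"
        using inL[of "lift2 a"] inL[of "lift2 b"] by simp
    qed
    ultimately show "?M \<in> mid_colourings {} {}" unfolding mid_colourings_def by blast
  next
    fix M assume "M \<in> mid_colourings {} {}"
    then have M: "({}, M) \<in> colrel D1" "(M, {}) \<in> colrel D2" unfolding mid_colourings_def by auto
    let ?L = "(\<lambda>i. {v. conn (1, i) v}) ` M"
    have Mk: "M \<subseteq> {1..k}" using colrel_subset[OF m1 M(1)] by simp
    have comp: "v \<in> {1} \<times> M" if "i \<in> M" "conn (1, i) v" for i v
    proof -
      have "lab {} M {} v" using lab_conn[OF M that(2)] that(1) by simp
      then show ?thesis by (cases v) (auto split: if_splits)
    qed
    have "C \<in> loops k D1 D2" if "C \<in> ?L" for C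
      unfolding loops_iff
    proof (intro conjI ballI allI)
      show "\<exists>i\<in>{1..k}. C = {v. conn (1, i) v}" using that Mk by blast
      show "C \<subseteq> {1} \<times> {1..k}" using that comp Mk by blast
      fix v s assume "v \<in> C"
      then have "v \<in> {1} \<times> M" using that comp by blast
      then obtain j where j: "v = (1, j)" "j \<in> M" by blast
      show "\<exists>w. stack_side D1 D2 s v w"
        using lab_covered(1)[OF M, of "B j"] lab_covered(2)[OF M, of "T j"] j
        by (cases s) auto
    qed
    then have "?L \<in> Pow (loops k D1 D2)" by blast
    moreover have "M = ?h ?L"
    proof (intro equalityI subsetI)
      fix i assume "i \<in> ?h ?L"
      then obtain j where "j \<in> M" "conn (1, j) (1, i)" by blast
      then show "i \<in> M" using comp by blast
    qed auto
    ultimately show "\<exists>L\<in>Pow (loops k D1 D2). M = ?h L" by blast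
  qed
  from bij_betw_same_card[OF this] show ?thesis
    by (simp add: card_Pow finite_loops num_loops_def)
qed

text \<open>A nonempty fibre is a translate, under symmetric difference, of the solutions with blank
  outer rows.\<close>

lemma card_mid_colourings:
  "card (mid_colourings S R) =
     (if (S, R) \<in> colrel (compose k D1 D2) then 2 ^ num_loops k D1 D2 else 0)"
proof (cases "(S, R) \<in> colrel (compose k D1 D2)")
  case True
  then obtain M0 where M0: "(S, M0) \<in> colrel D1" "(M0, R) \<in> colrel D2" by (rule colrel_compose2)
  have "bij_betw (\<lambda>M. sym_diff M M0) (mid_colourings {} {}) (mid_colourings S R)"
  proof (rule bij_betw_byWitness[where f' = "\<lambda>M. sym_diff M M0"])
    show "(\<lambda>M. sym_diff M M0) ` mid_colourings {} {} \<subseteq> mid_colourings S R"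
    proof clarify
      fix M assume "M \<in> mid_colourings {} {}"
      then show "sym_diff M M0 \<in> mid_colourings S R"
        using colrel_sym_diff[OF _ M0(1), of "{}" M] colrel_sym_diff[OF _ M0(2), of M "{}"]
        by (simp add: mid_colourings_def)
    qed
    show "(\<lambda>M. sym_diff M M0) ` mid_colourings S R \<subseteq> mid_colourings {} {}"
    proof clarify
      fix M assume "M \<in> mid_colourings S R"
      then show "sym_diff M M0 \<in> mid_colourings {} {}"
        using colrel_sym_diff[OF _ M0(1), of S M] colrel_sym_diff[OF _ M0(2), of M R]
        by (simp add: mid_colourings_def)
    qed
  qed auto
  from bij_betw_same_card[OF this] show ?thesis using card_mid_colourings_empty True by simp
next
  case False
  then have "mid_colourings S R = {}" using colrel_compose1 unfolding mid_colourings_def by blast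
  then show ?thesis using False by simp
qed

end

section \<open>Associativity of stacking and of the loop count\<close>

lemma compose_assoc:
  assumes "matching k D1" "matching k D2" "matching k D3"
  shows "compose k (compose k D1 D2) D3 = compose k D1 (compose k D2 D3)"
proof -
  interpret s12: stack k D1 D2 by unfold_locales (use assms in auto)
  interpret s23: stack k D2 D3 by unfold_locales (use assms in auto)
  interpret s12_3: stack k "compose k D1 D2" D3
    by unfold_locales (use assms s12.matching_compose in auto)
  interpret s1_23: stack k D1 "compose k D2 D3"
    by unfold_locales (use assms s23.matching_compose in auto)
  show ?thesis
    by (rule colrel_inj[OF s12_3.matching_compose s1_23.matching_compose])
      (simp only: s12.colrel_compose s23.colrel_compose s12_3.colrel_compose s1_23.colrel_compose O_assoc)
qed

text \<open>Both sides are the binary logarithm of the number of ways to colour the two middle rows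
  of a triple stack with blank outer rows, counted by choosing the lower or the upper middle row
  first.\<close>

lemma num_loops_assoc:
  assumes "matching k D1" "matching k D2" "matching k D3"
  shows "num_loops k D1 D2 + num_loops k (compose k D1 D2) D3 =
         num_loops k D2 D3 + num_loops k D1 (compose k D2 D3)"
proof -
  interpret s12: stack k D1 D2 by unfold_locales (use assms in auto)
  interpret s23: stack k D2 D3 by unfold_locales (use assms in auto)
  interpret s12_3: stack k "compose k D1 D2" D3
    by unfold_locales (use assms s12.matching_compose in auto)
  interpret s1_23: stack k D1 "compose k D2 D3"
    by unfold_locales (use assms s23.matching_compose in auto)
  let ?X = "{(M, M'). ({}, M) \<in> colrel D1 \<and> (M, M') \<in> colrel D2 \<and> (M', {}) \<in> colrel D3}"
  have X1: "bij_betw prod.swap (SIGMA M':s12_3.mid_colourings {} {}. s12.mid_colourings {} M') ?X"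
    by (rule bij_betw_byWitness[where f' = prod.swap])
      (auto simp: s12_3.mid_colourings_def s12.mid_colourings_def s12.colrel_compose)
  have X2: "(SIGMA M:s1_23.mid_colourings {} {}. s23.mid_colourings M {}) = ?X"
    by (auto simp: s1_23.mid_colourings_def s23.mid_colourings_def s23.colrel_compose)
  have "card ?X = (\<Sum>M'\<in>s12_3.mid_colourings {} {}. card (s12.mid_colourings {} M'))"
    using bij_betw_same_card[OF X1]
    by (simp add: card_SigmaI s12_3.finite_mid_colourings s12.finite_mid_colourings)
  also have "\<dots> = (\<Sum>M'\<in>s12_3.mid_colourings {} {}. 2 ^ num_loops k D1 D2)"
    by (rule sum.cong) (auto simp: s12.card_mid_colourings s12_3.mid_colourings_def)
  also have "\<dots> = 2 ^ (num_loops k D1 D2 + num_loops k (compose k D1 D2) D3)"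
    by (simp add: s12_3.card_mid_colourings_empty power_add)
  finally have 1: "card ?X = 2 ^ (num_loops k D1 D2 + num_loops k (compose k D1 D2) D3)" .
  have "card ?X = (\<Sum>M\<in>s1_23.mid_colourings {} {}. card (s23.mid_colourings M {}))"
    unfolding X2[symmetric]
    by (simp add: card_SigmaI s1_23.finite_mid_colourings s23.finite_mid_colourings)
  also have "\<dots> = (\<Sum>M\<in>s1_23.mid_colourings {} {}. 2 ^ num_loops k D2 D3)"
    by (rule sum.cong) (auto simp: s23.card_mid_colourings s1_23.mid_colourings_def)
  also have "\<dots> = 2 ^ (num_loops k D2 D3 + num_loops k D1 (compose k D2 D3))"
    by (simp add: s1_23.card_mid_colourings_empty power_add)
  finally show ?thesis using 1 by simp
qed

section \<open>Planarity\<close>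

definition planar :: "nat \<Rightarrow> vtx set set \<Rightarrow> bool" where
  "planar k D \<longleftrightarrow> (\<forall>e1\<in>D. \<forall>e2\<in>D. \<forall>a b c d. e1 = {a, b} \<and> e2 = {c, d} \<longrightarrow>
        \<not> (bpos k a < bpos k c \<and> bpos k c < bpos k b \<and> bpos k b < bpos k d))"

lemma diagrams_iff: "D \<in> diagrams k \<longleftrightarrow> matching k D \<and> planar k D"
  by (simp add: diagrams_def motzkin_diagram_def matching_def planar_def)

lemma diagram_matching: "D \<in> diagrams k \<Longrightarrow> matching k D"
  by (simp add: diagrams_iff)

definition bsgn :: "nat \<Rightarrow> vtx \<Rightarrow> vtx \<Rightarrow> int" where
  "bsgn k u w = sgn (int (bpos k w) - int (bpos k u))"

definition sgnsum :: "nat set \<Rightarrow> nat set \<Rightarrow> int" where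
  "sgnsum U W = (\<Sum>u\<in>U. \<Sum>w\<in>W. sgn (int w - int u))"

text \<open>The sum of the signs of all position differences between the colourings \<open>(S, R)\<close> and
  \<open>(S', R')\<close>. Two distinct edges contribute \<open>\<plusminus>2\<close> if they cross and \<open>0\<close> or \<open>\<plusminus>4\<close> otherwise, so
  planarity is the vanishing of this form modulo 4 on the compatible colourings.\<close>

definition crossing_form :: "nat set \<Rightarrow> nat set \<Rightarrow> nat set \<Rightarrow> nat set \<Rightarrow> int" where
  "crossing_form S R S' R' =
     sgnsum S S' - sgnsum R R' + int (card S) * int (card R') - int (card R) * int (card S')"

lemma bpos_inj: "u \<in> verts k \<Longrightarrow> v \<in> verts k \<Longrightarrow> bpos k u = bpos k v \<longleftrightarrow> u = v"
  by (cases u; cases v) auto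

lemma bsgn_antisym: "bsgn k u w = - bsgn k w u"
  by (simp add: bsgn_def sgn_if)

lemma bsgn_simps:
  assumes "1 \<le> i" "i \<le> k" "1 \<le> j" "j \<le> k"
  shows "bsgn k (T i) (T j) = sgn (int j - int i)" "bsgn k (T i) (B j) = 1"
    "bsgn k (B i) (T j) = -1" "bsgn k (B i) (B j) = - sgn (int j - int i)"
  using assms by (auto simp: bsgn_def sgn_if)

lemma sum_T_B:
  assumes "finite S" "finite R"
  shows "sum f (T ` S \<union> B ` R) = (\<Sum>i\<in>S. f (T i)) + (\<Sum>i\<in>R. f (B i))"
proof -
  have "sum f (T ` S \<union> B ` R) = sum f (T ` S) + sum f (B ` R)"
    using assms by (intro sum.union_disjoint) auto
  then show ?thesis by (simp add: sum.reindex inj_on_def)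
qed

text \<open>Along the boundary every top vertex precedes every bottom vertex, which yields the
  products of cardinalities, and the bottom row is read backwards, which yields the minus sign. The
  left side is thereby free of \<open>k\<close> and additive under gluing up to cardinality
  terms.\<close>

lemma crossing_form_eq:
  assumes "S \<subseteq> {1..k}" "R \<subseteq> {1..k}" "S' \<subseteq> {1..k}" "R' \<subseteq> {1..k}"
  shows "crossing_form S R S' R' =
    (\<Sum>u\<in>T ` S \<union> B ` R. \<Sum>w\<in>T ` S' \<union> B ` R'. bsgn k u w)"
proof -
  have fin: "finite S" "finite R" "finite S'" "finite R'" using assms finite_subset by blast+
  have b: "(\<Sum>i\<in>X. \<Sum>j\<in>Y. bsgn k (f i) (g j)) = (\<Sum>i\<in>X. \<Sum>j\<in>Y. h i j)"
    if "X \<subseteq> {1..k}" "Y \<subseteq> {1..k}"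
      "\<And>i j. 1 \<le> i \<Longrightarrow> i \<le> k \<Longrightarrow> 1 \<le> j \<Longrightarrow> j \<le> k \<Longrightarrow> bsgn k (f i) (g j) = h i j"
    for X Y f g h
    using that(1,2) by (intro sum.cong refl that(3)) auto
  note b[OF assms(1,3), of T T, OF bsgn_simps(1)] b[OF assms(1,4), of T B, OF bsgn_simps(2)]
    b[OF assms(2,3), of B T, OF bsgn_simps(3)] b[OF assms(2,4), of B B, OF bsgn_simps(4)]
  then show ?thesis
    unfolding sum_T_B[OF fin(1,2)] sum_T_B[OF fin(3,4)] sum.distrib
    by (simp add: crossing_form_def sgnsum_def sum_negf)
qed

lemma finite_verts: "finite (verts k)"
proof -
  have "verts k = T ` {1..k} \<union> B ` {1..k}" by (auto simp: verts_def)
  then show ?thesis by simp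
qed

lemma coloured_vertices: "T ` S \<union> B ` R = {v. colour S R v}"
proof -
  have "v \<in> T ` S \<union> B ` R \<longleftrightarrow> colour S R v" for v by (cases v) auto
  then show ?thesis by blast
qed

lemma sum_coloured:
  assumes "matching k D" "(S, R) \<in> colrel D"
  shows "sum f (T ` S \<union> B ` R) = (\<Sum>e\<in>{e\<in>D. e \<subseteq> T ` S \<union> B ` R}. sum f e)"
proof -
  let ?U = "T ` S \<union> B ` R" and ?E = "{e\<in>D. e \<subseteq> T ` S \<union> B ` R}"
  have "?U \<subseteq> \<Union>?E"
  proof
    fix v assume v: "v \<in> ?U"
    then obtain w where "{v, w} \<in> D" "colour S R v" "colour S R w"
      using assms(2) unfolding coloured_vertices colrel_iff[OF assms(1)] by blast
    then show "v \<in> \<Union>?E" unfolding coloured_vertices by blast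
  qed
  then have U: "?U = \<Union>?E" by blast
  have "sum f (\<Union>?E) = (sum \<circ> sum) f ?E"
  proof (rule sum.Union_disjoint)
    show "\<forall>A\<in>?E. finite A" using matching_edgeE[OF assms(1)] by (metis (no_types, lifting) finite.emptyI finite.insertI mem_Collect_eq)
    show "\<forall>A\<in>?E. \<forall>B\<in>?E. A \<noteq> B \<longrightarrow> A \<inter> B = {}" using assms(1) unfolding matching_def by simp
  qed
  then show ?thesis using U by simp
qed

lemma colrel_parity:
  assumes "matching k D" "(S, R) \<in> colrel D"
  shows "even (card S + card R)"
proof -
  have "card S + card R = sum (\<lambda>_. 1) (T ` S \<union> B ` R)"
    unfolding sum_T_B[OF colrel_finite[OF assms]] card_eq_sum ..
  also have "\<dots> = (\<Sum>e\<in>{e\<in>D. e \<subseteq> T ` S \<union> B ` R}. card e)"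
    using sum_coloured[OF assms, of "\<lambda>_. 1 :: nat"] by simp
  also have "even \<dots>"
  proof (rule dvd_sum)
    fix e assume "e \<in> {e\<in>D. e \<subseteq> T ` S \<union> B ` R}"
    then have "e \<in> D" by simp
    then obtain a b where "e = {a, b}" "a \<noteq> b" using matching_edgeE[OF assms(1)] by metis
    then show "even (card e)" by simp
  qed
  finally show ?thesis .
qed

text \<open>The eight excluded orders are the interleavings of \<open>{a, b}\<close> with
  \<open>{c, d}\<close> under all ways of naming the endpoints. In every other order the four signs
  are all equal or cancel in pairs.\<close>

lemma noncrossing_sgn:
  fixes a b c d :: nat
  assumes "a \<noteq> c" "a \<noteq> d" "b \<noteq> c" "b \<noteq> d"
    "\<not> (a < c \<and> c < b \<and> b < d)" "\<not> (a < d \<and> d < b \<and> b < c)"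
    "\<not> (b < c \<and> c < a \<and> a < d)" "\<not> (b < d \<and> d < a \<and> a < c)"
    "\<not> (c < a \<and> a < d \<and> d < b)" "\<not> (c < b \<and> b < d \<and> d < a)"
    "\<not> (d < a \<and> a < c \<and> c < b)" "\<not> (d < b \<and> b < c \<and> c < a)"
  shows "4 dvd sgn (int c - int a) + sgn (int d - int a) + sgn (int c - int b) + sgn (int d - int b)"
proof -
  have sgn: "sgn (int v - int u) = (if u < v then 1 else -1)" "v < u \<longleftrightarrow> \<not> u < v"
    if "u \<noteq> v" for u v using that by auto
  note o = sgn(2)[OF assms(1)] sgn(2)[OF assms(2)] sgn(2)[OF assms(3)] sgn(2)[OF assms(4)]
  show ?thesis
    unfolding sgn(1)[OF assms(1)] sgn(1)[OF assms(2)] sgn(1)[OF assms(3)] sgn(1)[OF assms(4)]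
    using assms(5-12) unfolding o by (simp, blast)
qed

lemma planar_crossing_form:
  assumes "D \<in> diagrams k" "(S, R) \<in> colrel D" "(S', R') \<in> colrel D"
  shows "4 dvd crossing_form S R S' R'"
proof -
  have m: "matching k D" and pl: "planar k D" using assms(1) by (auto simp: diagrams_iff)
  have edge: "4 dvd (\<Sum>u\<in>e. \<Sum>w\<in>e'. bsgn k u w)" if e: "e \<in> D" "e' \<in> D" for e e'
  proof -
    obtain a b where ab: "a \<noteq> b" "a \<in> verts k" "b \<in> verts k" "e = {a, b}"
      using matching_edgeE[OF m e(1)] by metis
    obtain c d where cd: "c \<noteq> d" "c \<in> verts k" "d \<in> verts k" "e' = {c, d}"
      using matching_edgeE[OF m e(2)] by metis
    have sum4: "(\<Sum>u\<in>e. \<Sum>w\<in>e'. bsgn k u w) =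
        bsgn k a c + bsgn k a d + bsgn k b c + bsgn k b d"
      using ab cd by simp
    show ?thesis
    proof (cases "e = e'")
      case True
      then have "(c = a \<and> d = b) \<or> (c = b \<and> d = a)" using ab cd by (auto simp: doubleton_eq_iff)
      then show ?thesis unfolding sum4 using bsgn_antisym[of k a b] bsgn_antisym[of k a a]
          bsgn_antisym[of k b b] by auto
    next
      case False
      then have "e \<inter> e' = {}" using e m unfolding matching_def by simp
      then have ne: "bpos k a \<noteq> bpos k c" "bpos k a \<noteq> bpos k d"
        "bpos k b \<noteq> bpos k c" "bpos k b \<noteq> bpos k d"
        using ab cd by (auto simp: bpos_inj)
      have nc: "\<not> (bpos k p < bpos k r \<and> bpos k r < bpos k q \<and> bpos k q < bpos k s)"
        if "{p, q} \<in> D" "{r, s} \<in> D" for p q r s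
        using pl that unfolding planar_def by simp
      have D: "{a, b} \<in> D" "{b, a} \<in> D" "{c, d} \<in> D" "{d, c} \<in> D"
        using e ab cd by (auto simp: insert_commute)
      show ?thesis unfolding sum4 unfolding bsgn_def
        by (intro noncrossing_sgn ne nc D)
    qed
  qed
  have "crossing_form S R S' R' = (\<Sum>u\<in>T ` S \<union> B ` R. \<Sum>w\<in>T ` S' \<union> B ` R'. bsgn k u w)"
    using colrel_subset[OF m] assms(2,3) by (intro crossing_form_eq) auto
  also have "\<dots> = (\<Sum>e\<in>{e\<in>D. e \<subseteq> T ` S \<union> B ` R}. \<Sum>e'\<in>{e\<in>D. e \<subseteq> T ` S' \<union> B ` R'}.
      \<Sum>u\<in>e. \<Sum>w\<in>e'. bsgn k u w)"
    unfolding sum_coloured[OF m assms(2)] sum_coloured[OF m assms(3)]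
    by (intro sum.cong refl) (rule sum.swap)
  also have "4 dvd \<dots>" by (rule dvd_sum, rule dvd_sum, rule edge) auto
  finally show ?thesis .
qed

text \<open>The indicators of two crossing edges, named as in the definition of
  \<open>planar\<close>, give the form the value 2.\<close>

lemma planar_if_crossing_form:
  assumes m: "matching k D"
    and form: "\<And>S R S' R'. (S, R) \<in> colrel D \<Longrightarrow> (S', R') \<in> colrel D \<Longrightarrow> 4 dvd crossing_form S R S' R'"
  shows "D \<in> diagrams k"
proof -
  have False if e: "{a, b} \<in> D" "{c, d} \<in> D"
    and x: "bpos k a < bpos k c" "bpos k c < bpos k b" "bpos k b < bpos k d" for a b c d
  proof -
    let ?e = "{a, b}" and ?e' = "{c, d}"
    have U: "T ` tops e \<union> B ` bots e = e" for e by (simp add: coloured_vertices)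
    have "crossing_form (tops ?e) (bots ?e) (tops ?e') (bots ?e') =
        (\<Sum>u\<in>?e. \<Sum>w\<in>?e'. bsgn k u w)"
      using crossing_form_eq[OF colrel_subset[OF m colrel_edge[OF m e(1)]]
          colrel_subset[OF m colrel_edge[OF m e(2)]]] unfolding U .
    also have "\<dots> = 2"
      using matching_edgeD(1)[OF m e(1)] matching_edgeD(1)[OF m e(2)] x by (simp add: bsgn_def sgn_if)
    finally show False using form[OF colrel_edge[OF m e(1)] colrel_edge[OF m e(2)]] by simp
  qed
  then have "planar k D" unfolding planar_def by blast
  then show ?thesis using m by (simp add: diagrams_iff)
qed

lemma compose_diagrams:
  assumes "D1 \<in> diagrams k" "D2 \<in> diagrams k"
  shows "compose k D1 D2 \<in> diagrams k"
proof -
  interpret stack k D1 D2 by unfold_locales (use assms diagram_matching in auto)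
  show ?thesis
  proof (rule planar_if_crossing_form[OF matching_compose])
    fix S R S' R' assume SR: "(S, R) \<in> colrel (compose k D1 D2)" "(S', R') \<in> colrel (compose k D1 D2)"
    obtain M where M: "(S, M) \<in> colrel D1" "(M, R) \<in> colrel D2" using colrel_compose2[OF SR(1)] .
    obtain M' where M': "(S', M') \<in> colrel D1" "(M', R') \<in> colrel D2" using colrel_compose2[OF SR(2)] .
    have par: "\<exists>a. int x = int y + 2 * a" if "even (x + y)" for x y :: nat
      using that by presburger
    obtain a where a: "int (card S) = int (card M) + 2 * a"
      using par[OF colrel_parity[OF m1 M(1)]] by blast
    obtain a' where a': "int (card S') = int (card M') + 2 * a'"
      using par[OF colrel_parity[OF m1 M'(1)]] by blast
    obtain b where b: "int (card R) = int (card M) + 2 * b"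
      using par[of "card R" "card M"] colrel_parity[OF m2 M(2)] by (auto simp: add.commute)
    obtain b' where b': "int (card R') = int (card M') + 2 * b'"
      using par[of "card R'" "card M'"] colrel_parity[OF m2 M'(2)] by (auto simp: add.commute)
    \<comment> \<open>The contributions \<open>sgnsum M M'\<close> of the glued row cancel. As edges
      have two endpoints, the three rows have cardinalities of equal parity, so what remains of the
      cardinality terms is a multiple of 4.\<close>
    have "crossing_form S R S' R' =
        crossing_form S M S' M' + crossing_form M R M' R' + 4 * (a * b' - a' * b)"
      unfolding crossing_form_def a a' b b' by (simp add: algebra_simps)
    then show "4 dvd crossing_form S R S' R'"
      using planar_crossing_form[OF assms(1) M(1) M'(1)] planar_crossing_form[OF assms(2) M(2) M'(2)]
      by simp
  qed
qed

section \<open>Order-preserving strands\<close>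

definition strands :: "nat set \<Rightarrow> (nat \<Rightarrow> nat) \<Rightarrow> vtx set set" where
  "strands X \<phi> = {{T j, B (\<phi> j)} | j. j \<in> X}"

lemma strands_edge: "{a, b} \<in> strands X \<phi> \<longleftrightarrow>
    (\<exists>j\<in>X. a = T j \<and> b = B (\<phi> j) \<or> a = B (\<phi> j) \<and> b = T j)"
  by (auto simp: strands_def doubleton_eq_iff)

lemma strands_diagram:
  assumes "X \<subseteq> {1..k}" "\<phi> ` X \<subseteq> {1..k}" "strict_mono_on X \<phi>"
  shows "strands X \<phi> \<in> diagrams k"
proof -
  have inj: "inj_on \<phi> X" using assms(3) by (rule strict_mono_on_imp_inj_on)
  have "matching k (strands X \<phi>)"
    unfolding matching_def
  proof (intro conjI ballI impI)
    fix e assume "e \<in> strands X \<phi>"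
    then obtain j where j: "j \<in> X" "e = {T j, B (\<phi> j)}" by (auto simp: strands_def)
    then have "T j \<in> verts k" "B (\<phi> j) \<in> verts k" using assms(1,2) by auto
    then show "\<exists>a b. a \<noteq> b \<and> a \<in> verts k \<and> b \<in> verts k \<and> e = {a, b}" using j by blast
  next
    fix e1 e2 assume "e1 \<in> strands X \<phi>" "e2 \<in> strands X \<phi>" "e1 \<noteq> e2"
    then show "e1 \<inter> e2 = {}" using inj by (auto simp: strands_def inj_on_def)
  qed
  moreover have "planar k (strands X \<phi>)"
    unfolding planar_def
  proof (intro ballI allI impI notI, elim conjE)
    fix e1 e2 a b c d
    assume e: "e1 \<in> strands X \<phi>" "e2 \<in> strands X \<phi>" "e1 = {a, b}" "e2 = {c, d}"
      and x: "bpos k a < bpos k c" "bpos k c < bpos k b" "bpos k b < bpos k d"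
    obtain j where j: "j \<in> X" "a = T j \<and> b = B (\<phi> j) \<or> a = B (\<phi> j) \<and> b = T j"
      using e strands_edge by blast
    obtain l where l: "l \<in> X" "c = T l \<and> d = B (\<phi> l) \<or> c = B (\<phi> l) \<and> d = T l"
      using e strands_edge by blast
    have r: "1 \<le> j" "j \<le> k" "1 \<le> l" "l \<le> k" "1 \<le> \<phi> j" "\<phi> j \<le> k" "1 \<le> \<phi> l" "\<phi> l \<le> k"
      using j l assms(1,2) by auto
    have ab: "a = T j" "b = B (\<phi> j)" using j(2) r x by auto
    have cd: "c = T l" "d = B (\<phi> l)" using l(2) r x ab by auto
    have "j < l" using x ab cd by simp
    then have "\<phi> j < \<phi> l" using assms(3) j l by (simp add: strict_mono_on_def)
    then show False using x ab cd r by simp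
  qed
  ultimately show ?thesis by (simp add: diagrams_iff)
qed

lemma colrel_strands:
  assumes "inj_on \<phi> X"
  shows "(S, R) \<in> colrel (strands X \<phi>) \<longleftrightarrow> S \<subseteq> X \<and> R = \<phi> ` S"
proof
  assume SR: "(S, R) \<in> colrel (strands X \<phi>)"
  have cov: "v \<in> \<Union>(strands X \<phi>)" if "colour S R v" for v
    using SR that unfolding colrel_def by blast
  have "S \<subseteq> X" using cov[of "T _"] by (auto simp: strands_def)
  moreover have eq: "j \<in> S \<longleftrightarrow> \<phi> j \<in> R" if "j \<in> X" for j
  proof -
    have "{T j, B (\<phi> j)} \<in> strands X \<phi>" using that by (auto simp: strands_def)
    then have "colour S R (T j) = colour S R (B (\<phi> j))" using SR unfolding colrel_def by blast
    then show ?thesis by simp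
  qed
  moreover have "R \<subseteq> \<phi> ` X" using cov[of "B _"] by (auto simp: strands_def)
  ultimately show "S \<subseteq> X \<and> R = \<phi> ` S" by auto
next
  assume SR: "S \<subseteq> X \<and> R = \<phi> ` S"
  have "colour S R a = colour S R b" if "{a, b} \<in> strands X \<phi>" for a b
    using that SR inj_on_image_mem_iff[OF assms, of _ S] unfolding strands_edge by auto
  moreover have "v \<in> \<Union>(strands X \<phi>)" if "colour S R v" for v
    using that SR by (cases v) (auto simp: strands_def)
  ultimately show "(S, R) \<in> colrel (strands X \<phi>)" unfolding colrel_def by auto
qed

definition id_diagram :: "nat \<Rightarrow> vtx set set" where
  "id_diagram k = strands {1..k} id"

lemma id_diagram_in [simp]: "id_diagram k \<in> diagrams k"
  unfolding id_diagram_def by (rule strands_diagram) (auto simp: strict_mono_on_def)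

lemma colrel_id: "(S, R) \<in> colrel (id_diagram k) \<longleftrightarrow> S \<subseteq> {1..k} \<and> R = S"
  unfolding id_diagram_def by (subst colrel_strands) auto

lemma compose_eqI:
  assumes "D1 \<in> diagrams k" "D2 \<in> diagrams k" "D3 \<in> diagrams k" "colrel D1 O colrel D2 = colrel D3"
  shows "compose k D1 D2 = D3"
proof -
  interpret stack k D1 D2 by unfold_locales (use assms diagram_matching in auto)
  show ?thesis
    using colrel_inj[OF matching_compose diagram_matching[OF assms(3)]] colrel_compose assms(4) by simp
qed

lemma colrel_compose_diagrams:
  assumes "D1 \<in> diagrams k" "D2 \<in> diagrams k"
  shows "colrel (compose k D1 D2) = colrel D1 O colrel D2"
proof -
  interpret stack k D1 D2 by unfold_locales (use assms diagram_matching in auto)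
  show ?thesis by (rule colrel_compose)
qed

lemma num_loops_card:
  assumes "D1 \<in> diagrams k" "D2 \<in> diagrams k"
  shows "2 ^ num_loops k D1 D2 = card {M. ({}, M) \<in> colrel D1 \<and> (M, {}) \<in> colrel D2}"
proof -
  interpret stack k D1 D2 by unfold_locales (use assms diagram_matching in auto)
  show ?thesis using card_mid_colourings_empty unfolding mid_colourings_def by simp
qed

lemma num_loops_0I:
  assumes "D1 \<in> diagrams k" "D2 \<in> diagrams k"
    "\<And>M. ({}, M) \<in> colrel D1 \<Longrightarrow> (M, {}) \<in> colrel D2 \<Longrightarrow> M = {}"
  shows "num_loops k D1 D2 = 0"
proof -
  have "{M. ({}, M) \<in> colrel D1 \<and> (M, {}) \<in> colrel D2} = {{}}"
    using assms(3) colrel_empty by blast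
  then have "(2::nat) ^ num_loops k D1 D2 = 1" using num_loops_card[OF assms(1,2)] by simp
  then show ?thesis by simp
qed

lemma compose_id:
  assumes "D \<in> diagrams k"
  shows "compose k (id_diagram k) D = D" "compose k D (id_diagram k) = D"
    "num_loops k (id_diagram k) D = 0" "num_loops k D (id_diagram k) = 0"
proof -
  have sub: "S \<subseteq> {1..k}" "R \<subseteq> {1..k}" if "(S, R) \<in> colrel D" for S R
    using colrel_subset[OF diagram_matching[OF assms] that] .
  show "compose k (id_diagram k) D = D"
    using assms sub(1) by (intro compose_eqI) (auto simp: relcomp_unfold colrel_id)
  show "compose k D (id_diagram k) = D"
    using assms sub(2) by (intro compose_eqI) (auto simp: relcomp_unfold colrel_id)
  show "num_loops k (id_diagram k) D = 0" "num_loops k D (id_diagram k) = 0"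
    by (rule num_loops_0I; use assms in \<open>auto simp: colrel_id\<close>)+
qed

lemma finite_diagrams [simp]: "finite (diagrams k)"
  by (rule finite_subset[of _ "Pow (Pow (verts k))"])
    (auto simp: finite_verts dest!: diagram_matching elim!: matching_edgeE)

section \<open>The ring of all Motzkin algebras\<close>

lemma malg_mult_closed: "malg_mult k x f g \<in> malg_carrier k"
proof -
  have "compose k D1 D2 \<noteq> D" if "D \<notin> diagrams k" "D1 \<in> diagrams k" "D2 \<in> diagrams k" for D D1 D2
    using compose_diagrams that by blast
  then show ?thesis unfolding malg_carrier_def malg_mult_def by (simp add: sum.neutral)
qed

text \<open>Pairs a product with arbitrary weights \<open>F\<close>. Each bracketing of a triple
  product has this shape, so both become sums over triples of diagrams that can be compared
  termwise.\<close>

lemma sum_malg_mult: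
  "(\<Sum>A\<in>diagrams k. F A * malg_mult k x f g A) =
   (\<Sum>D1\<in>diagrams k. \<Sum>D2\<in>diagrams k. F (compose k D1 D2) * (f D1 * g D2 * x ^ num_loops k D1 D2))"
proof -
  have "(\<Sum>A\<in>diagrams k. F A * malg_mult k x f g A) =
    (\<Sum>A\<in>diagrams k. \<Sum>D1\<in>diagrams k. \<Sum>D2\<in>diagrams k.
      if compose k D1 D2 = A then F A * (f D1 * g D2 * x ^ num_loops k D1 D2) else 0)"
    unfolding malg_mult_def sum_distrib_left by (intro sum.cong refl) simp
  also have "\<dots> = (\<Sum>D1\<in>diagrams k. \<Sum>D2\<in>diagrams k. \<Sum>A\<in>diagrams k.
      if compose k D1 D2 = A then F A * (f D1 * g D2 * x ^ num_loops k D1 D2) else 0)"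
    by (subst sum.swap, rule sum.cong[OF refl], rule sum.swap)
  also have "\<dots> = (\<Sum>D1\<in>diagrams k. \<Sum>D2\<in>diagrams k.
      F (compose k D1 D2) * (f D1 * g D2 * x ^ num_loops k D1 D2))"
    by (intro sum.cong refl) (simp add: sum.delta' compose_diagrams)
  finally show ?thesis .
qed

lemma malg_mult_assoc:
  "malg_mult k x (malg_mult k x f g) h = malg_mult k x f (malg_mult k x g h)"
proof
  fix D
  let ?G = "diagrams k"
  have "malg_mult k x (malg_mult k x f g) h D =
    (\<Sum>A\<in>?G. (\<Sum>D3\<in>?G. if compose k A D3 = D then h D3 * x ^ num_loops k A D3 else 0) * malg_mult k x f g A)"
    unfolding malg_mult_def[of k x "malg_mult k x f g"] sum_distrib_right
    by (intro sum.cong refl) simp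
  also have "\<dots> = (\<Sum>D1\<in>?G. \<Sum>D2\<in>?G. \<Sum>D3\<in>?G. (if compose k (compose k D1 D2) D3 = D
      then h D3 * x ^ num_loops k (compose k D1 D2) D3 else 0) * (f D1 * g D2 * x ^ num_loops k D1 D2))"
    unfolding sum_malg_mult by (simp only: sum_distrib_right)
  also have "\<dots> = (\<Sum>D1\<in>?G. \<Sum>D2\<in>?G. \<Sum>D3\<in>?G. (if compose k D1 (compose k D2 D3) = D
      then f D1 * x ^ num_loops k D1 (compose k D2 D3) else 0) * (g D2 * h D3 * x ^ num_loops k D2 D3))"
  proof (intro sum.cong refl)
    fix D1 D2 D3 assume "D1 \<in> ?G" "D2 \<in> ?G" "D3 \<in> ?G"
    then have m: "matching k D1" "matching k D2" "matching k D3" by (simp_all add: diagram_matching)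
    have "x ^ num_loops k D1 D2 * x ^ num_loops k (compose k D1 D2) D3 =
          x ^ num_loops k D2 D3 * x ^ num_loops k D1 (compose k D2 D3)"
      using num_loops_assoc[OF m] by (simp flip: power_add)
    then show "(if compose k (compose k D1 D2) D3 = D
        then h D3 * x ^ num_loops k (compose k D1 D2) D3 else 0) * (f D1 * g D2 * x ^ num_loops k D1 D2)
      = (if compose k D1 (compose k D2 D3) = D
        then f D1 * x ^ num_loops k D1 (compose k D2 D3) else 0) * (g D2 * h D3 * x ^ num_loops k D2 D3)"
      unfolding compose_assoc[OF m] by (simp add: algebra_simps)
  qed
  also have "\<dots> = (\<Sum>D1\<in>?G. \<Sum>A\<in>?G. (if compose k D1 A = D
      then f D1 * x ^ num_loops k D1 A else 0) * malg_mult k x g h A)"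
    by (simp only: sum_malg_mult)
  also have "\<dots> = malg_mult k x f (malg_mult k x g h) D"
    unfolding malg_mult_def[of k x f "malg_mult k x g h"]
    by (intro sum.cong refl) simp
  finally show "malg_mult k x (malg_mult k x f g) h D = malg_mult k x f (malg_mult k x g h) D" .
qed

lemma malg_mult_single_left:
  assumes "E \<in> diagrams k"
  shows "malg_mult k x (\<lambda>D. if D = E then c else 0) g D3 =
    (\<Sum>D2\<in>diagrams k. if compose k E D2 = D3 then c * g D2 * x ^ num_loops k E D2 else 0)"
proof -
  have "malg_mult k x (\<lambda>D. if D = E then c else 0) g D3 =
    (\<Sum>D1\<in>diagrams k. if D1 = E then
      (\<Sum>D2\<in>diagrams k. if compose k E D2 = D3 then c * g D2 * x ^ num_loops k E D2 else 0) else 0)"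
    unfolding malg_mult_def by (intro sum.cong refl) (auto intro: sum.neutral)
  then show ?thesis using assms by (simp add: sum.delta)
qed

lemma malg_mult_single_right:
  assumes "E \<in> diagrams k"
  shows "malg_mult k x f (\<lambda>D. if D = E then c else 0) D3 =
    (\<Sum>D1\<in>diagrams k. if compose k D1 E = D3 then f D1 * c * x ^ num_loops k D1 E else 0)"
proof -
  have "malg_mult k x f (\<lambda>D. if D = E then c else 0) D3 =
    (\<Sum>D1\<in>diagrams k. \<Sum>D2\<in>diagrams k. if D2 = E then
      (if compose k D1 E = D3 then f D1 * c * x ^ num_loops k D1 E else 0) else 0)"
    unfolding malg_mult_def by (intro sum.cong refl) auto
  then show ?thesis using assms by (simp add: sum.delta)
qed

lemma malg_mult_scalar:
  assumes "f \<in> malg_carrier k"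
  shows "malg_mult k x (\<lambda>D. if D = id_diagram k then c else 0) f = (\<lambda>D. c * f D)"
    and "malg_mult k x f (\<lambda>D. if D = id_diagram k then c else 0) = (\<lambda>D. f D * c)"
proof -
  have out: "f D = 0" if "D \<notin> diagrams k" for D using assms that by (simp add: malg_carrier_def)
  show "malg_mult k x (\<lambda>D. if D = id_diagram k then c else 0) f = (\<lambda>D. c * f D)"
  proof
    fix D
    have "malg_mult k x (\<lambda>D. if D = id_diagram k then c else 0) f D =
        (\<Sum>D2\<in>diagrams k. if D2 = D then c * f D2 else 0)"
      unfolding malg_mult_single_left[OF id_diagram_in]
      by (intro sum.cong refl) (auto simp: compose_id)
    then show "malg_mult k x (\<lambda>D. if D = id_diagram k then c else 0) f D = c * f D"
      using out by (simp add: sum.delta)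
  qed
  show "malg_mult k x f (\<lambda>D. if D = id_diagram k then c else 0) = (\<lambda>D. f D * c)"
  proof
    fix D
    have "malg_mult k x f (\<lambda>D. if D = id_diagram k then c else 0) D =
        (\<Sum>D1\<in>diagrams k. if D1 = D then f D1 * c else 0)"
      unfolding malg_mult_single_right[OF id_diagram_in]
      by (intro sum.cong refl) (auto simp: compose_id)
    then show "malg_mult k x f (\<lambda>D. if D = id_diagram k then c else 0) D = f D * c"
      using out by (simp add: sum.delta)
  qed
qed

lemma malg_mult_zero_left: "malg_mult k x (\<lambda>_. 0) g = (\<lambda>_. 0)"
  by (rule ext) (auto simp: malg_mult_def intro!: sum.neutral)

lemma malg_mult_add_left: "malg_mult k x (\<lambda>D. f D + g D) h = (\<lambda>D. malg_mult k x f h D + malg_mult k x g h D)"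
  unfolding malg_mult_def sum.distrib[symmetric]
  by (intro ext sum.cong refl) (simp add: algebra_simps)

lemma malg_mult_add_right: "malg_mult k x h (\<lambda>D. f D + g D) = (\<lambda>D. malg_mult k x h f D + malg_mult k x h g D)"
  unfolding malg_mult_def sum.distrib[symmetric]
  by (intro ext sum.cong refl) (simp add: algebra_simps)

text \<open>The product of all algebras \<open>M\<^sub>k(x)\<close>, over all \<open>k\<close> and \<open>x\<close>: the parameters cannot be
  parameters of a type, but the product is a single type and hence an instance of \<open>ring_1\<close>.\<close>

typedef (overloaded) 'a::field malg =
  "{F :: nat \<Rightarrow> 'a \<Rightarrow> vtx set set \<Rightarrow> 'a. \<forall>k x. F k x \<in> malg_carrier k}"
  morphisms comp Abs_malg
  by (intro exI[of _ "\<lambda>_ _ _. 0"]) (simp add: malg_carrier_def)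

lemma comp_carrier [simp]: "comp a k x \<in> malg_carrier k"
  using comp[of a] by blast

lemma malg_eqI: "(\<And>k x. comp a k x = comp b k x) \<Longrightarrow> a = b"
  by (metis comp_inject ext)

lemma comp_Abs: "(\<And>k x. F k x \<in> malg_carrier k) \<Longrightarrow> comp (Abs_malg F) = F"
  by (simp add: Abs_malg_inverse)

instantiation malg :: (field) ring_1
begin

definition zero_malg :: "'a malg" where "0 = Abs_malg (\<lambda>_ _ _. 0)"
definition one_malg :: "'a malg" where "1 = Abs_malg (\<lambda>k _ D. if D = id_diagram k then 1 else 0)"
definition plus_malg :: "'a malg \<Rightarrow> 'a malg \<Rightarrow> 'a malg" where
  "a + b = Abs_malg (\<lambda>k x D. comp a k x D + comp b k x D)"
definition minus_malg :: "'a malg \<Rightarrow> 'a malg \<Rightarrow> 'a malg" where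
  "a - b = Abs_malg (\<lambda>k x D. comp a k x D - comp b k x D)"
definition uminus_malg :: "'a malg \<Rightarrow> 'a malg" where
  "- a = Abs_malg (\<lambda>k x D. - comp a k x D)"
definition times_malg :: "'a malg \<Rightarrow> 'a malg \<Rightarrow> 'a malg" where
  "a * b = Abs_malg (\<lambda>k x. malg_mult k x (comp a k x) (comp b k x))"

lemma comp_zero: "comp (0 :: 'a malg) k x = (\<lambda>_. 0)"
  unfolding zero_malg_def by (subst comp_Abs) (auto simp: malg_carrier_def)

lemma comp_one: "comp (1 :: 'a malg) k x = (\<lambda>D. if D = id_diagram k then 1 else 0)"
  unfolding one_malg_def by (subst comp_Abs) (auto simp: malg_carrier_def)

lemma comp_plus: "comp (a + b :: 'a malg) k x = (\<lambda>D. comp a k x D + comp b k x D)"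
  unfolding plus_malg_def
  by (subst comp_Abs) (use comp_carrier[of a] comp_carrier[of b] in \<open>auto simp: malg_carrier_def\<close>)

lemma comp_minus: "comp (a - b :: 'a malg) k x = (\<lambda>D. comp a k x D - comp b k x D)"
  unfolding minus_malg_def
  by (subst comp_Abs) (use comp_carrier[of a] comp_carrier[of b] in \<open>auto simp: malg_carrier_def\<close>)

lemma comp_uminus: "comp (- a :: 'a malg) k x = (\<lambda>D. - comp a k x D)"
  unfolding uminus_malg_def
  by (subst comp_Abs) (use comp_carrier[of a] in \<open>auto simp: malg_carrier_def\<close>)

lemma comp_times: "comp (a * b :: 'a malg) k x = malg_mult k x (comp a k x) (comp b k x)"
  unfolding times_malg_def by (subst comp_Abs) (auto simp: malg_mult_closed)

instance
proof
  fix a b c :: "'a malg"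
  note cs = comp_zero comp_one comp_plus comp_minus comp_uminus comp_times
  show "a + b + c = a + (b + c)" "a + b = b + a" "0 + a = a" "- a + a = 0" "a - b = a + - b"
    by (rule malg_eqI, simp add: cs algebra_simps)+
  show "a * b * c = a * (b * c)" by (rule malg_eqI) (simp add: cs malg_mult_assoc)
  show "1 * a = a" "a * 1 = a" by (rule malg_eqI, simp add: cs malg_mult_scalar)+
  show "(a + b) * c = a * c + b * c" by (rule malg_eqI) (simp add: cs malg_mult_add_left)
  show "a * (b + c) = a * b + a * c" by (rule malg_eqI) (simp add: cs malg_mult_add_right)
  have "comp (0 :: 'a malg) 0 0 (id_diagram 0) \<noteq> comp (1 :: 'a malg) 0 0 (id_diagram 0)"
    by (simp add: cs)
  then show "(0 :: 'a malg) \<noteq> 1" by metis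
qed

end

lemmas comp_simps = comp_zero comp_one comp_plus comp_minus comp_uminus comp_times

definition scalar :: "'a::field \<Rightarrow> 'a malg" where
  "scalar c = Abs_malg (\<lambda>k _ D. if D = id_diagram k then c else 0)"

text \<open>Unlike \<open>scalar\<close>, this lives in the single factor \<open>(k, x)\<close>;
  with \<open>E = id_diagram k\<close> it is the central idempotent that cuts out this
  factor.\<close>

definition basis :: "nat \<Rightarrow> 'a::field \<Rightarrow> vtx set set \<Rightarrow> 'a malg" where
  "basis k x E = Abs_malg (\<lambda>k' x' D. if D = E then (if k' = k \<and> x' = x then 1 else 0) else 0)"

lemma comp_scalar: "comp (scalar c) k x = (\<lambda>D. if D = id_diagram k then c else 0)"
  unfolding scalar_def by (subst comp_Abs) (auto simp: malg_carrier_def)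

lemma comp_basis:
  "E \<in> diagrams k \<Longrightarrow>
    comp (basis k x E) k' x' = (\<lambda>D. if D = E then (if k' = k \<and> x' = x then 1 else 0) else 0)"
  unfolding basis_def by (subst comp_Abs) (auto simp: malg_carrier_def)

lemma comp_scalar_mult: "comp (scalar c * a) k x = (\<lambda>D. c * comp a k x D)"
  by (simp add: comp_times comp_scalar malg_mult_scalar)

lemma comp_mult_scalar: "comp (a * scalar c) k x = (\<lambda>D. comp a k x D * c)"
  by (simp add: comp_times comp_scalar malg_mult_scalar)

lemma scalar_comm: "a * scalar c = scalar c * a"
  by (rule malg_eqI) (simp add: comp_scalar_mult comp_mult_scalar mult.commute)

lemma scalar_1: "scalar 1 = 1"
  by (rule malg_eqI) (simp add: comp_scalar comp_one)

lemma scalar_add: "scalar (c + d) = scalar c + scalar d"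
  by (rule malg_eqI) (auto simp: comp_scalar comp_plus)

lemma scalar_mult: "scalar (c * d) = scalar c * scalar d"
  by (rule malg_eqI) (simp add: comp_scalar_mult, auto simp: comp_scalar)

lemma comp_sum: "comp (\<Sum>i\<in>I. f i) k x = (\<lambda>D. \<Sum>i\<in>I. comp (f i) k x D)"
  by (induction I rule: infinite_finite_induct) (simp_all add: comp_zero comp_plus)

lemma basis_mult:
  assumes "D1 \<in> diagrams k" "D2 \<in> diagrams k"
  shows "basis k x D1 * basis k x D2 = scalar (x ^ num_loops k D1 D2) * basis k x (compose k D1 D2)"
proof (rule malg_eqI)
  fix k' x'
  show "comp (basis k x D1 * basis k x D2) k' x' =
    comp (scalar (x ^ num_loops k D1 D2) * basis k x (compose k D1 D2)) k' x'"
  proof (cases "k' = k \<and> x' = x")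
    case True
    have "malg_mult k x (\<lambda>D. if D = D1 then 1 else 0) (\<lambda>D. if D = D2 then 1 else 0) D =
      x ^ num_loops k D1 D2 * (if D = compose k D1 D2 then 1 else 0)" for D
    proof -
      have "malg_mult k x (\<lambda>D. if D = D1 then 1 else 0) (\<lambda>D. if D = D2 then 1 else 0) D =
        (\<Sum>E\<in>diagrams k. if E = D2 then (if D = compose k D1 D2 then x ^ num_loops k D1 D2 else 0) else 0)"
        unfolding malg_mult_single_left[OF assms(1)] by (intro sum.cong refl) auto
      then show ?thesis using assms(2) by (simp add: sum.delta)
    qed
    then show ?thesis using True assms
      by (simp add: fun_eq_iff comp_scalar_mult comp_times[of "basis k x D1"] comp_basis compose_diagrams)
  next
    case False
    have b: "comp (basis k x D) k' x' = (\<lambda>_. 0)" if "D \<in> diagrams k" for D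
      using False comp_basis[OF that, of x k' x'] by auto
    show ?thesis using assms by (simp add: comp_scalar_mult comp_times[of "basis k x D1"] b malg_mult_zero_left compose_diagrams)
  qed
qed

lemma basis_id_expand:
  "basis k x (id_diagram k) * a = (\<Sum>D\<in>diagrams k. scalar (comp a k x D) * basis k x D)"
proof (rule malg_eqI)
  fix k' x'
  show "comp (basis k x (id_diagram k) * a) k' x' =
    comp (\<Sum>D\<in>diagrams k. scalar (comp a k x D) * basis k x D) k' x'"
  proof (cases "k' = k \<and> x' = x")
    case True
    have "comp (basis k x (id_diagram k) * a) k x = comp a k x"
      by (simp add: comp_times comp_basis malg_mult_scalar)
    moreover have "comp (\<Sum>E\<in>diagrams k. scalar (comp a k x E) * basis k x E) k x D = comp a k x D" for D
    proof -
      have "comp (\<Sum>E\<in>diagrams k. scalar (comp a k x E) * basis k x E) k x D =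
          (\<Sum>E\<in>diagrams k. if E = D then comp a k x D else 0)"
        unfolding comp_sum comp_scalar_mult by (intro sum.cong refl) (auto simp: comp_basis)
      then show ?thesis using comp_carrier[of a k x] by (simp add: sum.delta malg_carrier_def)
    qed
    ultimately show ?thesis using True by (simp add: fun_eq_iff)
  next
    case False
    have b: "comp (basis k x D) k' x' = (\<lambda>_. 0)" if "D \<in> diagrams k" for D
      using False comp_basis[OF that, of x k' x'] by auto
    show ?thesis by (simp add: comp_times[of "basis k x (id_diagram k)"] comp_sum comp_scalar_mult b malg_mult_zero_left)
  qed
qed

lemma compose_num_loopsI:
  assumes "D1 \<in> diagrams k" "D2 \<in> diagrams k" "D3 \<in> diagrams k"
    and "\<And>S M R. (S, M) \<in> colrel D1 \<Longrightarrow> (M, R) \<in> colrel D2 \<Longrightarrow> (S, R) \<in> colrel D3"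
    and "\<And>S R. (S, R) \<in> colrel D3 \<Longrightarrow> \<exists>M. (S, M) \<in> colrel D1 \<and> (M, R) \<in> colrel D2"
    and "\<And>M. ({}, M) \<in> colrel D1 \<Longrightarrow> (M, {}) \<in> colrel D2 \<Longrightarrow> M = {}"
  shows "compose k D1 D2 = D3 \<and> num_loops k D1 D2 = 0"
proof
  show "compose k D1 D2 = D3"
    using assms(1-5) by (intro compose_eqI) (auto simp: relcomp_unfold)
  show "num_loops k D1 D2 = 0" using assms(1,2,6) by (rule num_loops_0I)
qed

lemma basis_mult_eqI:
  assumes "D1 \<in> diagrams k" "D2 \<in> diagrams k" "D3 \<in> diagrams k"
    and "\<And>S M R. (S, M) \<in> colrel D1 \<Longrightarrow> (M, R) \<in> colrel D2 \<Longrightarrow> (S, R) \<in> colrel D3"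
    and "\<And>S R. (S, R) \<in> colrel D3 \<Longrightarrow> \<exists>M. (S, M) \<in> colrel D1 \<and> (M, R) \<in> colrel D2"
    and "\<And>M. ({}, M) \<in> colrel D1 \<Longrightarrow> (M, {}) \<in> colrel D2 \<Longrightarrow> M = {}"
  shows "basis k x D1 * basis k x D2 = basis k x D3"
  using compose_num_loopsI[OF assms] basis_mult[OF assms(1,2), of x] by (simp add: scalar_1)

lemma basis_mult_cong:
  assumes "D1 \<in> diagrams k" "D2 \<in> diagrams k" "D3 \<in> diagrams k" "D4 \<in> diagrams k"
    and eq: "\<And>S R. (\<exists>M. (S, M) \<in> colrel D1 \<and> (M, R) \<in> colrel D2) \<longleftrightarrow>
                (\<exists>M. (S, M) \<in> colrel D3 \<and> (M, R) \<in> colrel D4)"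
    and l: "\<And>M. ({}, M) \<in> colrel D1 \<Longrightarrow> (M, {}) \<in> colrel D2 \<Longrightarrow> M = {}"
      "\<And>M. ({}, M) \<in> colrel D3 \<Longrightarrow> (M, {}) \<in> colrel D4 \<Longrightarrow> M = {}"
  shows "basis k x D1 * basis k x D2 = basis k x D3 * basis k x D4"
proof -
  have "compose k D1 D2 = compose k D3 D4"
    using assms(1-4) eq
    by (intro compose_eqI) (auto simp: relcomp_unfold colrel_compose_diagrams compose_diagrams)
  moreover have "num_loops k D1 D2 = 0" using assms(1,2) l(1) by (rule num_loops_0I)
  moreover have "num_loops k D3 D4 = 0" using assms(3,4) l(2) by (rule num_loops_0I)
  ultimately show ?thesis using basis_mult[of D1 k D2 x] basis_mult[of D3 k D4 x] assms(1-4)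
    by simp
qed

lemma basis_mult3_eqI:
  assumes D: "D1 \<in> diagrams k" "D2 \<in> diagrams k" "D3 \<in> diagrams k" "D4 \<in> diagrams k"
    and sub: "\<And>S M M' R. (S, M) \<in> colrel D1 \<Longrightarrow> (M, M') \<in> colrel D2 \<Longrightarrow> (M', R) \<in> colrel D3 \<Longrightarrow>
            (S, R) \<in> colrel D4"
    and sup: "\<And>S R. (S, R) \<in> colrel D4 \<Longrightarrow>
            \<exists>M M'. (S, M) \<in> colrel D1 \<and> (M, M') \<in> colrel D2 \<and> (M', R) \<in> colrel D3"
    and l1: "\<And>M. ({}, M) \<in> colrel D1 \<Longrightarrow> (M, {}) \<in> colrel D2 \<Longrightarrow> M = {}"
    and l2: "\<And>M M'. ({}, M) \<in> colrel D1 \<Longrightarrow> (M, M') \<in> colrel D2 \<Longrightarrow> (M', {}) \<in> colrel D3 \<Longrightarrow> M' = {}"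
  shows "basis k x D1 * basis k x D2 * basis k x D3 = basis k x D4"
proof -
  have "basis k x D1 * basis k x D2 = basis k x (compose k D1 D2)"
    using num_loops_0I[OF D(1,2) l1] basis_mult[OF D(1,2), of x] by (simp add: scalar_1)
  moreover have "basis k x (compose k D1 D2) * basis k x D3 = basis k x D4"
  proof (rule basis_mult_eqI)
    show "compose k D1 D2 \<in> diagrams k" using D by (simp add: compose_diagrams)
  qed (use D sub l2 sup in \<open>(force simp: colrel_compose_diagrams relcomp_unfold)+\<close>)
  ultimately show ?thesis by simp
qed

section \<open>Generators\<close>

definition dp :: "nat \<Rightarrow> nat \<Rightarrow> vtx set set" where
  "dp k i = strands ({1..k} - {i}) id"

text \<open>The idempotent that empties all positions beyond \<open>n\<close>; between two of these,
  only diagrams on initial segments of the rows survive.\<close>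

definition dP :: "nat \<Rightarrow> vtx set set" where
  "dP n = strands {1..n} id"

text \<open>Moves the strand at \<open>Suc i\<close> to position \<open>i\<close>. Together with
  \<open>dr\<close> it conjugates \<open>dp k (Suc i)\<close> into \<open>dp k i\<close>, so the
  latter lies in the two-sided ideal of the former.\<close>

definition dl :: "nat \<Rightarrow> nat \<Rightarrow> vtx set set" where
  "dl k i = strands ({1..k} - {i}) (\<lambda>j. if j = Suc i then i else j)"

definition dr :: "nat \<Rightarrow> nat \<Rightarrow> vtx set set" where
  "dr k i = strands ({1..k} - {Suc i}) (\<lambda>j. if j = i then Suc i else j)"

definition dt :: "nat \<Rightarrow> nat \<Rightarrow> vtx set set" where
  "dt k i = insert {T i, T (Suc i)} (insert {B i, B (Suc i)} (strands ({1..k} - {i, Suc i}) id))"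

lemma dp_diagram [simp]: "dp k i \<in> diagrams k"
  unfolding dp_def by (rule strands_diagram) (auto simp: strict_mono_on_def)

lemma dP_diagram [simp]: "n \<le> k \<Longrightarrow> dP n \<in> diagrams k"
  unfolding dP_def by (rule strands_diagram) (auto simp: strict_mono_on_def)

lemma dl_diagram [simp]: "1 \<le> i \<Longrightarrow> i < k \<Longrightarrow> dl k i \<in> diagrams k"
  unfolding dl_def by (rule strands_diagram) (auto simp: strict_mono_on_def)

lemma dr_diagram [simp]: "1 \<le> i \<Longrightarrow> i < k \<Longrightarrow> dr k i \<in> diagrams k"
  unfolding dr_def by (rule strands_diagram) (auto simp: strict_mono_on_def)

lemma dt_edge: "{a, b} \<in> dt k i \<longleftrightarrow> a = T i \<and> b = T (Suc i) \<or> a = T (Suc i) \<and> b = T i \<or>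
    a = B i \<and> b = B (Suc i) \<or> a = B (Suc i) \<and> b = B i \<or>
    (\<exists>j\<in>{1..k} - {i, Suc i}. a = T j \<and> b = B j \<or> a = B j \<and> b = T j)"
  unfolding dt_def insert_iff strands_edge by (auto simp: doubleton_eq_iff)

lemma dt_diagram [simp]:
  assumes "1 \<le> i" "i < k"
  shows "dt k i \<in> diagrams k"
proof -
  have "matching k (dt k i)"
    unfolding matching_def
  proof (intro conjI ballI impI)
    fix e assume "e \<in> dt k i"
    then consider "e = {T i, T (Suc i)}" | "e = {B i, B (Suc i)}"
      | j where "j \<in> {1..k}" "e = {T j, B j}" by (auto simp: dt_def strands_def)
    then show "\<exists>a b. a \<noteq> b \<and> a \<in> verts k \<and> b \<in> verts k \<and> e = {a, b}"
    proof cases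
      case 1
      then show ?thesis using assms by (intro exI[of _ "T i"] exI[of _ "T (Suc i)"]) auto
    next
      case 2
      then show ?thesis using assms by (intro exI[of _ "B i"] exI[of _ "B (Suc i)"]) auto
    next
      case 3
      then show ?thesis by (intro exI[of _ "T j"] exI[of _ "B j"]) auto
    qed
  next
    fix e1 e2 assume "e1 \<in> dt k i" "e2 \<in> dt k i" "e1 \<noteq> e2"
    then show "e1 \<inter> e2 = {}" by (auto simp: dt_def strands_def)
  qed
  moreover have "planar k (dt k i)"
    unfolding planar_def
  proof (intro ballI allI impI notI, elim conjE)
    fix e1 e2 a b c d
    assume e: "e1 \<in> dt k i" "e2 \<in> dt k i" "e1 = {a, b}" "e2 = {c, d}"
      and x: "bpos k a < bpos k c" "bpos k c < bpos k b" "bpos k b < bpos k d"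
    have ab: "{a, b} \<in> dt k i" and cd: "{c, d} \<in> dt k i" using e by simp_all
    have "\<exists>j\<in>{1..k}. a = T j \<and> b = B j" using ab x assms unfolding dt_edge by (cases c) auto
    moreover from this have "\<exists>j\<in>{1..k}. c = T j \<and> d = B j" using cd x assms unfolding dt_edge by auto
    ultimately show False using x by auto
  qed
  ultimately show ?thesis by (simp add: diagrams_iff)
qed

lemma colrel_dp: "(S, R) \<in> colrel (dp k i) \<longleftrightarrow> S \<subseteq> {1..k} \<and> i \<notin> S \<and> R = S"
  unfolding dp_def by (subst colrel_strands) auto

lemma colrel_dP: "(S, R) \<in> colrel (dP n) \<longleftrightarrow> S \<subseteq> {1..n} \<and> R = S"
  unfolding dP_def by (subst colrel_strands) auto

lemma colrel_dl:
  assumes "1 \<le> i" "i < k"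
  shows "(S, R) \<in> colrel (dl k i) \<longleftrightarrow> S \<subseteq> {1..k} \<and> R \<subseteq> {1..k} \<and> i \<notin> S \<and> Suc i \<notin> R \<and>
    (Suc i \<in> S \<longleftrightarrow> i \<in> R) \<and> (\<forall>j. j \<noteq> i \<and> j \<noteq> Suc i \<longrightarrow> (j \<in> S \<longleftrightarrow> j \<in> R))"
  (is "_ \<longleftrightarrow> ?rhs")
proof -
  let ?f = "\<lambda>j. if j = Suc i then i else j"
  have "(S, R) \<in> colrel (dl k i) \<longleftrightarrow> S \<subseteq> {1..k} - {i} \<and> R = ?f ` S"
    unfolding dl_def by (rule colrel_strands) (auto simp: inj_on_def)
  also have "\<dots> \<longleftrightarrow> ?rhs"
  proof (cases "S \<subseteq> {1..k} - {i}")
    case True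
    then have "R = ?f ` S \<longleftrightarrow>
        (\<forall>j. j \<in> R \<longleftrightarrow> (j = i \<and> Suc i \<in> S) \<or> (j \<noteq> i \<and> j \<noteq> Suc i \<and> j \<in> S))"
      (is "_ \<longleftrightarrow> ?mid") unfolding set_eq_iff by (intro iff_allI) auto
    also have "?mid \<longleftrightarrow> R \<subseteq> {1..k} \<and> Suc i \<notin> R \<and> (Suc i \<in> S \<longleftrightarrow> i \<in> R) \<and>
        (\<forall>j. j \<noteq> i \<and> j \<noteq> Suc i \<longrightarrow> (j \<in> S \<longleftrightarrow> j \<in> R))" (is "_ \<longleftrightarrow> ?r")
    proof
      assume m: ?mid
      have "R \<subseteq> {1..k}"
      proof
        fix j assume "j \<in> R"
        then have "j = i \<or> j \<in> S" using m by blast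
        then show "j \<in> {1..k}" using True assms by auto
      qed
      then show ?r using m by simp
    next
      assume r: ?r
      show ?mid
      proof
        fix j
        show "j \<in> R \<longleftrightarrow> (j = i \<and> Suc i \<in> S) \<or> (j \<noteq> i \<and> j \<noteq> Suc i \<and> j \<in> S)"
          using r by (cases "j = i"; cases "j = Suc i") simp_all
      qed
    qed
    finally show ?thesis using True by (simp add: subset_Diff_insert)
  qed auto
  finally show ?thesis .
qed

lemma colrel_dr:
  assumes "1 \<le> i" "i < k"
  shows "(S, R) \<in> colrel (dr k i) \<longleftrightarrow> S \<subseteq> {1..k} \<and> R \<subseteq> {1..k} \<and> Suc i \<notin> S \<and> i \<notin> R \<and>
    (i \<in> S \<longleftrightarrow> Suc i \<in> R) \<and> (\<forall>j. j \<noteq> i \<and> j \<noteq> Suc i \<longrightarrow> (j \<in> S \<longleftrightarrow> j \<in> R))"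
  (is "_ \<longleftrightarrow> ?rhs")
proof -
  let ?f = "\<lambda>j. if j = i then Suc i else j"
  have "(S, R) \<in> colrel (dr k i) \<longleftrightarrow> S \<subseteq> {1..k} - {Suc i} \<and> R = ?f ` S"
    unfolding dr_def by (rule colrel_strands) (auto simp: inj_on_def)
  also have "\<dots> \<longleftrightarrow> ?rhs"
  proof (cases "S \<subseteq> {1..k} - {Suc i}")
    case True
    then have "R = ?f ` S \<longleftrightarrow>
        (\<forall>j. j \<in> R \<longleftrightarrow> (j = Suc i \<and> i \<in> S) \<or> (j \<noteq> i \<and> j \<noteq> Suc i \<and> j \<in> S))"
      (is "_ \<longleftrightarrow> ?mid") unfolding set_eq_iff by (intro iff_allI) auto
    also have "?mid \<longleftrightarrow> R \<subseteq> {1..k} \<and> i \<notin> R \<and> (i \<in> S \<longleftrightarrow> Suc i \<in> R) \<and>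
        (\<forall>j. j \<noteq> i \<and> j \<noteq> Suc i \<longrightarrow> (j \<in> S \<longleftrightarrow> j \<in> R))" (is "_ \<longleftrightarrow> ?r")
    proof
      assume m: ?mid
      have "R \<subseteq> {1..k}"
      proof
        fix j assume "j \<in> R"
        then have "j = Suc i \<or> j \<in> S" using m by blast
        then show "j \<in> {1..k}" using True assms by auto
      qed
      then show ?r using m by simp
    next
      assume r: ?r
      show ?mid
      proof
        fix j
        show "j \<in> R \<longleftrightarrow> (j = Suc i \<and> i \<in> S) \<or> (j \<noteq> i \<and> j \<noteq> Suc i \<and> j \<in> S)"
          using r by (cases "j = i"; cases "j = Suc i") simp_all
      qed
    qed
    finally show ?thesis using True by (simp add: subset_Diff_insert)
  qed auto
  finally show ?thesis .
qed

lemma colrel_dt: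
  assumes "1 \<le> i" "i < k"
  shows "(S, R) \<in> colrel (dt k i) \<longleftrightarrow> S \<subseteq> {1..k} \<and> R \<subseteq> {1..k} \<and>
    (i \<in> S \<longleftrightarrow> Suc i \<in> S) \<and> (i \<in> R \<longleftrightarrow> Suc i \<in> R) \<and>
    (\<forall>j. j \<noteq> i \<and> j \<noteq> Suc i \<longrightarrow> (j \<in> S \<longleftrightarrow> j \<in> R))" (is "_ \<longleftrightarrow> ?rhs")
proof
  assume SR: "(S, R) \<in> colrel (dt k i)"
  have m: "matching k (dt k i)" using assms by (simp add: diagram_matching)
  have sub: "S \<subseteq> {1..k}" "R \<subseteq> {1..k}" using colrel_subset[OF m SR] .
  have eq: "colour S R a = colour S R b" if "{a, b} \<in> dt k i" for a b
    using SR that unfolding colrel_def by blast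
  have "j \<in> S \<longleftrightarrow> j \<in> R" if "j \<noteq> i \<and> j \<noteq> Suc i" for j
  proof (cases "j \<in> {1..k}")
    case True
    then show ?thesis using eq[of "T j" "B j"] that by (auto simp: dt_edge)
  qed (use sub in blast)
  then show ?rhs using sub eq[of "T i" "T (Suc i)"] eq[of "B i" "B (Suc i)"] by (simp add: dt_edge)
next
  assume r: ?rhs
  have r': "i \<in> S \<longleftrightarrow> Suc i \<in> S" "i \<in> R \<longleftrightarrow> Suc i \<in> R" using r by blast+
  have r'': "j \<in> S \<longleftrightarrow> j \<in> R" if "j \<in> {1..k} - {i, Suc i}" for j using r that by blast
  have "colour S R a = colour S R b" if "{a, b} \<in> dt k i" for a b
    using that r' unfolding dt_edge by (elim disjE bexE) (use r'' in simp_all)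
  moreover have "\<exists>w. {v, w} \<in> dt k i" if v: "colour S R v" for v
  proof (cases v)
    case (T j)
    then have "j \<in> {1..k}" using v r by auto
    then show ?thesis unfolding T dt_edge by (cases "j = i \<or> j = Suc i") auto
  next
    case (B j)
    then have "j \<in> {1..k}" using v r by auto
    then show ?thesis unfolding B dt_edge by (cases "j = i \<or> j = Suc i") auto
  qed
  moreover have m: "matching k (dt k i)" using assms by (simp add: diagram_matching)
  ultimately show "(S, R) \<in> colrel (dt k i)" unfolding colrel_iff[OF m] by blast
qed

lemma subset_transfer:
  assumes "\<forall>j. j \<noteq> i \<and> j \<noteq> Suc i \<longrightarrow> (j \<in> S \<longleftrightarrow> j \<in> R)" "1 \<le> i" "i < n" "S \<subseteq> {1..n}"
  shows "R \<subseteq> {1..n}"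
proof
  fix j assume "j \<in> R"
  then show "j \<in> {1..n}" using assms by (cases "j = i \<or> j = Suc i") auto
qed

context
  fixes k :: nat and x :: "'a::field"
begin

abbreviation "bp i \<equiv> basis k x (dp k i)"
abbreviation "bt i \<equiv> basis k x (dt k i)"
abbreviation "bP n \<equiv> basis k x (dP n)"
abbreviation "bl i \<equiv> basis k x (dl k i)"
abbreviation "br i \<equiv> basis k x (dr k i)"

lemma bp_idem: "bp i * bp i = bp i"
  by (rule basis_mult_eqI) (auto simp: colrel_dp)

lemma bp_comm: "bp i * bp j = bp j * bp i"
  by (rule basis_mult_cong) (auto simp: colrel_dp)

lemma bt_square:
  assumes i: "1 \<le> i" "i < k"
  shows "bt i * bt i = scalar x * bt i"
proof -
  have "compose k (dt k i) (dt k i) = dt k i"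
  proof (rule compose_eqI)
    show "colrel (dt k i) O colrel (dt k i) = colrel (dt k i)"
    proof (intro equalityI subsetI; clarify)
      fix S R assume "(S, R) \<in> colrel (dt k i)"
      then have "(S, S) \<in> colrel (dt k i)" "(S, R) \<in> colrel (dt k i)"
        using i by (auto simp: colrel_dt)
      then show "(S, R) \<in> colrel (dt k i) O colrel (dt k i)" by blast
    next
      fix S M R assume "(S, M) \<in> colrel (dt k i)" "(M, R) \<in> colrel (dt k i)"
      then show "(S, R) \<in> colrel (dt k i)" using i by (simp add: colrel_dt)
    qed
  qed (use i in simp_all)
  moreover have "{M. ({}, M) \<in> colrel (dt k i) \<and> (M, {}) \<in> colrel (dt k i)} = {{}, {i, Suc i}}"
    using i by (auto simp: colrel_dt)
  then have "(2::nat) ^ num_loops k (dt k i) (dt k i) = 2 ^ 1"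
    using num_loops_card[of "dt k i" k "dt k i"] i by simp
  then have "num_loops k (dt k i) (dt k i) = 1" by (subst (asm) power_inject_exp) auto
  ultimately show ?thesis using basis_mult[of "dt k i" k "dt k i" x] i by simp
qed

lemma bt_braid:
  assumes i: "1 \<le> i" "Suc i < k"
  shows "bt (Suc i) * bt i * bt (Suc i) = bt (Suc i)"
proof (rule basis_mult3_eqI)
  fix S R assume SR: "(S, R) \<in> colrel (dt k (Suc i))"
  \<comment> \<open>In the middle rows the outer factors equate positions \<open>Suc i\<close> and
    \<open>Suc (Suc i)\<close>, and the inner one equates \<open>i\<close> and \<open>Suc i\<close>;
    so both new positions take the colour of \<open>i\<close>.\<close>
  let ?M = "(S - {Suc i, Suc (Suc i)}) \<union> (if i \<in> S then {Suc i, Suc (Suc i)} else {})"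
  have "(S, ?M) \<in> colrel (dt k (Suc i)) \<and> (?M, ?M) \<in> colrel (dt k i) \<and> (?M, R) \<in> colrel (dt k (Suc i))"
    using SR i by (auto simp: colrel_dt)
  then show "\<exists>M M'. (S, M) \<in> colrel (dt k (Suc i)) \<and> (M, M') \<in> colrel (dt k i) \<and> (M', R) \<in> colrel (dt k (Suc i))"
    by blast
next
  fix S M M' R
  assume "(S, M) \<in> colrel (dt k (Suc i))" "(M, M') \<in> colrel (dt k i)" "(M', R) \<in> colrel (dt k (Suc i))"
  then show "(S, R) \<in> colrel (dt k (Suc i))" using i by (simp add: colrel_dt) (metis n_not_Suc_n)
next
  fix M assume "({}, M) \<in> colrel (dt k (Suc i))" "(M, {}) \<in> colrel (dt k i)"
  then show "M = {}" using i by (simp add: colrel_dt) (metis all_not_in_conv n_not_Suc_n)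
next
  fix M M' assume "({}, M) \<in> colrel (dt k (Suc i))" "(M, M') \<in> colrel (dt k i)" "(M', {}) \<in> colrel (dt k (Suc i))"
  then show "M' = {}" using i by (simp add: colrel_dt) (metis all_not_in_conv n_not_Suc_n)
qed (use i in simp_all)

lemma bt_comm:
  assumes "1 \<le> i" "Suc i < j" "j < k"
  shows "bt i * bt j = bt j * bt i"
proof -
  have ij: "1 \<le> i" "i < k" "1 \<le> j" "j < k" using assms by auto
  have key: "(S, (S - {b, Suc b}) \<union> (R \<inter> {b, Suc b})) \<in> colrel (dt k b) \<and>
      ((S - {b, Suc b}) \<union> (R \<inter> {b, Suc b}), R) \<in> colrel (dt k a)"
    if "(S, M) \<in> colrel (dt k a)" "(M, R) \<in> colrel (dt k b)"
      "Suc a < b \<or> Suc b < a" "1 \<le> a" "a < k" "1 \<le> b" "b < k" for S M R a b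
  proof -
    \<comment> \<open>With the factors exchanged, the first one may change only the positions
      \<open>b\<close> and \<open>Suc b\<close>, so these must already receive their final colours
      from \<open>R\<close>.\<close>
    let ?N = "(S - {b, Suc b}) \<union> (R \<inter> {b, Suc b})"
    have N: "j \<in> ?N \<longleftrightarrow> (if j = b \<or> j = Suc b then j \<in> R else j \<in> S)" for j by auto
    have ne: "b \<noteq> a" "b \<noteq> Suc a" "Suc b \<noteq> a" "Suc b \<noteq> Suc a" using that(3) by auto
    have SM: "S \<subseteq> {1..k}" "M \<subseteq> {1..k}" "a \<in> S \<longleftrightarrow> Suc a \<in> S" "a \<in> M \<longleftrightarrow> Suc a \<in> M"
      "\<And>j. j \<noteq> a \<Longrightarrow> j \<noteq> Suc a \<Longrightarrow> j \<in> S \<longleftrightarrow> j \<in> M"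
      using that by (simp_all add: colrel_dt)
    have MR: "R \<subseteq> {1..k}" "b \<in> M \<longleftrightarrow> Suc b \<in> M" "b \<in> R \<longleftrightarrow> Suc b \<in> R"
      "\<And>j. j \<noteq> b \<Longrightarrow> j \<noteq> Suc b \<Longrightarrow> j \<in> M \<longleftrightarrow> j \<in> R"
      using that by (simp_all add: colrel_dt)
    have Nk: "?N \<subseteq> {1..k}" using SM(1) MR(1) by blast
    have bS: "b \<in> S \<longleftrightarrow> Suc b \<in> S" using SM(5) MR(2) ne by simp
    have aR: "a \<in> R \<longleftrightarrow> Suc a \<in> R" using SM(4) MR(4) ne by (metis (full_types))
    have 1: "(S, ?N) \<in> colrel (dt k b)"
      unfolding colrel_dt[OF that(6,7)] N using SM(1) Nk bS MR(3) by simp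
    have 2: "(?N, R) \<in> colrel (dt k a)"
      unfolding colrel_dt[OF that(4,5)] N using MR(1,4) Nk SM(3,5) aR ne by auto
    show ?thesis using 1 2 by blast
  qed
  show ?thesis
  proof (rule basis_mult_cong)
    fix S R
    show "(\<exists>M. (S, M) \<in> colrel (dt k i) \<and> (M, R) \<in> colrel (dt k j)) \<longleftrightarrow>
       (\<exists>M. (S, M) \<in> colrel (dt k j) \<and> (M, R) \<in> colrel (dt k i))"
      using key[of S _ i R j] key[of S _ j R i] ij assms(2) by meson
  next
    fix M assume "({}, M) \<in> colrel (dt k i)" "(M, {}) \<in> colrel (dt k j)"
    then have "m \<notin> M" for m using ij assms(2) by (cases "m = i \<or> m = Suc i") (auto simp: colrel_dt)
    then show "M = {}" by blast
  next
    fix M assume "({}, M) \<in> colrel (dt k j)" "(M, {}) \<in> colrel (dt k i)"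
    then have "m \<notin> M" for m using ij assms(2) by (cases "m = i \<or> m = Suc i") (auto simp: colrel_dt)
    then show "M = {}" by blast
  qed (use ij in simp_all)
qed

lemma bt_bp_comm:
  assumes i: "1 \<le> i" "i < k" and j: "j \<noteq> i" "j \<noteq> Suc i"
  shows "bt i * bp j = bp j * bt i"
  by (rule basis_mult_cong) (use assms in \<open>auto simp: colrel_dt colrel_dp\<close>)

lemma bt_bp_slide:
  assumes i: "1 \<le> i" "i < k"
  shows "bt i * bp (Suc i) = bt i * bp i" "bp (Suc i) * bt i = bp i * bt i"
  by (rule basis_mult_cong; use assms in \<open>auto simp: colrel_dt colrel_dp\<close>)+

lemma bt_bp_bt:
  assumes i: "1 \<le> i" "i < k"
  shows "bt i * bp i * bt i = bt i"
proof (rule basis_mult3_eqI)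
  fix S R assume SR: "(S, R) \<in> colrel (dt k i)"
  \<comment> \<open>The middle factor forces position \<open>i\<close> to be blank, and the arc then
    forces \<open>Suc i\<close> to be blank.\<close>
  let ?M = "S - {i, Suc i}"
  have "(S, ?M) \<in> colrel (dt k i) \<and> (?M, ?M) \<in> colrel (dp k i) \<and> (?M, R) \<in> colrel (dt k i)"
    using SR i by (auto simp: colrel_dt colrel_dp)
  then show "\<exists>M M'. (S, M) \<in> colrel (dt k i) \<and> (M, M') \<in> colrel (dp k i) \<and> (M', R) \<in> colrel (dt k i)"
    by blast
qed (use i in \<open>auto simp: colrel_dt colrel_dp\<close>)

lemma bP_mult:
  assumes "m \<le> k" "n \<le> k"
  shows "bP m * bP n = bP (min m n)"
proof -
  have "S \<subseteq> {1..min m n} \<longleftrightarrow> S \<subseteq> {1..m} \<and> S \<subseteq> {1..n}" for S by (auto simp: subset_iff)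
  then show ?thesis by (intro basis_mult_eqI) (use assms in \<open>simp_all add: colrel_dP\<close>)
qed

lemma bP_bp_comm: "n \<le> k \<Longrightarrow> bP n * bp i = bp i * bP n"
  by (rule basis_mult_cong) (auto simp: colrel_dP colrel_dp)

lemma bP_bt_comm:
  assumes "1 \<le> i" "i < n" "n \<le> k"
  shows "bP n * bt i = bt i * bP n"
proof (rule basis_mult_cong)
  fix S R
  have "(\<exists>M. (S, M) \<in> colrel (dP n) \<and> (M, R) \<in> colrel (dt k i)) \<longleftrightarrow>
     S \<subseteq> {1..n} \<and> (S, R) \<in> colrel (dt k i)" by (auto simp: colrel_dP)
  also have "\<dots> \<longleftrightarrow> R \<subseteq> {1..n} \<and> (S, R) \<in> colrel (dt k i)"
  proof -
    have "\<forall>j. j \<noteq> i \<and> j \<noteq> Suc i \<longrightarrow> (j \<in> S \<longleftrightarrow> j \<in> R)" if "(S, R) \<in> colrel (dt k i)"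
      using that assms by (simp add: colrel_dt)
    then show ?thesis using subset_transfer[of i S R n] subset_transfer[of i R S n] assms by auto
  qed
  also have "\<dots> \<longleftrightarrow> (\<exists>M. (S, M) \<in> colrel (dt k i) \<and> (M, R) \<in> colrel (dP n))"
    by (auto simp: colrel_dP)
  finally show "(\<exists>M. (S, M) \<in> colrel (dP n) \<and> (M, R) \<in> colrel (dt k i)) \<longleftrightarrow>
     (\<exists>M. (S, M) \<in> colrel (dt k i) \<and> (M, R) \<in> colrel (dP n))" .
qed (use assms in \<open>auto simp: colrel_dt colrel_dP\<close>)

lemma bp_bP_drop: "1 \<le> n \<Longrightarrow> n \<le> k \<Longrightarrow> bp n * bP n = bP (n - 1)"
  by (rule basis_mult_eqI) (auto simp: colrel_dP colrel_dp subset_iff le_less Suc_le_eq intro!: dP_diagram)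

lemma bP_top: "bP k = basis k x (id_diagram k)"
  by (simp add: dP_def id_diagram_def)

lemma bp_conj:
  assumes i: "1 \<le> i" "i < k"
  shows "bl i * bp (Suc i) * br i = bp i"
proof (rule basis_mult3_eqI)
  fix S R assume SR: "(S, R) \<in> colrel (dp k i)"
  let ?M = "(S - {i, Suc i}) \<union> (if Suc i \<in> S then {i} else {})"
  have "(S, ?M) \<in> colrel (dl k i) \<and> (?M, ?M) \<in> colrel (dp k (Suc i)) \<and> (?M, R) \<in> colrel (dr k i)"
    using SR i by (auto simp: colrel_dl colrel_dr colrel_dp)
  then show "\<exists>M M'. (S, M) \<in> colrel (dl k i) \<and> (M, M') \<in> colrel (dp k (Suc i)) \<and> (M', R) \<in> colrel (dr k i)"
    by blast
next
  fix S M M' R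
  assume "(S, M) \<in> colrel (dl k i)" "(M, M') \<in> colrel (dp k (Suc i))" "(M', R) \<in> colrel (dr k i)"
  then show "(S, R) \<in> colrel (dp k i)"
    using i by (simp add: colrel_dl colrel_dr colrel_dp set_eq_iff) metis
qed (use i in \<open>auto simp: colrel_dl colrel_dr colrel_dp\<close>)

lemma bP_br_comm:
  assumes "1 \<le> i" "i < n" "n \<le> k"
  shows "br i * bP n = bP n * br i"
proof (rule basis_mult_cong)
  fix S R
  have "(\<exists>M. (S, M) \<in> colrel (dP n) \<and> (M, R) \<in> colrel (dr k i)) \<longleftrightarrow>
     S \<subseteq> {1..n} \<and> (S, R) \<in> colrel (dr k i)" by (auto simp: colrel_dP)
  also have "\<dots> \<longleftrightarrow> R \<subseteq> {1..n} \<and> (S, R) \<in> colrel (dr k i)"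
  proof -
    have "\<forall>j. j \<noteq> i \<and> j \<noteq> Suc i \<longrightarrow> (j \<in> S \<longleftrightarrow> j \<in> R)" if "(S, R) \<in> colrel (dr k i)"
      using that assms by (simp add: colrel_dr)
    then show ?thesis using subset_transfer[of i S R n] subset_transfer[of i R S n] assms by auto
  qed
  also have "\<dots> \<longleftrightarrow> (\<exists>M. (S, M) \<in> colrel (dr k i) \<and> (M, R) \<in> colrel (dP n))"
    by (auto simp: colrel_dP)
  finally show "(\<exists>M. (S, M) \<in> colrel (dr k i) \<and> (M, R) \<in> colrel (dP n)) \<longleftrightarrow>
     (\<exists>M. (S, M) \<in> colrel (dP n) \<and> (M, R) \<in> colrel (dr k i))" ..
qed (use assms in \<open>auto simp: colrel_dr colrel_dP\<close>)

end

section \<open>Jones--Wenzl projectors\<close>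

text \<open>The projectors need only these relations over central scalars, so the recursion can be
  carried out without any diagrams.\<close>

locale motzkin_relations =
  fixes k :: nat and x :: "'a::field" and sc :: "'a \<Rightarrow> 'r::ring_1" and p t :: "nat \<Rightarrow> 'r"
  assumes sc_add: "sc (c + d) = sc c + sc d"
    and sc_mult: "sc (c * d) = sc c * sc d"
    and sc_1: "sc 1 = 1"
    and sc_comm: "a * sc c = sc c * a"
    and p_idem: "p i * p i = p i"
    and p_comm: "p i * p j = p j * p i"
    and t_square: "1 \<le> i \<Longrightarrow> i < k \<Longrightarrow> t i * t i = sc x * t i"
    and t_braid: "1 \<le> i \<Longrightarrow> Suc i < k \<Longrightarrow> t (Suc i) * t i * t (Suc i) = t (Suc i)"
    and t_comm: "1 \<le> i \<Longrightarrow> Suc i < j \<Longrightarrow> j < k \<Longrightarrow> t i * t j = t j * t i"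
    and t_p_comm: "1 \<le> i \<Longrightarrow> i < k \<Longrightarrow> j \<noteq> i \<Longrightarrow> j \<noteq> Suc i \<Longrightarrow> t i * p j = p j * t i"
    and t_p_slide: "1 \<le> i \<Longrightarrow> i < k \<Longrightarrow> t i * p (Suc i) = t i * p i"
    and p_t_slide: "1 \<le> i \<Longrightarrow> i < k \<Longrightarrow> p (Suc i) * t i = p i * t i"
    and t_p_t: "1 \<le> i \<Longrightarrow> i < k \<Longrightarrow> t i * p i * t i = t i"
begin

lemma sc_left: "a * (sc c * b) = sc c * (a * b)"
  by (metis sc_comm mult.assoc)

lemma sc_diff: "sc (c - d) = sc c - sc d"
  using sc_add[of "c - d" d] by (simp add: algebra_simps)

abbreviation u :: "nat \<Rightarrow> 'a" where "u n \<equiv> cheb_u n (x - 1)"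

text \<open>The Jones-Wenzl recursion at loop value \<open>x - 1\<close>, where \<open>1 - p\<close>
  removes the empty state of the new strand. A quotient with denominator 0 is 0 by convention, so
  \<open>jw\<close> deserves the name of projector only below the first zero of
  \<open>u\<close>.\<close>

fun jw :: "nat \<Rightarrow> 'r" where
  "jw 0 = 1"
| "jw (Suc 0) = 1 - p 1"
| "jw (Suc (Suc n)) = jw (Suc n) * (1 - p (Suc (Suc n)))
     - sc (u n / u (Suc n)) * (jw (Suc n) * t (Suc n) * jw (Suc n))"

text \<open>\<open>jw n\<close> is a polynomial in \<open>p 1\<close>, ..., \<open>p n\<close> and
  \<open>t 1\<close>, ..., \<open>t (n - 1)\<close> with central coefficients.\<close>

lemma jw_comm:
  assumes "n \<le> k" "1 \<le> n \<Longrightarrow> b * p 1 = p 1 * b"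
    and "\<And>i. 1 \<le> i \<Longrightarrow> i < n \<Longrightarrow> b * p (Suc i) = p (Suc i) * b \<and> b * t i = t i * b"
  shows "b * jw n = jw n * b"
  using assms
proof (induction n rule: jw.induct)
  case (3 n)
  let ?G = "jw (Suc n)" and ?p = "p (Suc (Suc n))" and ?t = "t (Suc n)"
  have G: "b * ?G = ?G * b" using 3 by simp
  have pt: "b * ?p = ?p * b" "b * ?t = ?t * b" using "3.prems"(3)[of "Suc n"] by auto
  have "b * (?G * (1 - ?p)) = ?G * (1 - ?p) * b"
    using G pt by (metis (no_types, opaque_lifting) left_diff_distrib mult.assoc mult_1 mult_1_right right_diff_distrib)
  moreover have "b * (?G * ?t * ?G) = ?G * ?t * ?G * b" using G pt by (metis mult.assoc)
  ultimately show ?case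
    by (simp add: right_diff_distrib left_diff_distrib sc_left mult.assoc)
qed (auto simp: algebra_simps)

lemma jw_p_comm: "n \<le> k \<Longrightarrow> n < j \<Longrightarrow> p j * jw n = jw n * p j"
  by (rule jw_comm) (auto simp: p_comm t_p_comm)

lemma jw_t_comm: "n < j \<Longrightarrow> j < k \<Longrightarrow> t j * jw n = jw n * t j"
  by (rule jw_comm) (auto simp: t_comm[symmetric] t_p_comm)

text \<open>Absorption of the preceding projector is carried along because the partial trace in the
  next step produces that projector.\<close>

definition jw_good :: "nat \<Rightarrow> bool" where
  "jw_good n \<longleftrightarrow> (\<forall>i. 1 \<le> i \<and> i \<le> n \<longrightarrow> jw n * p i = 0 \<and> p i * jw n = 0) \<and>
     (\<forall>i. 1 \<le> i \<and> i < n \<longrightarrow> jw n * t i = 0 \<and> t i * jw n = 0) \<and>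
     jw n * jw n = jw n \<and> jw n * jw (n - 1) = jw n \<and> jw (n - 1) * jw n = jw n"

text \<open>The partial trace of the projector over its last strand: the first term of the recursion
  contributes the loop value \<open>x - 1\<close>, and the second collapses by the braid
  relation.\<close>

lemma t_jw_t:
  assumes "1 \<le> n" "n < k" "jw_good (n - 1)" "u (n - 1) \<noteq> 0"
  shows "t n * jw n * t n = sc (u n / u (n - 1)) * (jw (n - 1) * t n)"
proof -
  have A: "t n * (1 - p n) * t n = sc (x - 1) * t n"
    using t_square[OF assms(1,2)] t_p_t[OF assms(1,2)]
    by (simp add: right_diff_distrib left_diff_distrib sc_diff sc_1)
  show ?thesis
  proof (cases "n = 1")
    case True
    then show ?thesis using A by simp
  next
    case False
    then obtain m where m: "n = Suc (Suc m)" using assms(1) by (cases n; cases "n - 1") auto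
    let ?G = "jw (Suc m)" and ?c = "u m / u (Suc m)"
    have idem: "?G * ?G = ?G" using assms(3) m by (simp add: jw_good_def)
    have comm: "t n * ?G = ?G * t n" using jw_t_comm[of "Suc m" n] m assms(2) by simp
    have 1: "t n * (?G * (1 - p n)) * t n = sc (x - 1) * (?G * t n)"
    proof -
      have "t n * (?G * (1 - p n)) * t n = ?G * (t n * (1 - p n) * t n)"
        using comm by (metis mult.assoc)
      then show ?thesis by (simp add: A sc_left)
    qed
    have 2: "t n * (?G * t (Suc m) * ?G) * t n = ?G * t n"
    proof -
      have "t n * (?G * t (Suc m) * ?G) * t n = ?G * (t n * t (Suc m) * t n) * ?G"
        using comm by (metis mult.assoc)
      also have "\<dots> = ?G * t n * ?G" using t_braid[of "Suc m"] m assms(2) by simp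
      also have "\<dots> = ?G * t n" using comm idem by (metis mult.assoc)
      finally show ?thesis .
    qed
    have jn: "jw n = ?G * (1 - p n) - sc ?c * (?G * t (Suc m) * ?G)" by (simp add: m)
    have "t n * jw n * t n = t n * (?G * (1 - p n)) * t n - sc ?c * (t n * (?G * t (Suc m) * ?G) * t n)"
      unfolding jn right_diff_distrib left_diff_distrib sc_left by (simp only: mult.assoc)
    also have "\<dots> = sc (x - 1 - ?c) * (?G * t n)"
      unfolding 1 2 sc_diff[of "x - 1"] left_diff_distrib ..
    \<comment> \<open>This is the Chebyshev recursion divided by \<open>u (n - 1)\<close>; it is
      where these polynomials enter.\<close>
    also have "x - 1 - ?c = u n / u (n - 1)"
      using assms(4) m by (simp add: field_simps)
    finally show ?thesis using m by simp
  qed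
qed

lemma jw_goodI:
  assumes "n \<le> k" "\<And>j. 1 \<le> j \<Longrightarrow> j < n \<Longrightarrow> u j \<noteq> 0"
  shows "jw_good n"
  using assms
proof (induction n rule: less_induct)
  case (less N)
  consider "N = 0" | "N = 1" | m where "N = Suc (Suc m)" by (metis One_nat_def not0_implies_Suc)
  then show ?case
  proof cases
    case 1
    then show ?thesis by (simp add: jw_good_def)
  next
    case 2
    have "p (Suc 0) * p (Suc 0) = p (Suc 0)" by (rule p_idem)
    then show ?thesis unfolding 2 jw_good_def by (auto simp: algebra_simps le_Suc_eq)
  next
    case (3 m)
    define n where "n = Suc m"
    have N: "N = Suc n" by (simp add: 3 n_def)
    have good: "jw_good n" "jw_good m" using less.IH[of n] less.IH[of m] less.prems N n_def by auto
    let ?G = "jw n" and ?H = "jw (Suc n)" and ?p = "p (Suc n)" and ?t = "t n" and ?c = "u m / u n"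
    have n: "1 \<le> n" "n < k" using N n_def less.prems by auto
    have H: "?H = ?G * (1 - ?p) - sc ?c * (?G * ?t * ?G)" by (simp add: n_def)
    have Gp: "?p * ?G = ?G * ?p" using jw_p_comm n by simp
    \<comment> \<open>The mirror form of the recursion, so that products with \<open>?H\<close> on
      the left can be treated like those with \<open>?H\<close> on the right.\<close>
    have H': "?H = (1 - ?p) * ?G - sc ?c * (?G * ?t * ?G)"
      unfolding H by (simp add: left_diff_distrib right_diff_distrib Gp)
    have GG: "?G * ?G = ?G" and Gpn: "?G * p n = 0" "p n * ?G = 0"
      and Gm: "?G * jw m = ?G" "jw m * ?G = ?G"
      using good(1) n unfolding jw_good_def by (auto simp: n_def)
    have left0: "a * ?H = 0" if "a * ?G = 0" for a
    proof -
      have "a * (?G * y) = 0" for y using that by (simp flip: mult.assoc)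
      then show ?thesis unfolding H by (simp only: right_diff_distrib[of a] sc_left mult.assoc) simp
    qed
    have right0: "?H * a = 0" if "?G * a = 0" for a
      unfolding H' by (simp add: left_diff_distrib that mult.assoc)
    have HG: "?H * ?G = ?H" unfolding H' by (simp add: left_diff_distrib mult.assoc GG)
    have GH: "?G * ?H = ?H"
    proof -
      have "?G * (?G * y) = ?G * y" for y using GG by (simp flip: mult.assoc)
      then show ?thesis unfolding H by (simp only: right_diff_distrib[of ?G] sc_left mult.assoc)
    qed
    have un: "u n \<noteq> 0" "u m \<noteq> 0"
      using less.prems(2)[of n] less.prems(2)[of m] n N by (auto simp: n_def, cases m, auto)
    have tGt: "?t * ?G * ?t = sc (u n / u m) * (jw m * ?t)"
      using t_jw_t[OF n] un good(2) by (simp add: n_def)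
    have mt: "?t * jw m = jw m * ?t" using jw_t_comm[of m n] n by (simp add: n_def)
    have cc: "sc ?c * sc (u n / u m) = 1" using un by (simp add: sc_1 flip: sc_mult)
    \<comment> \<open>The coefficient \<open>?c\<close> is the inverse of the partial trace factor,
      which makes the two terms of the recursion cancel in \<open>tH\<close> and
      \<open>Ht\<close>.\<close>
    have ctGt: "sc ?c * (?t * ?G * ?t) = jw m * ?t"
      unfolding tGt by (simp add: cc flip: mult.assoc)
    have pH: "?p * ?H = 0"
    proof -
      have "?p * (?G * (1 - ?p)) = ?G * (?p * (1 - ?p))" using Gp by (metis mult.assoc)
      also have "\<dots> = 0" by (simp add: right_diff_distrib p_idem)
      finally have 1: "?p * (?G * (1 - ?p)) = 0" .
      have "?p * (?G * ?t * ?G) = ?G * (?p * ?t) * ?G" using Gp by (metis mult.assoc)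
      also have "\<dots> = ?G * p n * ?t * ?G" using p_t_slide[OF n] by (simp add: mult.assoc)
      finally have 2: "?p * (?G * ?t * ?G) = 0" by (simp add: Gpn)
      show ?thesis unfolding H right_diff_distrib[of ?p] sc_left 1 2 by simp
    qed
    have Hp: "?H * ?p = 0"
    proof -
      have "(1 - ?p) * ?G * ?p = ((1 - ?p) * ?p) * ?G" using Gp by (metis mult.assoc)
      also have "\<dots> = 0" by (simp add: left_diff_distrib p_idem)
      finally have 1: "(1 - ?p) * ?G * ?p = 0" .
      have "?G * ?t * ?G * ?p = ?G * (?t * ?p) * ?G" using Gp by (metis mult.assoc)
      also have "\<dots> = ?G * ?t * (p n * ?G)" using t_p_slide[OF n] by (simp add: mult.assoc)
      finally have 2: "?G * ?t * ?G * ?p = 0" by (simp add: Gpn)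
      show ?thesis unfolding H' left_diff_distrib[of _ _ ?p] 1 mult.assoc[of "sc ?c"] 2 by simp
    qed
    have tH: "?t * ?H = 0"
    proof -
      have "?t * ?H = ?t * ?G * (1 - ?p) - sc ?c * (?t * ?G * ?t) * ?G"
        unfolding H right_diff_distrib[of ?t] sc_left by (simp only: mult.assoc)
      also have "\<dots> = ?t * ?G * (1 - ?p) - ?t * ?G"
        unfolding ctGt mt[symmetric] by (simp only: mult.assoc Gm)
      \<comment> \<open>What survives the cancellation contains the new \<open>?p\<close>; it slides
        through \<open>?t\<close> to \<open>p n\<close>, which \<open>?G\<close> kills.\<close>
      also have "\<dots> = - (?t * ?p * ?G)" by (simp add: right_diff_distrib Gp mult.assoc)
      also have "\<dots> = 0" unfolding t_p_slide[OF n] by (simp add: mult.assoc Gpn)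
      finally show ?thesis .
    qed
    have Ht: "?H * ?t = 0"
    proof -
      have "?H * ?t = (1 - ?p) * ?G * ?t - ?G * (sc ?c * (?t * ?G * ?t))"
        unfolding H' left_diff_distrib[of _ _ ?t] sc_left by (simp only: mult.assoc)
      also have "\<dots> = (1 - ?p) * ?G * ?t - ?G * ?t"
        unfolding ctGt by (simp add: Gm flip: mult.assoc)
      also have "\<dots> = - (?G * (?p * ?t))" by (simp add: left_diff_distrib Gp flip: mult.assoc)
      also have "\<dots> = 0" unfolding p_t_slide[OF n] by (simp add: Gpn flip: mult.assoc)
      finally show ?thesis .
    qed
    have HH: "?H * ?H = ?H"
    proof -
      have "?H * ?H = ?H * ?G * (1 - ?p) - sc ?c * (?H * ?G * ?t * ?G)"
        unfolding H[THEN arg_cong, of "\<lambda>y. ?H * y"] right_diff_distrib[of ?H] sc_left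
        by (simp only: mult.assoc)
      also have "\<dots> = ?H" unfolding HG Ht by (simp add: right_diff_distrib Hp)
      finally show ?thesis .
    qed
    show ?thesis
      using HH HG GH pH Hp tH Ht left0 right0 good(1)
      unfolding jw_good_def N by (auto simp: le_Suc_eq less_Suc_eq)
  qed
qed

end

section \<open>Diagrams without a full set of through strands\<close>

lemma isolated_bot:
  assumes "matching k E" "\<nexists>w. {B i, w} \<in> E" "(S, R) \<in> colrel E"
  shows "i \<notin> R"
  using assms(2,3) unfolding colrel_iff[OF assms(1)] by (metis colour.simps(2))

lemma basis_absorb_bp:
  assumes E: "E \<in> diagrams k" and iso: "\<nexists>w. {B i, w} \<in> E"
  shows "basis k x E * basis k x (dp k i) = basis k x E"
proof -
  note m = diagram_matching[OF E]
  have R: "R \<subseteq> {1..k}" "i \<notin> R" if "(S, R) \<in> colrel E" for S R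
    using isolated_bot[OF m iso that] colrel_subset[OF m that] by auto
  show ?thesis
    by (rule basis_mult_eqI) (use E R in \<open>auto simp: colrel_dp\<close>)
qed

lemma diagram_subset:
  assumes "E \<in> diagrams k" "E' \<subseteq> E"
  shows "E' \<in> diagrams k"
proof -
  have "matching k E" "planar k E" using assms(1) by (auto simp: diagrams_iff)
  then have "matching k E'" "planar k E'"
    using assms(2) unfolding matching_def planar_def by (meson subsetD)+
  then show ?thesis by (simp add: diagrams_iff)
qed

text \<open>Without its cap, \<open>E\<close> leaves two isolated bottom vertices. The upper arc of
  \<open>dt k i\<close> meets only these and is dropped as a path, not a loop, while its lower arc
  restores the cap. Thus \<open>E\<close> is a left multiple of \<open>dt k i\<close>.\<close>

lemma compose_cap:
  assumes E: "E \<in> diagrams k" and cap: "{B i, B (Suc i)} \<in> E"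
  shows "compose k (E - {{B i, B (Suc i)}}) (dt k i) = E \<and>
    num_loops k (E - {{B i, B (Suc i)}}) (dt k i) = 0"
proof -
  let ?E0 = "E - {{B i, B (Suc i)}}"
  note m = diagram_matching[OF E]
  have i: "1 \<le> i" "i < k" using matching_edgeD[OF m cap] by auto
  have E0: "?E0 \<in> diagrams k" using E by (rule diagram_subset) blast
  note m0 = diagram_matching[OF E0]
  have cap': "{B (Suc i), B i} \<in> E" using cap by (simp add: insert_commute)
  have iso: "{B i, w} \<notin> ?E0" "{B (Suc i), w} \<notin> ?E0" for w
    using matching_unique[OF m cap, of w] matching_unique[OF m cap', of w]
    by (auto simp: doubleton_eq_iff)
  have c0: "(S, R) \<in> colrel ?E0 \<longleftrightarrow> (S, R) \<in> colrel E \<and> i \<notin> R \<and> Suc i \<notin> R" for S R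
  proof
    assume c: "(S, R) \<in> colrel ?E0"
    then have n: "i \<notin> R" "Suc i \<notin> R" using isolated_bot[OF m0 _ c] iso by blast+
    have "colour S R a = colour S R b" if ab: "{a, b} \<in> E" for a b
    proof (cases "{a, b} = {B i, B (Suc i)}")
      case True
      then show ?thesis using n by (auto simp: doubleton_eq_iff)
    next
      case False
      then show ?thesis using c ab unfolding colrel_iff[OF m0] by blast
    qed
    then show "(S, R) \<in> colrel E \<and> i \<notin> R \<and> Suc i \<notin> R"
      using c n unfolding colrel_iff[OF m] colrel_iff[OF m0] by blast
  next
    assume c: "(S, R) \<in> colrel E \<and> i \<notin> R \<and> Suc i \<notin> R"
    have "\<exists>w. {v, w} \<in> ?E0" if v: "colour S R v" for v
    proof -
      obtain w where w: "{v, w} \<in> E" using c v unfolding colrel_iff[OF m] by blast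
      have "v \<noteq> B i" "v \<noteq> B (Suc i)" using c v by auto
      then have "{v, w} \<noteq> {B i, B (Suc i)}" by (auto simp: doubleton_eq_iff)
      then show ?thesis using w by blast
    qed
    then show "(S, R) \<in> colrel ?E0" using c unfolding colrel_iff[OF m] colrel_iff[OF m0] by blast
  qed
  have capE: "i \<in> R \<longleftrightarrow> Suc i \<in> R" if "(S, R) \<in> colrel E" for S R
    using that cap unfolding colrel_iff[OF m] by fastforce
  show ?thesis
  proof (rule compose_num_loopsI[OF E0 _ E])
    fix S R assume SR: "(S, R) \<in> colrel E"
    note sub = colrel_subset[OF m SR]
    let ?M = "R - {i, Suc i}"
    have "(S, ?M) \<in> colrel E"
    proof (cases "i \<in> R")
      case True
      have "(sym_diff S (tops {B i, B (Suc i)}), sym_diff R (bots {B i, B (Suc i)})) \<in> colrel E"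
        by (rule colrel_sym_diff[OF SR colrel_edge[OF m cap]])
      moreover have "sym_diff S (tops {B i, B (Suc i)}) = S" by (auto simp: tops_def)
      moreover have "sym_diff R (bots {B i, B (Suc i)}) = ?M"
        using True capE[OF SR] by (auto simp: bots_def)
      ultimately show ?thesis by simp
    next
      case False
      then have "?M = R" using capE[OF SR] by auto
      then show ?thesis using SR by simp
    qed
    then have "(S, ?M) \<in> colrel ?E0" by (simp add: c0)
    moreover have "(?M, R) \<in> colrel (dt k i)" using i sub capE[OF SR] by (auto simp: colrel_dt)
    ultimately show "\<exists>M. (S, M) \<in> colrel ?E0 \<and> (M, R) \<in> colrel (dt k i)" by blast
  next
    fix S M R assume SM: "(S, M) \<in> colrel ?E0" and MR: "(M, R) \<in> colrel (dt k i)"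
    have M: "(S, M) \<in> colrel E" "i \<notin> M" "Suc i \<notin> M" using SM by (auto simp: c0)
    have R: "i \<in> R \<longleftrightarrow> Suc i \<in> R" "\<And>j. j \<noteq> i \<Longrightarrow> j \<noteq> Suc i \<Longrightarrow> j \<in> M \<longleftrightarrow> j \<in> R"
      using MR i by (auto simp: colrel_dt)
    show "(S, R) \<in> colrel E"
    proof (cases "i \<in> R")
      case True
      have "(sym_diff S (tops {B i, B (Suc i)}), sym_diff M (bots {B i, B (Suc i)})) \<in> colrel E"
        by (rule colrel_sym_diff[OF M(1) colrel_edge[OF m cap]])
      moreover have "sym_diff S (tops {B i, B (Suc i)}) = S" by (auto simp: tops_def)
      moreover have "sym_diff M (bots {B i, B (Suc i)}) = R"
      proof (rule set_eqI)
        fix j show "j \<in> sym_diff M (bots {B i, B (Suc i)}) \<longleftrightarrow> j \<in> R"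
          using True R M by (cases "j = i"; cases "j = Suc i") (auto simp: bots_def)
      qed
      ultimately show ?thesis by simp
    next
      case False
      have "M = R"
      proof (rule set_eqI)
        fix j show "j \<in> M \<longleftrightarrow> j \<in> R"
          using False R M by (cases "j = i"; cases "j = Suc i") auto
      qed
      then show ?thesis using M by simp
    qed
  next
    fix M assume a: "({}, M) \<in> colrel ?E0" "(M, {}) \<in> colrel (dt k i)"
    have "i \<notin> M" "Suc i \<notin> M" using a(1) by (auto simp: c0)
    moreover have "j \<notin> M" if "j \<noteq> i" "j \<noteq> Suc i" for j using a(2) that i by (auto simp: colrel_dt)
    ultimately have "j \<notin> M" for j by (cases "j = i \<or> j = Suc i") auto
    then show "M = {}" by blast
  qed (use i in simp)
qed

text \<open>For \<open>m = n\<close> the two bounds pin \<open>a\<close> to the identity.\<close>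

lemma strict_mono_squeeze:
  fixes a :: "nat \<Rightarrow> nat"
  assumes mono: "\<And>i j. 1 \<le> i \<Longrightarrow> i < j \<Longrightarrow> j \<le> n \<Longrightarrow> a i < a j"
    and range: "\<And>i. 1 \<le> i \<Longrightarrow> i \<le> n \<Longrightarrow> 1 \<le> a i \<and> a i \<le> m"
    and i: "1 \<le> i" "i \<le> n"
  shows "i \<le> a i" "a i + n \<le> m + i"
proof -
  show "i \<le> a i" using i
  proof (induction i)
    case (Suc i)
    then show ?case using mono[of i "Suc i"] range[of "Suc i"] by (cases "i = 0") auto
  qed simp
  show "a i + n \<le> m + i" using i(2,1)
  proof (induction rule: inc_induct)
    case base
    then show ?case using range[of n] by simp
  next
    case (step i)
    then show ?case using mono[of i "Suc i"] by simp
  qed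
qed

text \<open>By planarity the partner of \<open>Suc i\<close> is trapped under the arc from
  \<open>i\<close> to \<open>j\<close>, so it spans a strictly shorter arc.\<close>

lemma innermost_cap:
  assumes E: "E \<in> diagrams k" and all: "\<And>i. 1 \<le> i \<Longrightarrow> i \<le> n \<Longrightarrow> \<exists>w. {B i, w} \<in> E"
    and bnd: "\<And>i w. {B i, w} \<in> E \<Longrightarrow> i \<le> n"
  shows "{B i, B j} \<in> E \<Longrightarrow> i < j \<Longrightarrow> \<exists>l. {B l, B (Suc l)} \<in> E"
proof (induction "j - i" arbitrary: i j rule: less_induct)
  case less
  note m = diagram_matching[OF E]
  show ?case
  proof (cases "j = Suc i")
    case True
    then show ?thesis using less.prems by blast
  next
    case False
    have ji: "{B j, B i} \<in> E" using less.prems by (simp add: insert_commute)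
    have r: "1 \<le> i" "i \<le> k" "j \<le> k" "j \<le> n"
      using matching_edgeD[OF m less.prems(1)] bnd[OF ji] by auto
    obtain w where w: "{B (Suc i), w} \<in> E" using all[of "Suc i"] r less.prems(2) False by auto
    then have w': "{w, B (Suc i)} \<in> E" by (simp add: insert_commute)
    have nc: "\<not> (bpos k a < bpos k c \<and> bpos k c < bpos k b \<and> bpos k b < bpos k d)"
      if "{a, b} \<in> E" "{c, d} \<in> E" for a b c d
      using E that unfolding diagrams_iff planar_def by simp
    have wv: "w \<in> verts k" using matching_edgeD[OF m w] by simp
    have "w \<noteq> B i" "w \<noteq> B j" "w \<noteq> B (Suc i)"
      using matching_unique[OF m ji, of "B (Suc i)"] matching_unique[OF m less.prems(1), of "B (Suc i)"]
        matching_edgeD(1)[OF m w] w' w False less.prems(2) by (auto simp: insert_commute)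
    then have "\<exists>l. w = B l \<and> i < l \<and> l < j \<and> l \<noteq> Suc i"
    proof (cases w)
      case (T l)
      then show ?thesis using nc[OF w' ji] wv r less.prems(2) False by auto
    next
      case (B l)
      have "l \<noteq> i" "l \<noteq> j" "l \<noteq> Suc i" using B \<open>w \<noteq> B i\<close> \<open>w \<noteq> B j\<close> \<open>w \<noteq> B (Suc i)\<close> by auto
      moreover have "\<not> j < l" using nc[OF w' ji] wv r less.prems(2) False B by auto
      moreover have "\<not> l < i" using nc[OF ji w] wv r less.prems(2) False B by auto
      ultimately show ?thesis using B by auto
    qed
    then obtain l where l: "w = B l" "i < l" "l < j" "l \<noteq> Suc i" by blast
    have "j - i > l - Suc i" using l by simp
    then show ?thesis using less.hyps[of l "Suc i"] w l by (simp add: l(1))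
  qed
qed

text \<open>If no bottom vertex up to \<open>n\<close> is isolated and none is joined to another,
  then all carry strands to the top row. Planarity makes these strands order-preserving, so they
  need \<open>n\<close> of the \<open>m\<close> top positions; when \<open>m = n\<close> they are
  vertical and leave no room for other edges.\<close>

lemma diagram_trichotomy:
  assumes E: "E \<in> diagrams k" and bnd: "colrel E \<subseteq> Pow {1..m} \<times> Pow {1..n}"
  obtains (isolated) i where "1 \<le> i" "i \<le> n" "\<nexists>w. {B i, w} \<in> E"
  | (cap) i where "1 \<le> i" "i < n" "{B i, B (Suc i)} \<in> E"
  | (through) "n \<le> m" "m = n \<longrightarrow> E = dP n"
proof -
  note mt = diagram_matching[OF E]
  have edge: "(tops {a, b} \<subseteq> {1..m}) \<and> (bots {a, b} \<subseteq> {1..n})" if "{a, b} \<in> E" for a b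
    using subsetD[OF bnd colrel_edge[OF mt that]] by simp
  have Bb: "1 \<le> i" "i \<le> n" if "{B i, w} \<in> E" for i w
    using edge[OF that] by (auto simp: bots_def)
  have Tb: "1 \<le> i" "i \<le> m" if "{T i, w} \<in> E" for i w
    using edge[OF that] by (auto simp: tops_def)
  consider "\<exists>i. 1 \<le> i \<and> i \<le> n \<and> (\<nexists>w. {B i, w} \<in> E)"
    | "\<forall>i. 1 \<le> i \<and> i \<le> n \<longrightarrow> (\<exists>w. {B i, w} \<in> E)" "\<exists>i j. {B i, B j} \<in> E"
    | "\<forall>i. 1 \<le> i \<and> i \<le> n \<longrightarrow> (\<exists>w. {B i, w} \<in> E)" "\<nexists>i j. {B i, B j} \<in> E" by blast
  then show ?thesis
  proof cases
    case 1
    then show ?thesis using isolated by blast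
  next
    case 2
    then obtain i j where ij: "{B i, B j} \<in> E" by blast
    moreover have "i \<noteq> j" using matching_edgeD[OF mt ij] by auto
    ultimately obtain i j where ij: "{B i, B j} \<in> E" "i < j"
      by (metis insert_commute linorder_neqE_nat)
    obtain l where l: "{B l, B (Suc l)} \<in> E"
      using innermost_cap[OF E _ _ ij] 2(1) Bb by blast
    then have "{B (Suc l), B l} \<in> E" by (simp add: insert_commute)
    then show ?thesis using cap[of l] Bb l by fastforce
  next
    case 3
    have "\<exists>j. {T j, B i} \<in> E" if i: "1 \<le> i" "i \<le> n" for i
    proof -
      obtain w where w: "{B i, w} \<in> E" using 3(1) i by blast
      then obtain j where "w = T j" using 3(2) by (cases w) auto
      then show ?thesis using w by (auto simp: insert_commute)
    qed
    then obtain a where a: "\<And>i. 1 \<le> i \<Longrightarrow> i \<le> n \<Longrightarrow> {T (a i), B i} \<in> E" by metis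
    have range: "1 \<le> a i \<and> a i \<le> m" if "1 \<le> i" "i \<le> n" for i using Tb a[OF that] by blast
    have mono: "a i < a j" if ij: "1 \<le> i" "i < j" "j \<le> n" for i j
    proof (rule ccontr)
      assume "\<not> a i < a j"
      moreover have ei: "{T (a i), B i} \<in> E" and ej: "{T (a j), B j} \<in> E" using a ij by auto
      moreover have "a i \<noteq> a j" using matching_unique[OF mt ei, of "B j"] ej ij by auto
      ultimately have "a j < a i" by simp
      moreover have "a i \<le> k" "1 \<le> j" "j \<le> k" using matching_edgeD[OF mt ei] matching_edgeD[OF mt ej] by auto
      ultimately have "bpos k (T (a j)) < bpos k (T (a i))" "bpos k (T (a i)) < bpos k (B j)"
        "bpos k (B j) < bpos k (B i)" using ij by auto
      then show False using E ei ej unfolding diagrams_iff planar_def by blast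
    qed
    have sq: "i \<le> a i" "a i + n \<le> m + i" if "1 \<le> i" "i \<le> n" for i
      using strict_mono_squeeze[of n a m i] mono range that by blast+
    have nm: "n \<le> m"
    proof (cases "n = 0")
      case False
      then show ?thesis using sq(1)[of n] range[of n] by auto
    qed simp
    have "E = dP n" if "m = n"
    proof -
      have ai: "{T i, B i} \<in> E" if "1 \<le> i" "i \<le> n" for i
        using a[OF that] sq[OF that] \<open>m = n\<close> by (simp add: le_antisym)
      have "e \<in> dP n" if e: "e \<in> E" for e
      proof -
        obtain v w where vw: "e = {v, w}" using matching_edgeE[OF mt e] by metis
        show ?thesis
        proof (cases v)
          case (T i)
          then have "1 \<le> i" "i \<le> n" using Tb e vw \<open>m = n\<close> by blast+
          then have "w = B i" using matching_unique[OF mt ai] e vw T by metis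
          then show ?thesis using vw T \<open>1 \<le> i\<close> \<open>i \<le> n\<close> by (auto simp: dP_def strands_def)
        next
          case (B i)
          then have i: "1 \<le> i" "i \<le> n" using Bb e vw by blast+
          then have "{B i, T i} \<in> E" using ai by (simp add: insert_commute)
          then have "w = T i" using matching_unique[OF mt] e vw B by metis
          then show ?thesis using vw B i by (auto simp: dP_def strands_def)
        qed
      qed
      moreover have "dP n \<subseteq> E" using ai by (auto simp: dP_def strands_def)
      ultimately show ?thesis by blast
    qed
    then show ?thesis using through nm by blast
  qed
qed

section \<open>Reflection of diagrams in the horizontal axis\<close>

fun flip_vtx :: "vtx \<Rightarrow> vtx" where
  "flip_vtx (T i) = B i"
| "flip_vtx (B i) = T i"

definition flip :: "vtx set set \<Rightarrow> vtx set set" where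
  "flip D = (`) flip_vtx ` D"

lemma flip_vtx_flip [simp]: "flip_vtx (flip_vtx v) = v" by (cases v) auto

lemma flip_edge: "{a, b} \<in> flip D \<longleftrightarrow> {flip_vtx a, flip_vtx b} \<in> D"
proof
  assume "{a, b} \<in> flip D"
  then obtain e where e: "e \<in> D" "{a, b} = flip_vtx ` e" unfolding flip_def by blast
  have "flip_vtx ` {a, b} = e" unfolding e(2) by (simp add: image_image)
  then have "{flip_vtx a, flip_vtx b} = e" by simp
  then show "{flip_vtx a, flip_vtx b} \<in> D" using e(1) by simp
next
  assume "{flip_vtx a, flip_vtx b} \<in> D"
  then have "flip_vtx ` {flip_vtx a, flip_vtx b} \<in> flip D" unfolding flip_def by blast
  then show "{a, b} \<in> flip D" by simp
qed

lemma flip_diagram: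
  assumes "D \<in> diagrams k"
  shows "flip D \<in> diagrams k"
proof -
  note m = diagram_matching[OF assms]
  have "matching k (flip D)" unfolding matching_def
  proof (intro conjI ballI impI)
    fix e assume "e \<in> flip D"
    then obtain e' where e': "e' \<in> D" "e = flip_vtx ` e'" unfolding flip_def by blast
    obtain a b where ab: "a \<noteq> b" "a \<in> verts k" "b \<in> verts k" "e' = {a, b}"
      using matching_edgeE[OF m e'(1)] by metis
    have "flip_vtx a \<noteq> flip_vtx b" using ab(1) by (metis flip_vtx_flip)
    moreover have "flip_vtx v \<in> verts k" if "v \<in> verts k" for v
      using that by (cases v) auto
    ultimately have "flip_vtx a \<noteq> flip_vtx b" "flip_vtx a \<in> verts k" "flip_vtx b \<in> verts k"
      "e = {flip_vtx a, flip_vtx b}" using e' ab by auto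
    then show "\<exists>a b. a \<noteq> b \<and> a \<in> verts k \<and> b \<in> verts k \<and> e = {a, b}" by metis
  next
    fix e1 e2 assume e: "e1 \<in> flip D" "e2 \<in> flip D" "e1 \<noteq> e2"
    obtain d1 d2 where d: "d1 \<in> D" "d2 \<in> D" "e1 = flip_vtx ` d1" "e2 = flip_vtx ` d2"
      using e unfolding flip_def by blast
    then have "d1 \<inter> d2 = {}" using e(3) m unfolding matching_def by metis
    moreover have "inj flip_vtx" by (metis flip_vtx_flip injI)
    ultimately show "e1 \<inter> e2 = {}" using d by (metis image_Int image_empty)
  qed
  moreover have "planar k (flip D)" unfolding planar_def
  proof (intro ballI allI impI notI, elim conjE)
    fix e1 e2 a b c d
    assume e: "e1 \<in> flip D" "e2 \<in> flip D" "e1 = {a, b}" "e2 = {c, d}"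
      and x: "bpos k a < bpos k c" "bpos k c < bpos k b" "bpos k b < bpos k d"
    have ab: "{flip_vtx a, flip_vtx b} \<in> D" and cd: "{flip_vtx d, flip_vtx c} \<in> D"
      using e flip_edge by (auto simp: insert_commute)
    have "v \<in> verts k" if "flip_vtx v \<in> verts k" for v using that by (cases v) auto
    then have v: "a \<in> verts k" "b \<in> verts k" "c \<in> verts k" "d \<in> verts k"
      using matching_edgeD[OF m ab] matching_edgeD[OF m cd] by auto
    have pos: "bpos k (flip_vtx v) + bpos k v = 2 * k + 1" if "v \<in> verts k" for v
      using that by (cases v) auto
    have "bpos k (flip_vtx d) < bpos k (flip_vtx b)" "bpos k (flip_vtx b) < bpos k (flip_vtx c)"
      "bpos k (flip_vtx c) < bpos k (flip_vtx a)"
      using x pos[OF v(1)] pos[OF v(2)] pos[OF v(3)] pos[OF v(4)] by linarith+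
    moreover have "{flip_vtx b, flip_vtx a} \<in> D" using ab by (simp add: insert_commute)
    ultimately show False using assms cd unfolding diagrams_iff planar_def by blast
  qed
  ultimately show ?thesis by (simp add: diagrams_iff)
qed

lemma colrel_flip: "(S, R) \<in> colrel (flip D) \<longleftrightarrow> (R, S) \<in> colrel D"
proof -
  have c: "colour S R v = colour R S (flip_vtx v)" for v by (cases v) auto
  have "v \<in> \<Union>(flip D) \<longleftrightarrow> flip_vtx v \<in> \<Union>D" for v
    unfolding flip_def by (auto, metis flip_vtx_flip image_eqI)
  then show ?thesis unfolding colrel_def mem_Collect_eq prod.case flip_edge c
    by (metis flip_vtx_flip)
qed

text \<open>Reflection turns a relation into its converse and so reverses products. With no loops
  the scalar is 1; this is the case that carries \<open>compose_cap\<close> over to the top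
  row.\<close>

lemma basis_flip_mult:
  assumes "D1 \<in> diagrams k" "D2 \<in> diagrams k" "D3 \<in> diagrams k"
    and "num_loops k D1 D2 = 0" "compose k D1 D2 = D3"
  shows "basis k x (flip D2) * basis k x (flip D1) = basis k x (flip D3)"
proof (rule basis_mult_eqI)
  have c: "colrel D3 = colrel D1 O colrel D2" using assms(5) colrel_compose_diagrams[OF assms(1,2)] by simp
  show "(S, M) \<in> colrel (flip D2) \<Longrightarrow> (M, R) \<in> colrel (flip D1) \<Longrightarrow> (S, R) \<in> colrel (flip D3)" for S M R
    unfolding colrel_flip c by blast
  show "(S, R) \<in> colrel (flip D3) \<Longrightarrow> \<exists>M. (S, M) \<in> colrel (flip D2) \<and> (M, R) \<in> colrel (flip D1)" for S R
    unfolding colrel_flip c by blast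
  have "card {M. ({}, M) \<in> colrel D1 \<and> (M, {}) \<in> colrel D2} = 1"
    using num_loops_card[OF assms(1,2)] assms(4) by simp
  then obtain M0 where M0: "{M. ({}, M) \<in> colrel D1 \<and> (M, {}) \<in> colrel D2} = {M0}"
    by (auto simp: card_1_singleton_iff)
  moreover have "{} \<in> {M. ({}, M) \<in> colrel D1 \<and> (M, {}) \<in> colrel D2}" using colrel_empty by blast
  ultimately show "({}, M) \<in> colrel (flip D2) \<Longrightarrow> (M, {}) \<in> colrel (flip D1) \<Longrightarrow> M = {}" for M
    unfolding colrel_flip by blast
qed (use assms flip_diagram in auto)

lemma flip_flip [simp]: "flip (flip D) = D"
proof -
  have "flip_vtx ` flip_vtx ` e = e" for e by (simp add: image_image)
  then show ?thesis unfolding flip_def by (simp add: image_image)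
qed

lemma flip_dt:
  assumes "1 \<le> i" "i < k"
  shows "flip (dt k i) = dt k i"
proof (rule colrel_inj)
  show "colrel (flip (dt k i)) = colrel (dt k i)"
  proof (rule set_eqI, clarify)
    fix S R show "(S, R) \<in> colrel (flip (dt k i)) \<longleftrightarrow> (S, R) \<in> colrel (dt k i)"
      unfolding colrel_flip colrel_dt[OF assms] by blast
  qed
qed (use assms flip_diagram diagram_matching dt_diagram in blast)+

text \<open>Recasts the trichotomy as a factorisation ending in \<open>p\<close> or
  \<open>t\<close>, which a projector standing on the right annihilates.\<close>

lemma basis_reduce_right:
  assumes E: "E \<in> diagrams k" and bnd: "colrel E \<subseteq> Pow {1..m} \<times> Pow {1..n}"
    and nk: "n \<le> k"
  obtains (isolated) i where "1 \<le> i" "i \<le> n" "basis k x E = basis k x E * basis k x (dp k i)"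
  | (cap) i a where "1 \<le> i" "i < n" "basis k x E = a * basis k x (dt k i)"
  | (through) "n \<le> m" "m = n \<longrightarrow> E = dP n"
proof -
  show ?thesis
  proof (rule diagram_trichotomy[OF E bnd], goal_cases isolated cap through)
    case (isolated i)
    then show ?thesis using that(1) basis_absorb_bp[OF E] by metis
  next
    case (cap i)
    let ?E0 = "E - {{B i, B (Suc i)}}"
    have "?E0 \<in> diagrams k" using E by (rule diagram_subset) blast
    moreover have "dt k i \<in> diagrams k" using cap nk by simp
    ultimately have "basis k x ?E0 * basis k x (dt k i) = basis k x E"
      using basis_mult[of ?E0 k "dt k i" x] compose_cap[OF E cap(3)] by (simp add: scalar_1)
    then show ?thesis using that(2) cap by metis
  next
    case through
    then show ?thesis by (rule that(3))
  qed
qed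

lemma basis_reduce_left:
  assumes E: "E \<in> diagrams k" and bnd: "colrel E \<subseteq> Pow {1..m} \<times> Pow {1..n}"
    and mk: "m \<le> k" and nm: "n < m"
  obtains (isolated) i where "1 \<le> i" "i \<le> m" "basis k x E = basis k x (dp k i) * basis k x E"
  | (cup) i a where "1 \<le> i" "i < m" "basis k x E = basis k x (dt k i) * a"
proof -
  have F: "flip E \<in> diagrams k" using E by (rule flip_diagram)
  have bnd': "colrel (flip E) \<subseteq> Pow {1..n} \<times> Pow {1..m}"
  proof (rule subrelI)
    fix S R assume "(S, R) \<in> colrel (flip E)"
    then have "(R, S) \<in> Pow {1..m} \<times> Pow {1..n}" using bnd unfolding colrel_flip by blast
    then show "(S, R) \<in> Pow {1..n} \<times> Pow {1..m}" by simp
  qed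
  show ?thesis
  proof (rule diagram_trichotomy[OF F bnd'], goal_cases isolated cap through)
    case (isolated i)
    have iS: "i \<notin> S" "S \<subseteq> {1..k}" if "(S, R) \<in> colrel E" for S R
      using isolated_bot[OF diagram_matching[OF F] isolated(3), of R S] that
        colrel_subset[OF diagram_matching[OF E] that] by (auto simp: colrel_flip)
    have "basis k x (dp k i) * basis k x E = basis k x E"
      by (rule basis_mult_eqI) (use E iS in \<open>auto simp: colrel_dp\<close>)
    then show ?thesis using that(1) isolated by metis
  next
    case (cap i)
    let ?F0 = "flip E - {{B i, B (Suc i)}}"
    have "?F0 \<in> diagrams k" using F by (rule diagram_subset) blast
    moreover have i: "i < k" using cap mk by simp
    ultimately have "basis k x (flip (dt k i)) * basis k x (flip ?F0) = basis k x (flip (flip E))"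
      using compose_cap[OF F cap(3)] cap(1) F by (intro basis_flip_mult) auto
    then have "basis k x E = basis k x (dt k i) * basis k x (flip ?F0)"
      using flip_dt[OF cap(1) i] by simp
    then show ?thesis using that(2) cap by metis
  next
    case through
    then show ?thesis using nm by simp
  qed
qed

text \<open>Makes diagrams on the first \<open>m\<close> top and first \<open>n\<close> bottom
  vertices span the corner cut out by two truncations, which is the input of the reduction
  lemmas.\<close>

lemma basis_corner:
  assumes "D \<in> diagrams k" "m \<le> k" "n \<le> k"
  obtains c E where "E \<in> diagrams k" "colrel E \<subseteq> Pow {1..m} \<times> Pow {1..n}"
    "basis k x (dP m) * basis k x D * basis k x (dP n) = scalar c * basis k x E"
proof -
  let ?D1 = "compose k (dP m) D"
  let ?E = "compose k ?D1 (dP n)"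
  have D1: "?D1 \<in> diagrams k" using assms by (simp add: compose_diagrams)
  have E: "?E \<in> diagrams k" using D1 assms by (simp add: compose_diagrams)
  have "basis k x (dP m) * basis k x D * basis k x (dP n) =
    scalar (x ^ num_loops k (dP m) D) * (scalar (x ^ num_loops k ?D1 (dP n)) * basis k x ?E)"
    using assms D1 by (simp add: basis_mult mult.assoc)
  then have "basis k x (dP m) * basis k x D * basis k x (dP n) =
    scalar (x ^ num_loops k (dP m) D * x ^ num_loops k ?D1 (dP n)) * basis k x ?E"
    by (simp add: scalar_mult mult.assoc)
  moreover have "colrel ?E \<subseteq> Pow {1..m} \<times> Pow {1..n}"
  proof (rule subrelI)
    fix S R assume "(S, R) \<in> colrel ?E"
    then have "(S, R) \<in> (colrel (dP m) O colrel D) O colrel (dP n)"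
      using assms D1 by (simp add: colrel_compose_diagrams)
    then show "(S, R) \<in> Pow {1..m} \<times> Pow {1..n}" by (elim relcompE) (simp add: colrel_dP)
  qed
  ultimately show ?thesis using that E by blast
qed

section \<open>Left ideals and complements\<close>

definition left_ideal :: "'r::ring_1 set \<Rightarrow> bool" where
  "left_ideal L \<longleftrightarrow> 0 \<in> L \<and> (\<forall>a\<in>L. \<forall>b\<in>L. a + b \<in> L) \<and> (\<forall>r. \<forall>a\<in>L. r * a \<in> L)"

lemma left_idealD:
  assumes "left_ideal L"
  shows "0 \<in> L" "a \<in> L \<Longrightarrow> b \<in> L \<Longrightarrow> a + b \<in> L" "a \<in> L \<Longrightarrow> r * a \<in> L" "a \<in> L \<Longrightarrow> - a \<in> L"
proof -
  show "0 \<in> L" "a \<in> L \<Longrightarrow> b \<in> L \<Longrightarrow> a + b \<in> L" "a \<in> L \<Longrightarrow> r * a \<in> L"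
    using assms unfolding left_ideal_def by auto
  show "- a \<in> L" if "a \<in> L"
  proof -
    have "- 1 * a \<in> L" using assms that unfolding left_ideal_def by blast
    then show ?thesis by simp
  qed
qed

lemma left_ideal_sum:
  assumes "left_ideal L" "left_ideal L'"
  shows "left_ideal {l + l' | l l'. l \<in> L \<and> l' \<in> L'}"
  unfolding left_ideal_def
proof (intro conjI ballI allI)
  have "(0::'a) = 0 + 0" by simp
  then show "0 \<in> {l + l' | l l'. l \<in> L \<and> l' \<in> L'}" using left_idealD(1)[OF assms(1)] left_idealD(1)[OF assms(2)] by blast
next
  fix a b assume "a \<in> {l + l' | l l'. l \<in> L \<and> l' \<in> L'}" "b \<in> {l + l' | l l'. l \<in> L \<and> l' \<in> L'}"
  then obtain l1 m1 l2 m2 where h: "a = l1 + m1" "b = l2 + m2" "l1 \<in> L" "l2 \<in> L" "m1 \<in> L'" "m2 \<in> L'" by blast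
  have "a + b = (l1 + l2) + (m1 + m2)" using h by (simp add: algebra_simps)
  then show "a + b \<in> {l + l' | l l'. l \<in> L \<and> l' \<in> L'}"
    using left_idealD(2)[OF assms(1) h(3,4)] left_idealD(2)[OF assms(2) h(5,6)] by blast
next
  fix r a assume "a \<in> {l + l' | l l'. l \<in> L \<and> l' \<in> L'}"
  then obtain l m where h: "a = l + m" "l \<in> L" "m \<in> L'" by blast
  have "r * a = r * l + r * m" using h by (simp add: distrib_left)
  then show "r * a \<in> {l + l' | l l'. l \<in> L \<and> l' \<in> L'}"
    using left_idealD(3)[OF assms(1) h(2)] left_idealD(3)[OF assms(2) h(3)] by blast
qed

lemma left_ideal_principal: "left_ideal {a * h | a. True}"
  unfolding left_ideal_def
proof (intro conjI ballI allI)
  show "0 \<in> {a * h | a. True}" by (auto intro: exI[of _ 0])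
  fix a b assume "a \<in> {a * h | a. True}" "b \<in> {a * h | a. True}"
  then show "a + b \<in> {a * h | a. True}" by (auto simp flip: distrib_right)
next
  fix r a assume "a \<in> {a * h | a. True}"
  then show "r * a \<in> {a * h | a. True}" by (auto simp flip: mult.assoc)
qed

text \<open>The hypothesis on \<open>h\<close> says that the left ideal generated by \<open>h\<close> is zero or minimal.\<close>

lemma left_ideal_complement:
  assumes "finite F" and min: "\<And>h a. h \<in> F \<Longrightarrow> a * h \<noteq> 0 \<Longrightarrow> \<exists>c. c * (a * h) = h"
    and L: "left_ideal L"
  shows "\<exists>L'. left_ideal L' \<and> L \<inter> L' = {0} \<and> F \<subseteq> {l + l' | l l'. l \<in> L \<and> l' \<in> L'}"
  using assms(1,2)
proof (induction F rule: finite_induct)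
  case empty
  have "left_ideal {0::'a}" by (simp add: left_ideal_def)
  then show ?case using left_idealD(1)[OF L] by (intro exI[of _ "{0}"]) auto
next
  case (insert h F)
  then obtain L' where L': "left_ideal L'" "L \<inter> L' = {0}" "F \<subseteq> {l + l' | l l'. l \<in> L \<and> l' \<in> L'}"
    by auto
  show ?case
  proof (cases "h \<in> {l + l' | l l'. l \<in> L \<and> l' \<in> L'}")
    case True
    then show ?thesis using L' by blast
  next
    case False
    let ?N = "{a * h | a. True}"
    \<comment> \<open>Enlarge the partial complement by the left ideal of \<open>h\<close>, as
      \<open>h\<close> is not yet reached.\<close>
    let ?L = "{l + l' | l l'. l \<in> L' \<and> l' \<in> ?N}"
    have Li: "left_ideal ?L" using left_ideal_sum[OF L'(1) left_ideal_principal] .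
    have in1: "l \<in> ?L" if "l \<in> L'" for l
    proof -
      have "l = l + 0 * h" by simp
      then show ?thesis using that by blast
    qed
    have in2: "h \<in> ?L"
    proof -
      have "h = 0 + 1 * h" by simp
      then show ?thesis using left_idealD(1)[OF L'(1)] by blast
    qed
    have "y = 0" if y: "y \<in> L" "y \<in> ?L" for y
    proof -
      obtain l' a where la: "y = l' + a * h" "l' \<in> L'" using y(2) by blast
      \<comment> \<open>Otherwise minimality recovers \<open>h\<close> from \<open>a * h\<close>,
        which lies in the sum of \<open>L\<close> and \<open>L'\<close>, so that \<open>h\<close>
        would be reached already.\<close>
      have ah: "a * h = 0"
      proof (rule ccontr)
        assume "a * h \<noteq> 0"
        then obtain c where c: "c * (a * h) = h" using insert.prems by blast
        have "a * h = y + - l'" using la by simp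
        then have "h = c * y + c * (- l')" using c by (metis distrib_left)
        moreover have "c * y \<in> L" "c * (- l') \<in> L'" using left_idealD[OF L] left_idealD[OF L'(1)] y la by auto
        ultimately show False using False by blast
      qed
      then have "y \<in> L'" using la by simp
      then show ?thesis using y(1) L'(2) by blast
    qed
    then have "L \<inter> ?L = {0}" using left_idealD(1)[OF L] left_idealD(1)[OF Li] by blast
    moreover have "insert h F \<subseteq> {l + l' | l l'. l \<in> L \<and> l' \<in> ?L}"
    proof
      fix y assume "y \<in> insert h F"
      then consider "y = h" | "y \<in> F" by blast
      then show "y \<in> {l + l' | l l'. l \<in> L \<and> l' \<in> ?L}"
      proof cases
        case 1
        have "y = 0 + h" using 1 by simp
        then show ?thesis using in2 left_idealD(1)[OF L] by blast
      next
        case 2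
        then obtain l l' where "y = l + l'" "l \<in> L" "l' \<in> L'" using L'(3) by blast
        then show ?thesis using in1 by blast
      qed
    qed
    ultimately show ?thesis using Li by blast
  qed
qed

inductive_set two_sided :: "'r::ring_1 set \<Rightarrow> 'r set" for X where
  zero: "0 \<in> two_sided X"
| add: "a \<in> two_sided X \<Longrightarrow> b \<in> two_sided X \<Longrightarrow> a + b \<in> two_sided X"
| gen: "f \<in> X \<Longrightarrow> a * f * b \<in> two_sided X"

lemma two_sided_left: "y \<in> two_sided X \<Longrightarrow> c * y \<in> two_sided X"
  by (induction rule: two_sided.induct)
    (auto simp: distrib_left mult.assoc[symmetric] intro: two_sided.intros)

lemma two_sided_right: "y \<in> two_sided X \<Longrightarrow> y * c \<in> two_sided X"
proof (induction rule: two_sided.induct)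
  case (gen f a b)
  then show ?case using two_sided.gen[of f X a "b * c"] by (simp add: mult.assoc)
qed (auto simp: distrib_right intro: two_sided.intros)

lemma two_sided_diff: "y \<in> two_sided X \<Longrightarrow> z \<in> two_sided X \<Longrightarrow> y - z \<in> two_sided X"
  using two_sided.add[of y X "- 1 * z"] two_sided_left[of z X "- 1"] by simp

lemma two_sided_nonzero:
  "y \<in> two_sided X \<Longrightarrow> y * v \<noteq> 0 \<Longrightarrow> \<exists>f\<in>X. \<exists>b. f * b * v \<noteq> 0"
proof (induction rule: two_sided.induct)
  case (gen f a b)
  then have "f * b * v \<noteq> 0" by (auto simp: mult.assoc)
  then show ?case using gen.hyps by blast
next
  case (add a b)
  then have "a * v \<noteq> 0 \<or> b * v \<noteq> 0" by (auto simp: distrib_right)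
  then show ?case using add.IH by blast
qed simp

text \<open>An element is a finite sum of terms \<open>a * f * b\<close>, and the factors
  \<open>f * b\<close> are collected in \<open>F\<close>. Applied to \<open>P k\<close>, this
  supplies the finite family for \<open>left_ideal_complement\<close>.\<close>

lemma two_sided_finite:
  "y \<in> two_sided X \<Longrightarrow> \<exists>F. finite F \<and> F \<subseteq> {f * b | f b. f \<in> X} \<and>
     (\<forall>L. left_ideal L \<longrightarrow> F \<subseteq> L \<longrightarrow> y \<in> L)"
proof (induction rule: two_sided.induct)
  case zero
  then show ?case by (intro exI[of _ "{}"]) (simp add: left_idealD)
next
  case (add a b)
  then obtain F G where "finite F" "F \<subseteq> {f * b | f b. f \<in> X}" "\<forall>L. left_ideal L \<longrightarrow> F \<subseteq> L \<longrightarrow> a \<in> L"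
    "finite G" "G \<subseteq> {f * b | f b. f \<in> X}" "\<forall>L. left_ideal L \<longrightarrow> G \<subseteq> L \<longrightarrow> b \<in> L" by blast
  then show ?case by (intro exI[of _ "F \<union> G"]) (simp add: left_idealD)
next
  case (gen f a b)
  have "a * f * b \<in> L" if "left_ideal L" "f * b \<in> L" for L
    using left_idealD(3)[OF that, of a] by (simp add: mult.assoc)
  then show ?case using gen by (intro exI[of _ "{f * b}"]) auto
qed

section \<open>Primitive idempotents\<close>

context
  fixes k :: nat and x :: "'a::field"
begin

interpretation motzkin_relations k x scalar "\<lambda>i. basis k x (dp k i)" "\<lambda>i. basis k x (dt k i)"
  by unfold_locales
    (fact scalar_add scalar_mult scalar_1 scalar_comm bp_idem bp_comm bt_square bt_braid bt_comm
      bt_bp_comm bt_bp_slide bt_bp_bt)+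

abbreviation "p i \<equiv> basis k x (dp k i)"
abbreviation "t i \<equiv> basis k x (dt k i)"
abbreviation "P n \<equiv> basis k x (dP n)"

text \<open>Truncating by \<open>P n\<close> separates the projectors by their number of strands:
  all positions beyond the first \<open>n\<close> are empty.\<close>

definition unit_proj :: "nat \<Rightarrow> 'a malg" where
  "unit_proj n = jw n * P n"

lemma jw_P_comm: "m \<le> n \<Longrightarrow> n \<le> k \<Longrightarrow> P n * jw m = jw m * P n"
  by (rule jw_comm) (auto simp: bP_bp_comm bP_bt_comm)

lemma P_idem: "n \<le> k \<Longrightarrow> P n * P n = P n"
  using bP_mult[of n k n x] by simp

lemma P_unit_proj:
  assumes "n \<le> k"
  shows "P n * unit_proj n = unit_proj n"
proof -
  have "P n * (jw n * P n) = jw n * (P n * P n)"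
    using jw_P_comm[of n n] assms by (simp flip: mult.assoc)
  then show ?thesis unfolding unit_proj_def P_idem[OF assms] .
qed

lemma unit_proj_P: "n \<le> k \<Longrightarrow> unit_proj n * P n = unit_proj n"
  unfolding unit_proj_def using P_idem[of n] by (simp add: mult.assoc)

text \<open>\<open>P k\<close> is the unit of one factor of the product ring and zero in all
  others.\<close>

lemma id_central: "P k * a = a * P k"
proof (rule malg_eqI)
  fix k' and x' :: 'a
  have r: "malg_mult k' x' g (\<lambda>_. 0) = (\<lambda>_. 0)" for g
    by (rule ext) (auto simp: malg_mult_def intro!: sum.neutral)
  show "comp (P k * a) k' x' = comp (a * P k) k' x'"
  proof (cases "k' = k \<and> x' = x")
    case True
    then show ?thesis by (simp add: bP_top comp_times comp_basis malg_mult_scalar)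
  next
    case False
    then have "comp (P k) k' x' = (\<lambda>_. 0)" by (auto simp: bP_top comp_basis)
    then show ?thesis by (simp add: comp_times malg_mult_zero_left r)
  qed
qed

lemma P_top_P: "n \<le> k \<Longrightarrow> P k * P n = P n"
  using bP_mult[of k k n x] by simp

lemma expand_middle:
  assumes "m \<le> k"
  shows "P m * a = (\<Sum>D\<in>diagrams k. scalar (comp a k x D) * (P m * basis k x D))"
proof -
  have "P m * a = P m * (P k * a)" using bP_mult[of m k k x] assms by (simp add: mult.assoc[symmetric])
  then show ?thesis by (simp add: bP_top basis_id_expand sum_distrib_left sc_left)
qed

lemma unit_proj_mid:
  assumes "m \<le> k" "n \<le> k"
  shows "unit_proj m * a * unit_proj n =
    (\<Sum>D\<in>diagrams k. scalar (comp a k x D) * (unit_proj m * (P m * basis k x D * P n) * unit_proj n))"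
proof -
  have "unit_proj m * a * unit_proj n = unit_proj m * (P m * a) * unit_proj n"
    using unit_proj_P[OF assms(1)] by (simp add: mult.assoc[symmetric])
  also have "\<dots> = (\<Sum>D\<in>diagrams k. scalar (comp a k x D) * (unit_proj m * (P m * basis k x D) * unit_proj n))"
    by (subst expand_middle[OF assms(1)]) (simp add: sum_distrib_left sum_distrib_right sc_left mult.assoc)
  also have "\<dots> = (\<Sum>D\<in>diagrams k. scalar (comp a k x D) * (unit_proj m * (P m * basis k x D * P n) * unit_proj n))"
    using P_unit_proj[OF assms(2)] by (simp add: mult.assoc)
  finally show ?thesis .
qed

text \<open>Such an \<open>E\<close> cannot consist of \<open>n\<close> through strands in place, so
  it factors with some \<open>p\<close> or \<open>t\<close> on its right, next to the
  projector.\<close>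

lemma basis_unit_proj_zero:
  assumes "jw_good n" "n \<le> k" "E \<in> diagrams k" "colrel E \<subseteq> Pow {1..m} \<times> Pow {1..n}"
    "m < n \<or> m = n \<and> E \<noteq> dP n"
  shows "basis k x E * unit_proj n = 0"
proof (rule basis_reduce_right[OF assms(3,4,2), of x], goal_cases isolated cap through)
  case (isolated i)
  have "basis k x E * unit_proj n = basis k x E * p i * unit_proj n"
    by (rule arg_cong[OF isolated(3)])
  also have "\<dots> = basis k x E * (p i * jw n) * P n"
    unfolding unit_proj_def by (simp only: mult.assoc)
  finally show ?thesis using assms(1) isolated unfolding jw_good_def by simp
next
  case (cap i a)
  have "basis k x E * unit_proj n = a * (t i * jw n) * P n"
    unfolding unit_proj_def by (simp only: cap(3) mult.assoc)
  then show ?thesis using assms(1) cap unfolding jw_good_def by simp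
next
  case through
  then show ?thesis using assms(5) by simp
qed

lemma unit_proj_basis_zero:
  assumes "jw_good m" "m \<le> k" "E \<in> diagrams k" "colrel E \<subseteq> Pow {1..m} \<times> Pow {1..n}" "n < m"
  shows "unit_proj m * basis k x E = 0"
proof -
  have u: "unit_proj m = P m * jw m" unfolding unit_proj_def using jw_P_comm[of m m] assms(2) by simp
  show ?thesis
  proof (rule basis_reduce_left[OF assms(3,4,2,5), of x], goal_cases isolated cup)
    case (isolated i)
    have "unit_proj m * basis k x E = unit_proj m * (p i * basis k x E)"
      by (rule arg_cong[OF isolated(3)])
    also have "\<dots> = P m * (jw m * p i) * basis k x E"
      unfolding u by (simp only: mult.assoc)
    finally show ?thesis using assms(1) isolated unfolding jw_good_def by simp
  next
    case (cup i a)
    have "unit_proj m * basis k x E = P m * (jw m * t i) * a"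
      unfolding u by (simp only: cup(3) mult.assoc)
    then show ?thesis using assms(1) cup unfolding jw_good_def by simp
  qed
qed

text \<open>A diagram between different numbers of strands has too few through strands for the
  larger projector: if \<open>m < n\<close> it is killed from the right, otherwise from the
  left.\<close>

lemma unit_proj_orthogonal:
  assumes "jw_good m" "jw_good n" "m \<le> k" "n \<le> k" "m \<noteq> n"
  shows "unit_proj m * a * unit_proj n = 0"
proof -
  have "unit_proj m * (P m * basis k x D * P n) * unit_proj n = 0" if D: "D \<in> diagrams k" for D
  proof -
    obtain c E where E: "E \<in> diagrams k" "colrel E \<subseteq> Pow {1..m} \<times> Pow {1..n}"
      "P m * basis k x D * P n = scalar c * basis k x E" using basis_corner[OF D assms(3,4)] .
    have "unit_proj m * basis k x E * unit_proj n = 0"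
    proof (cases "m < n")
      case True
      then show ?thesis using basis_unit_proj_zero[OF assms(2,4) E(1,2)] by (simp add: mult.assoc)
    next
      case False
      then show ?thesis using unit_proj_basis_zero[OF assms(1,3) E(1,2)] assms(5) by simp
    qed
    then show ?thesis unfolding E(3) by (simp add: sc_left mult.assoc)
  qed
  then show ?thesis by (subst unit_proj_mid[OF assms(3,4)]) (simp add: sum.neutral)
qed

lemma unit_proj_idem:
  assumes "jw_good n" "n \<le> k"
  shows "unit_proj n * unit_proj n = unit_proj n"
proof -
  have "unit_proj n * unit_proj n = jw n * (P n * unit_proj n)"
    unfolding unit_proj_def by (simp add: mult.assoc)
  also have "\<dots> = jw n * jw n * P n"
    using P_unit_proj[OF assms(2)] unfolding unit_proj_def by (simp add: mult.assoc)
  finally show ?thesis using assms(1) unfolding jw_good_def unit_proj_def by simp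
qed

text \<open>Among the diagrams of the corner only \<open>dP n\<close> survives next to the
  projector, so the corner consists of scalar multiples: the idempotent is primitive.\<close>

lemma unit_proj_corner:
  assumes "jw_good n" "n \<le> k"
  shows "\<exists>c. unit_proj n * a * unit_proj n = scalar c * unit_proj n"
proof -
  have "\<exists>c. unit_proj n * (P n * basis k x D * P n) * unit_proj n = scalar c * unit_proj n"
    if D: "D \<in> diagrams k" for D
  proof -
    obtain c E where E: "E \<in> diagrams k" "colrel E \<subseteq> Pow {1..n} \<times> Pow {1..n}"
      "P n * basis k x D * P n = scalar c * basis k x E" using basis_corner[OF D assms(2,2)] .
    have eq: "unit_proj n * (P n * basis k x D * P n) * unit_proj n =
        scalar c * (unit_proj n * (basis k x E * unit_proj n))"
      unfolding E(3) by (simp add: sc_left mult.assoc)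
    show ?thesis
    proof (cases "E = dP n")
      case True
      then show ?thesis unfolding eq using P_unit_proj unit_proj_idem assms by auto
    next
      case False
      then have "basis k x E * unit_proj n = 0"
        using basis_unit_proj_zero[OF assms E(1,2)] by simp
      then have "unit_proj n * (P n * basis k x D * P n) * unit_proj n = scalar 0 * unit_proj n"
        unfolding eq using sc_diff[of 0 0] by simp
      then show ?thesis by blast
    qed
  qed
  then obtain c where c: "\<And>D. D \<in> diagrams k \<Longrightarrow>
      unit_proj n * (P n * basis k x D * P n) * unit_proj n = scalar (c D) * unit_proj n" by metis
  have sum: "(\<Sum>D\<in>X. scalar (g D) * unit_proj n) = scalar (\<Sum>D\<in>X. g D) * unit_proj n" for X g
    using sc_diff[of 0 0] by (induction X rule: infinite_finite_induct) (simp_all add: scalar_add distrib_right)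
  have "unit_proj n * a * unit_proj n = (\<Sum>D\<in>diagrams k. scalar (comp a k x D * c D) * unit_proj n)"
    by (subst unit_proj_mid[OF assms(2,2)], intro sum.cong refl) (simp add: c scalar_mult mult.assoc[of "scalar _" "scalar _"])
  then show ?thesis unfolding sum by blast
qed

text \<open>Induction on \<open>n\<close>. Removing the last strand of \<open>P (Suc n)\<close>
  gives \<open>P n\<close>, already in the ideal; conjugation by \<open>dl\<close> and
  \<open>dr\<close> carries this to every \<open>p i\<close>, and
  \<open>t i = t i * p i * t i\<close> carries it to every \<open>t i\<close>. Modulo the ideal
  \<open>jw\<close> therefore acts as 1 on \<open>P (Suc n)\<close>, which becomes congruent to its
  projector.\<close>

lemma P_in_two_sided:
  assumes "n \<le> k"
  shows "P n \<in> two_sided (unit_proj ` {..k})"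
  using assms
proof (induction n)
  case 0
  have "1 * unit_proj 0 * 1 \<in> two_sided (unit_proj ` {..k})" by (rule two_sided.gen) simp
  then show ?case by (simp add: unit_proj_def)
next
  case (Suc n)
  let ?I = "two_sided (unit_proj ` {..k})" and ?N = "Suc n"
  have IH: "P n \<in> ?I" using Suc by simp
  have p: "p i * P ?N \<in> ?I" if "i \<le> ?N" "1 \<le> i" for i
    using that
  proof (induction rule: inc_induct)
    case base
    have "p ?N * P ?N = P (?N - 1)" using Suc.prems by (intro bp_bP_drop) auto
    then show ?case using IH by simp
  next
    case (step i)
    have i: "1 \<le> i" "i < k" "i < ?N" using step Suc.prems by auto
    have "p i * P ?N = basis k x (dl k i) * p (Suc i) * (basis k x (dr k i) * P ?N)"
      by (simp add: bp_conj[OF i(1,2)] flip: mult.assoc)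
    also have "\<dots> = basis k x (dl k i) * (p (Suc i) * P ?N) * basis k x (dr k i)"
      unfolding bP_br_comm[OF i(1,3) Suc.prems] by (simp only: mult.assoc)
    finally have "p i * P ?N = basis k x (dl k i) * (p (Suc i) * P ?N) * basis k x (dr k i)" .
    moreover have "p (Suc i) * P ?N \<in> ?I" using step by simp
    ultimately show ?case by (simp add: two_sided_left two_sided_right)
  qed
  have t: "t i * P ?N \<in> ?I" if "1 \<le> i" "i < ?N" for i
  proof -
    have i: "i < k" using that Suc.prems by simp
    have "t i * P ?N = t i * p i * (t i * P ?N)"
      by (simp add: bt_bp_bt[OF that(1) i] flip: mult.assoc)
    also have "\<dots> = t i * (p i * P ?N) * t i"
      unfolding bP_bt_comm[OF that Suc.prems, symmetric] by (simp only: mult.assoc)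
    finally have "t i * P ?N = t i * (p i * P ?N) * t i" .
    then show ?thesis using p[of i] that by (simp add: two_sided_left two_sided_right)
  qed
  have "(jw m - 1) * P ?N \<in> ?I" if "m \<le> ?N" for m
    using that
  proof (induction m rule: jw.induct)
    case 1
    then show ?case by (simp add: two_sided.zero)
  next
    case 2
    have "0 - p 1 * P ?N \<in> ?I" using p[of 1] by (intro two_sided_diff two_sided.zero) simp
    then show ?case by simp
  next
    case (3 m)
    let ?G = "jw (Suc m)"
    have G: "(?G - 1) * P ?N \<in> ?I" using 3 by simp
    have PG: "P ?N * ?G = ?G * P ?N" using jw_P_comm[of "Suc m" ?N] 3 Suc.prems by simp
    have "(jw (Suc (Suc m)) - 1) * P ?N = (?G - 1) * P ?N - ?G * (p (Suc (Suc m)) * P ?N)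
        - scalar (cheb_u m (x - 1) / cheb_u (Suc m) (x - 1)) * (?G * (t (Suc m) * P ?N) * ?G)"
    proof -
      have "?G * t (Suc m) * ?G * P ?N = ?G * t (Suc m) * (P ?N * ?G)"
        unfolding PG by (simp only: mult.assoc)
      then have "?G * t (Suc m) * ?G * P ?N = ?G * (t (Suc m) * P ?N) * ?G"
        by (simp only: mult.assoc)
      then show ?thesis
        unfolding jw.simps left_diff_distrib right_diff_distrib mult_1 mult_1_right mult.assoc[of "scalar _"]
        by (simp add: mult.assoc)
    qed
    moreover have "p (Suc (Suc m)) * P ?N \<in> ?I" "t (Suc m) * P ?N \<in> ?I"
      using p[of "Suc (Suc m)"] t[of "Suc m"] 3 by auto
    ultimately show ?case
      using G by (simp add: two_sided_diff two_sided_left two_sided_right)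
  qed
  from this[of ?N] have "(jw ?N - 1) * P ?N \<in> ?I" by simp
  moreover have "1 * unit_proj ?N * 1 \<in> ?I" using Suc.prems by (intro two_sided.gen) simp
  ultimately have "unit_proj ?N - (jw ?N - 1) * P ?N \<in> ?I" using two_sided_diff by simp
  moreover have "unit_proj ?N - (jw ?N - 1) * P ?N = P ?N"
    unfolding unit_proj_def by (simp add: left_diff_distrib)
  ultimately show ?case by simp
qed

text \<open>As \<open>P k\<close> acts as a unit and lies in the ideal of the projectors, some
  \<open>unit_proj m * b\<close> does not kill \<open>a * unit_proj n\<close>. Orthogonality forces
  \<open>m = n\<close>, and the corner turns the product into a nonzero multiple of
  \<open>unit_proj n\<close>, which can be inverted.\<close>

lemma unit_proj_minimal:
  assumes good: "\<And>m. m \<le> k \<Longrightarrow> jw_good m" and n: "n \<le> k" and nz: "a * unit_proj n \<noteq> 0"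
  shows "\<exists>c. c * (a * unit_proj n) = unit_proj n"
proof -
  have "P k * unit_proj n = P k * P n * unit_proj n"
    using P_unit_proj[OF n] by (simp only: mult.assoc)
  then have Pk: "P k * unit_proj n = unit_proj n" using P_top_P[OF n] P_unit_proj[OF n] by simp
  have "P k * (a * unit_proj n) = a * (P k * unit_proj n)"
    using id_central[of a] by (simp flip: mult.assoc)
  then have "P k * (a * unit_proj n) \<noteq> 0" using nz Pk by simp
  from two_sided_nonzero[OF P_in_two_sided[OF order_refl] this]
  obtain m b where m: "m \<le> k" and "unit_proj m * b * (a * unit_proj n) \<noteq> 0" by auto
  then have nz': "unit_proj m * (b * a) * unit_proj n \<noteq> 0" by (simp add: mult.assoc)
  then have "m = n" using unit_proj_orthogonal[OF good[OF m] good[OF n] m n] by blast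
  then obtain c where c: "unit_proj n * (b * a) * unit_proj n = scalar c * unit_proj n"
    using unit_proj_corner[OF good[OF n] n] by blast
  have "c \<noteq> 0" using nz' c \<open>m = n\<close> sc_diff[of 0 0] by auto
  have "scalar (1 / c) * unit_proj n * b * (a * unit_proj n) =
      scalar (1 / c) * (unit_proj n * (b * a) * unit_proj n)" by (simp only: mult.assoc)
  also have "\<dots> = scalar (1 / c * c) * unit_proj n"
    unfolding c scalar_mult by (simp only: mult.assoc)
  also have "\<dots> = unit_proj n" using \<open>c \<noteq> 0\<close> by (simp add: scalar_1)
  finally show ?thesis by blast
qed

section \<open>Semisimplicity when no Chebyshev value vanishes\<close>

lemma comp_surj:
  assumes "f \<in> malg_carrier k"
  obtains a where "comp a k x = f"
proof -
  have "comp (Abs_malg (\<lambda>k' x'. if k' = k \<and> x' = x then f else (\<lambda>_. 0))) k x = f"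
    by (subst comp_Abs) (use assms in \<open>auto simp: malg_carrier_def\<close>)
  then show ?thesis by (rule that)
qed

lemma semisimple_if_cheb_nonzero:
  assumes u: "\<And>j. 1 \<le> j \<Longrightarrow> j < k \<Longrightarrow> cheb_u j (x - 1) \<noteq> 0"
  shows "motzkin_semisimple k x"
  unfolding motzkin_semisimple_def
proof (intro allI impI)
  fix L :: "(vtx set set \<Rightarrow> 'a) set"
  assume L: "malg_left_ideal k x L"
  have good: "jw_good m" if "m \<le> k" for m using that u by (intro jw_goodI) auto
  obtain F where F: "finite F" "F \<subseteq> {f * b | f b. f \<in> unit_proj ` {..k}}"
    "\<And>I. left_ideal I \<Longrightarrow> F \<subseteq> I \<Longrightarrow> P k \<in> I"
    using two_sided_finite[OF P_in_two_sided[of k]] by auto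
  \<comment> \<open>This preimage contains everything that vanishes in the factor
    \<open>(k, x)\<close>, so a complement in the product ring projects onto a left ideal that still
    meets \<open>L\<close> only in 0.\<close>
  let ?L = "{a. comp a k x \<in> L}"
  have Li: "left_ideal ?L"
    using L unfolding malg_left_ideal_def left_ideal_def by (auto simp: comp_simps)
  have "\<exists>c. c * (a * h) = h" if h: "h \<in> F" "a * h \<noteq> 0" for h a
  proof -
    obtain n b where nb: "n \<le> k" "h = unit_proj n * b" using h(1) F(2) by auto
    have "a * unit_proj n \<noteq> 0" using h(2) nb(2) by (auto simp flip: mult.assoc)
    then obtain c where "c * (a * unit_proj n) = unit_proj n"
      using unit_proj_minimal[OF good nb(1)] by blast
    then have "c * (a * h) = h" unfolding nb(2) by (metis mult.assoc)
    then show ?thesis by blast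
  qed
  from left_ideal_complement[OF F(1) this Li]
  obtain I where I: "left_ideal I" "?L \<inter> I = {0}" "F \<subseteq> {l + l' | l l'. l \<in> ?L \<and> l' \<in> I}" by blast
  \<comment> \<open>The sum is a left ideal containing \<open>F\<close>, hence contains
    \<open>P k\<close>; decomposing this unit of the factor decomposes every element.\<close>
  have "P k \<in> {l + l' | l l'. l \<in> ?L \<and> l' \<in> I}"
    using F(3)[OF left_ideal_sum[OF Li I(1)] I(3)] .
  then obtain l l' where ll: "P k = l + l'" "comp l k x \<in> L" "l' \<in> I" by blast
  let ?L' = "(\<lambda>a. comp a k x) ` I"
  have "malg_left_ideal k x ?L'"
    unfolding malg_left_ideal_def
  proof (intro conjI ballI)
    show "?L' \<subseteq> malg_carrier k" by auto
    have "comp 0 k x \<in> ?L'" by (rule imageI) (rule left_idealD(1)[OF I(1)])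
    then show "(\<lambda>_. 0) \<in> ?L'" unfolding comp_zero .
  next
    fix f g assume "f \<in> ?L'" "g \<in> ?L'"
    then obtain a b where ab: "f = comp a k x" "g = comp b k x" "a \<in> I" "b \<in> I" by blast
    have "comp (a + b) k x \<in> ?L'" by (rule imageI) (rule left_idealD(2)[OF I(1) ab(3,4)])
    then show "(\<lambda>D. f D + g D) \<in> ?L'" unfolding ab comp_plus .
  next
    fix g :: "vtx set set \<Rightarrow> 'a" and f assume g: "g \<in> malg_carrier k" and "f \<in> ?L'"
    then obtain a where a: "f = comp a k x" "a \<in> I" by blast
    obtain b where b: "comp b k x = g" using comp_surj[OF g] .
    have "comp (b * a) k x \<in> ?L'" by (rule imageI) (rule left_idealD(3)[OF I(1) a(2)])
    then show "malg_mult k x g f \<in> ?L'" unfolding a b[symmetric] comp_times .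
  qed
  moreover have "L \<inter> ?L' = {\<lambda>_. 0}"
  proof
    show "L \<inter> ?L' \<subseteq> {\<lambda>_. 0}"
    proof
      fix y assume "y \<in> L \<inter> ?L'"
      then obtain a where "y = comp a k x" "a \<in> ?L" "a \<in> I" by blast
      moreover from this have "a = 0" using I(2) by blast
      ultimately show "y \<in> {\<lambda>_. 0}" by (simp add: comp_zero)
    qed
    have "comp 0 k x \<in> ?L'" by (rule imageI) (rule left_idealD(1)[OF I(1)])
    then have "(\<lambda>_. 0) \<in> ?L'" unfolding comp_zero .
    then show "{\<lambda>_. 0} \<subseteq> L \<inter> ?L'" using L unfolding malg_left_ideal_def by blast
  qed
  moreover have "\<exists>l\<in>L. \<exists>l'\<in>?L'. f = (\<lambda>D. l D + l' D)" if f: "f \<in> malg_carrier k" for f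
  proof -
    obtain a where a: "comp a k x = f" using comp_surj[OF f] .
    have "comp (a * P k) k x = comp a k x"
      by (simp add: bP_top comp_times comp_basis malg_mult_scalar)
    moreover have "a * P k = a * l + a * l'" using ll(1) by (simp add: distrib_left)
    ultimately have "f = (\<lambda>D. comp (a * l) k x D + comp (a * l') k x D)"
      using a by (simp add: comp_plus)
    moreover have "comp (a * l) k x \<in> L" using left_idealD(3)[OF Li, of l a] ll(2) by simp
    moreover have "comp (a * l') k x \<in> ?L'" using left_idealD(3)[OF I(1) ll(3)] by blast
    ultimately show ?thesis by blast
  qed
  ultimately show "\<exists>L'. malg_left_ideal k x L' \<and> L \<inter> L' = {\<lambda>_. 0} \<and>
      (\<forall>a\<in>malg_carrier k. \<exists>l\<in>L. \<exists>l'\<in>L'. a = (\<lambda>D. l D + l' D))" by blast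
qed

section \<open>Failure of semisimplicity at a Chebyshev zero\<close>

lemma square_zero_not_semisimple:
  assumes sq: "\<And>a. z * a * z = 0" and nz: "comp z k x \<noteq> (\<lambda>_. 0)"
  shows "\<not> motzkin_semisimple k x"
proof
  assume ss: "motzkin_semisimple k x"
  let ?L = "{comp (a * z) k x | a. True}"
  have "malg_left_ideal k x ?L"
    unfolding malg_left_ideal_def
  proof (intro conjI ballI)
    show "?L \<subseteq> malg_carrier k" by auto
    have "comp (0 * z) k x = (\<lambda>_. 0)" by (simp add: comp_zero)
    then show "(\<lambda>_. 0) \<in> ?L" by (metis (mono_tags, lifting) mem_Collect_eq)
  next
    fix f g assume "f \<in> ?L" "g \<in> ?L"
    then obtain a b where "f = comp (a * z) k x" "g = comp (b * z) k x" by blast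
    then have "(\<lambda>D. f D + g D) = comp ((a + b) * z) k x" by (simp add: comp_plus distrib_right)
    then show "(\<lambda>D. f D + g D) \<in> ?L" by blast
  next
    fix g :: "vtx set set \<Rightarrow> 'a" and f assume g: "g \<in> malg_carrier k" and "f \<in> ?L"
    then obtain a where a: "f = comp (a * z) k x" by blast
    obtain b where b: "comp b k x = g" using comp_surj[OF g] .
    have "malg_mult k x g f = comp (b * a * z) k x" unfolding a b[symmetric] mult.assoc comp_times ..
    then show "malg_mult k x g f \<in> ?L" by blast
  qed
  from ss[unfolded motzkin_semisimple_def, rule_format, OF this]
  obtain L' where L': "malg_left_ideal k x L'" "?L \<inter> L' = {\<lambda>_. 0}"
    "\<forall>a\<in>malg_carrier k. \<exists>l\<in>?L. \<exists>l'\<in>L'. a = (\<lambda>D. l D + l' D)" by (elim exE conjE)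
  from bspec[OF L'(3) comp_carrier[of 1 k x]]
  obtain l l' where l: "l \<in> ?L" "l' \<in> L'" "comp 1 k x = (\<lambda>D. l D + l' D)" by (elim bexE)
  obtain a where a: "l = comp (a * z) k x" using l(1) by blast
  \<comment> \<open>Multiplying \<open>1 = l + l'\<close> by \<open>z\<close> on the left kills the
    first part, since \<open>z * a * z = 0\<close>. So \<open>z\<close> equals \<open>z * l'\<close>
    and lies in both ideals.\<close>
  have "comp z k x = comp (z * 1) k x" by simp
  also have "\<dots> = malg_mult k x (comp z k x) (comp 1 k x)" by (rule comp_times)
  also have "\<dots> = (\<lambda>D. malg_mult k x (comp z k x) l D + malg_mult k x (comp z k x) l' D)"
    unfolding l(3) by (rule malg_mult_add_right)
  also have "malg_mult k x (comp z k x) l = comp (z * (a * z)) k x"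
    unfolding a by (rule comp_times[symmetric])
  also have "z * (a * z) = 0" using sq[of a] by (simp only: mult.assoc)
  finally have eq: "comp z k x = (\<lambda>D. malg_mult k x (comp z k x) l' D)"
    unfolding comp_zero add_0_left .
  have "\<forall>a\<in>malg_carrier k. \<forall>f\<in>L'. malg_mult k x a f \<in> L'"
    using L'(1) unfolding malg_left_ideal_def by (elim conjE)
  from bspec[OF bspec[OF this comp_carrier] l(2)]
  have mem: "malg_mult k x (comp z k x) l' \<in> L'" .
  have "comp z k x \<in> L'" by (subst eq) (rule mem)
  moreover have "comp z k x = comp (1 * z) k x" by simp
  then have "comp z k x \<in> ?L" by blast
  ultimately show False using L'(2) nz by blast
qed

text \<open>The domain of a composite relation lies in the domain of its first factor, so a top
  colouring of \<open>D\<close> outside the domain of \<open>colrel E\<close> excludes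
  \<open>D\<close> from every product starting with \<open>E\<close>.\<close>

lemma coeff_left_zero:
  assumes "E \<in> diagrams k" "(S, R) \<in> colrel D" "\<And>M. (S, M) \<notin> colrel E"
  shows "comp (basis k x E * a) k x D = 0"
proof -
  have "compose k E D2 \<noteq> D" if "D2 \<in> diagrams k" for D2
    using assms colrel_compose_diagrams[OF assms(1) that] by blast
  then show ?thesis
    using malg_mult_single_left[OF assms(1), of x 1 "comp a k x" D] assms(1)
    by (simp add: comp_times comp_basis sum.neutral)
qed

lemma coeff_right_zero:
  assumes "E \<in> diagrams k" "(S, R) \<in> colrel D" "\<And>M. (M, R) \<notin> colrel E"
  shows "comp (a * basis k x E) k x D = 0"
proof -
  have "compose k D1 E \<noteq> D" if "D1 \<in> diagrams k" for D1
    using assms colrel_compose_diagrams[OF that assms(1)] by blast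
  then show ?thesis
    using malg_mult_single_right[OF assms(1), of x "comp a k x" 1 D] assms(1)
    by (simp add: comp_times comp_basis sum.neutral)
qed

text \<open>\<open>jw m - 1\<close> is a sum of products that start with some \<open>p i\<close> or
  \<open>t i\<close>, and equally a sum of products that end with one; \<open>D\<close> occurs in
  neither kind.\<close>

lemma jw_coeff_zero:
  assumes "j \<le> k" "m \<le> j"
    and p: "\<And>i a. 1 \<le> i \<Longrightarrow> i \<le> j \<Longrightarrow> comp (p i * a) k x D = 0 \<and> comp (a * p i) k x D = 0"
    and t: "\<And>i a. 1 \<le> i \<Longrightarrow> i < j \<Longrightarrow> comp (t i * a) k x D = 0 \<and> comp (a * t i) k x D = 0"
  shows "comp ((jw m - 1) * a) k x D = 0 \<and> comp (a * (jw m - 1)) k x D = 0"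
  using assms(2)
proof (induction m arbitrary: a rule: jw.induct)
  case 1
  then show ?case by (simp add: comp_zero)
next
  case 2
  then show ?case using p[of 1 a] by (simp add: comp_uminus)
next
  case (3 m)
  let ?G = "jw (Suc m)" and ?p = "p (Suc (Suc m))" and ?t = "t (Suc m)"
  let ?c = "cheb_u m (x - 1) / cheb_u (Suc m) (x - 1)"
  have IH: "comp ((?G - 1) * b) k x D = 0" "comp (b * (?G - 1)) k x D = 0" for b using 3 by auto
  have Gp: "?p * ?G = ?G * ?p" using jw_p_comm[of "Suc m" "Suc (Suc m)"] 3 assms(1) by simp
  \<comment> \<open>Regrouped so that every term starts with \<open>?G - 1\<close>,
    \<open>?p\<close> or \<open>?t\<close>; in the companion identity every term ends with one of
    them.\<close>
  have l: "(jw (Suc (Suc m)) - 1) * a = (?G - 1) * ((1 - ?p) * a) - ?p * a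
      - scalar ?c * ((?G - 1) * (?t * ?G * a) + ?t * (?G * a))"
    by (simp add: algebra_simps)
  have r: "a * (jw (Suc (Suc m)) - 1) = a * (1 - ?p) * (?G - 1) - a * ?p
      - scalar ?c * (a * ?G * ?t * (?G - 1) + a * ?G * ?t)"
    by (simp add: algebra_simps Gp sc_left)
  show ?case unfolding l r
    using IH p[of "Suc (Suc m)"] t[of "Suc m"] 3
    by (simp add: comp_minus comp_plus comp_scalar_mult)
qed

lemma not_semisimple_if_cheb_zero:
  assumes j: "1 \<le> j" "j < k" and zero: "cheb_u j (x - 1) = 0"
    and least: "\<And>i. 1 \<le> i \<Longrightarrow> i < j \<Longrightarrow> cheb_u i (x - 1) \<noteq> 0"
  shows "\<not> motzkin_semisimple k x"
proof (rule square_zero_not_semisimple)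
  let ?n = "Suc j"
  let ?z = "jw j * t j * jw j * P ?n"
  have n: "?n \<le> k" using j by simp
  have good: "jw_good j" "jw_good (j - 1)" using j least by (auto intro!: jw_goodI)
  have "cheb_u (j - 1) (x - 1) \<noteq> 0" using j least[of "j - 1"] by (cases "j = 1") auto
  \<comment> \<open>The partial trace factor is \<open>u j / u (j - 1)\<close>, whose numerator
    vanishes by assumption.\<close>
  then have tGt: "t j * jw j * t j = 0"
    using t_jw_t[OF j good(2)] zero sc_diff[of 0 0] by simp
  have jj: "jw j * jw j = jw j" "\<And>i. 1 \<le> i \<Longrightarrow> i \<le> j \<Longrightarrow> jw j * p i = 0 \<and> p i * jw j = 0"
    "\<And>i. 1 \<le> i \<Longrightarrow> i < j \<Longrightarrow> jw j * t i = 0 \<and> t i * jw j = 0"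
    using good(1) unfolding jw_good_def by auto
  have Pj: "P ?n * jw j = jw j * P ?n" using jw_P_comm[of j ?n] n by simp
  have Pt: "P ?n * t j = t j * P ?n" using bP_bt_comm[of j ?n k x] j n by simp
  have Pj': "P ?n * (jw j * y) = jw j * (P ?n * y)" and Pt': "P ?n * (t j * y) = t j * (P ?n * y)" for y
    using Pj Pt by (simp_all flip: mult.assoc)
  \<comment> \<open>On \<open>Suc j\<close> strands a nonidentity diagram ends in some
    \<open>p i\<close> or \<open>t i\<close>. The projector kills these except for
    \<open>p ?n\<close>, which slides through \<open>t j\<close> to \<open>p j\<close>, and
    \<open>t j\<close>, which produces the vanishing partial trace; so does the identity.\<close>
  have mid: "t j * jw j * (P ?n * basis k x D * P ?n) * jw j * t j = 0" if D: "D \<in> diagrams k" for D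
  proof -
    obtain c E where E: "E \<in> diagrams k" "colrel E \<subseteq> Pow {1..?n} \<times> Pow {1..?n}"
      "P ?n * basis k x D * P ?n = scalar c * basis k x E" using basis_corner[OF D n n] .
    have "t j * jw j * (basis k x E * (jw j * t j)) = 0"
    proof (rule basis_reduce_right[OF E(1,2) n, of x], goal_cases isolated cap through)
      case (isolated i)
      have pz: "p i * (jw j * t j) = 0"
      proof (cases "i = ?n")
        case True
        have "p ?n * (jw j * t j) = jw j * (p ?n * t j)"
          using jw_p_comm[of j ?n] j by (simp flip: mult.assoc)
        also have "\<dots> = jw j * p j * t j" using p_t_slide[OF j] by (simp add: mult.assoc)
        finally show ?thesis using True jj(2)[of j] j by simp
      next
        case False
        then show ?thesis using jj(2)[of i] isolated by (simp flip: mult.assoc)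
      qed
      have "basis k x E * (jw j * t j) = basis k x E * p i * (jw j * t j)"
        by (rule arg_cong[OF isolated(3)])
      then show ?case using pz by (simp add: mult.assoc)
    next
      case (cap i a)
      show ?case
      proof (cases "i = j")
        case True
        have "t j * jw j * (basis k x E * (jw j * t j)) = t j * jw j * a * (t j * jw j * t j)"
          unfolding cap(3) True by (simp only: mult.assoc)
        then show ?thesis using tGt by simp
      next
        case False
        have "t j * jw j * (basis k x E * (jw j * t j)) = t j * jw j * a * (t i * jw j) * t j"
          unfolding cap(3) by (simp only: mult.assoc)
        then show ?thesis using jj(3)[of i] cap False by simp
      qed
    next
      case through
      have "P ?n * (jw j * t j) = jw j * t j * P ?n"
        by (simp only: mult.assoc Pj' Pt)
      then have "t j * jw j * (basis k x E * (jw j * t j)) = t j * (jw j * jw j) * t j * P ?n"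
        using through by (simp add: mult.assoc)
      then show ?case using jj(1) tGt by simp
    qed
    then show ?thesis unfolding E(3) by (simp add: sc_left mult.assoc)
  qed
  show "?z * a * ?z = 0" for a
  proof -
    have zz: "?z = P ?n * (jw j * t j * jw j)"
      by (simp only: mult.assoc Pj Pj' Pt')
    have "?z * a * ?z = ?z * a * (P ?n * (jw j * t j * jw j))" by (rule arg_cong[OF zz])
    also have "\<dots> = jw j * t j * jw j * (P ?n * a) * (P ?n * (jw j * t j * jw j))"
      by (simp only: mult.assoc)
    also have "\<dots> = (\<Sum>D\<in>diagrams k. scalar (comp a k x D) *
        (jw j * (t j * jw j * (P ?n * basis k x D * P ?n) * jw j * t j) * jw j))"
      by (subst expand_middle[OF n, of a])
        (simp add: sum_distrib_left sum_distrib_right sc_left mult.assoc)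
    also have "\<dots> = 0" using mid by (simp add: sum.neutral)
    finally show ?thesis .
  qed
  \<comment> \<open>The leading diagram of \<open>?z\<close>: replacing both projectors by 1 leaves
    \<open>t j * P ?n\<close>, and all other terms have coefficient 0 at this diagram.\<close>
  let ?D = "compose k (dt k j) (dP ?n)"
  have dt: "dt k j \<in> diagrams k" and dP: "dP ?n \<in> diagrams k" using j n by auto
  have D: "?D \<in> diagrams k" using dt dP by (rule compose_diagrams)
  have cD: "(S, R) \<in> colrel ?D \<longleftrightarrow> (S, R) \<in> colrel (dt k j) \<and> R \<subseteq> {1..?n}" for S R
    unfolding colrel_compose_diagrams[OF dt dP] relcomp_unfold mem_Collect_eq prod.case colrel_dP by blast
  \<comment> \<open>Test colourings for the coefficient lemmas. Colouring the single vertical strand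
    \<open>i\<close> is incompatible with \<open>p i\<close> and \<open>t i\<close>; for
    \<open>p j\<close>, the arcs at \<open>j\<close> and \<open>?n\<close> serve instead.\<close>
  have c1: "({i}, {i}) \<in> colrel ?D" if "1 \<le> i" "i < j" for i
    unfolding cD using j that by (auto simp: colrel_dt)
  have c2: "({j, ?n}, {}) \<in> colrel ?D" "({}, {j, ?n}) \<in> colrel ?D"
    unfolding cD using j by (auto simp: colrel_dt)
  have pz: "comp (p i * a) k x ?D = 0 \<and> comp (a * p i) k x ?D = 0" if i: "1 \<le> i" "i \<le> j" for i a
  proof (cases "i = j")
    case True
    have "comp (p j * a) k x ?D = 0" by (rule coeff_left_zero[OF dp_diagram c2(1)]) (simp add: colrel_dp)
    moreover have "comp (a * p j) k x ?D = 0" by (rule coeff_right_zero[OF dp_diagram c2(2)]) (auto simp: colrel_dp)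
    ultimately show ?thesis using True by simp
  next
    case False
    then have c: "({i}, {i}) \<in> colrel ?D" using c1 i by simp
    have "comp (p i * a) k x ?D = 0" by (rule coeff_left_zero[OF dp_diagram c]) (simp add: colrel_dp)
    moreover have "comp (a * p i) k x ?D = 0" by (rule coeff_right_zero[OF dp_diagram c]) (auto simp: colrel_dp)
    ultimately show ?thesis by simp
  qed
  have tz: "comp (t i * a) k x ?D = 0 \<and> comp (a * t i) k x ?D = 0" if i: "1 \<le> i" "i < j" for i a
  proof -
    have ik: "i < k" using i j by simp
    have "comp (t i * a) k x ?D = 0"
      by (rule coeff_left_zero[OF dt_diagram[OF i(1) ik] c1[OF i]]) (simp add: colrel_dt[OF i(1) ik])
    moreover have "comp (a * t i) k x ?D = 0"
      by (rule coeff_right_zero[OF dt_diagram[OF i(1) ik] c1[OF i]]) (simp add: colrel_dt[OF i(1) ik])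
    ultimately show ?thesis by simp
  qed
  have jz: "comp ((jw j - 1) * a) k x ?D = 0" "comp (a * (jw j - 1)) k x ?D = 0" for a
    using jw_coeff_zero[of j j ?D a, OF _ _ pz tz] j by auto
  have "t j * P ?n = basis k x ?D"
  proof -
    have "num_loops k (dt k j) (dP ?n) = 0"
      by (rule num_loops_0I[OF dt dP]) (auto simp: colrel_dP)
    then show ?thesis using basis_mult[OF dt dP, of x] by (simp add: scalar_1)
  qed
  moreover have "?z = t j * P ?n + (jw j - 1) * (t j * jw j * P ?n) + t j * P ?n * (jw j - 1)"
  proof -
    have "t j * P ?n * jw j = t j * jw j * P ?n" using Pj by (simp add: mult.assoc)
    then show ?thesis by (simp add: left_diff_distrib right_diff_distrib mult.assoc)
  qed
  ultimately have "comp ?z k x ?D = comp (basis k x ?D) k x ?D" using jz by (simp add: comp_plus)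
  also have "\<dots> = 1" by (simp add: comp_basis[OF D])
  finally show "comp ?z k x \<noteq> (\<lambda>_. 0)" by auto
qed

end

theorem mainTheorem17:
  fixes k :: nat and x :: "'a::field"
  assumes "k \<ge> 1"
  shows "motzkin_semisimple k x \<longleftrightarrow> (\<forall>j. 1 \<le> j \<and> j \<le> k - 1 \<longrightarrow> cheb_u j (x - 1) \<noteq> 0)"
proof
  assume ss: "motzkin_semisimple k x"
  show "\<forall>j. 1 \<le> j \<and> j \<le> k - 1 \<longrightarrow> cheb_u j (x - 1) \<noteq> 0"
  proof (rule ccontr)
    let ?Q = "\<lambda>j. 1 \<le> j \<and> j \<le> k - 1 \<and> cheb_u j (x - 1) = 0"
    assume "\<not> (\<forall>j. 1 \<le> j \<and> j \<le> k - 1 \<longrightarrow> cheb_u j (x - 1) \<noteq> 0)"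
    then obtain j where j: "?Q j" "\<And>i. i < j \<Longrightarrow> \<not> ?Q i" using exists_least_iff[of ?Q] by blast
    have "\<not> motzkin_semisimple k x"
      by (rule not_semisimple_if_cheb_zero[of j]) (use j assms in auto)
    then show False using ss by contradiction
  qed
next
  assume "\<forall>j. 1 \<le> j \<and> j \<le> k - 1 \<longrightarrow> cheb_u j (x - 1) \<noteq> 0"
  then show "motzkin_semisimple k x" by (intro semisimple_if_cheb_nonzero) auto
qed

end
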